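(* Let $0<p,\alpha<\infty$ and $w\in A^{\mathrm{restricted}}_{\infty}$. Suppose that $g(z)=c_2z^2+c_1z+c_0$ for some $c_0,c_1,c_2\in\mathbb{C}$ with $|c_1|+|c_2|>0$. Then the following conditions are equivalent: (a) $J_g$ has closed range on $F^p_{\alpha,w}$; (b) $J_g$ is bounded below on $F^p_{\alpha,w}$; (c) $c_2\neq0$.
   Context: $dA$ is Lebesgue measure on $\mathbb{C}$. A weight is a non-negative locally integrable function $w$ on $\mathbb{C}$. Squares $Q\subset\mathbb{C}$ have sides parallel to the coordinate axes and side length $\ell(Q)$. For $1<p<\infty$ with conjugate exponent $p'$ ($1/p+1/p'=1$), $A_p^{\mathrm{restricted}}$ is the class of weights $w$ such that for some (equivalently any) fixed $r>0$, $$\sup_{Q:\ell(Q)=r}\Big(\frac{1}{A(Q)}\int_{Q}w\,dA\Big)\Big(\frac{1}{A(Q)}\int_{Q}w^{-p'/p}dA\Big)^{p/p'}<\infty,$$ and $A_1^{\mathrm{restricted}}$ is the class of weights such that for some (equivalently any) fixed $r>0$, $\sup_{Q:\ell(Q)=r}\big(\frac{1}{A(Q)}\int_Q w\,dA\big)\|w^{-1}\|_{L^\infty(Q)}<\infty$ (convention $0\cdot\infty=\infty$, so $w>0$ a.e.). $A_\infty^{\mathrm{restricted}}:=\bigcup_{1\le p<\infty}A_p^{\mathrm{restricted}}$. $F^p_{\alpha,w}$ is the space of entire functions $f$ on $\mathbb{C}$ with $\|f\|^p_{F^p_{\alpha,w}}:=\int_{\mathbb{C}}|f(z)|^pe^{-\frac{p\alpha}{2}|z|^2}w(z)\,dA(z)<\infty$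 (a quasi-norm when $0<p<1$). For an entire function $g$, the Volterra type integration operator $J_g$ is $J_gf(z):=\int_0^zf(\xi)g'(\xi)\,d\xi$ for entire $f$. It is known that for $w\in A^{\mathrm{restricted}}_\infty$, $J_g$ is bounded on $F^p_{\alpha,w}$ if and only if $g$ is a polynomial of degree at most $2$. "Bounded below on $F^p_{\alpha,w}$" means that there is $C>0$ with $\|J_gf\|_{F^p_{\alpha,w}}\ge C\|f\|_{F^p_{\alpha,w}}$ for all $f\in F^p_{\alpha,w}$; "closed range on $F^p_{\alpha,w}$" means that $J_g(F^p_{\alpha,w})$ is a closed subspace of $F^p_{\alpha,w}$. *)

theory Defs
  imports
    "HOL-Complex_Analysis.Complex_Analysis"
    "HOL-Probability.Essential_Supremum"
begin

section \<open>Restricted Muckenhoupt weights\<close>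

definition is_weight :: "(complex \<Rightarrow> real) \<Rightarrow> bool" where
  "is_weight w \<longleftrightarrow> (\<forall>z. 0 \<le> w z) \<and> (\<forall>K. compact K \<longrightarrow> set_integrable lebesgue K w)"

text \<open>The power of an extended non-negative number to an exponent \<open>s > 0\<close>.\<close>

definition ennpowr :: "ennreal \<Rightarrow> real \<Rightarrow> ennreal" where
  "ennpowr x s = (if x = top then top else ennreal (enn2real x powr s))"

text \<open>Multiplication with the convention \<open>0 \<cdot> \<infinity> = \<infinity>\<close>; the library has \<open>0 * \<infinity> = 0\<close>.\<close>

definition mult_top :: "ennreal \<Rightarrow> ennreal \<Rightarrow> ennreal" where
  "mult_top x y = (if x = top \<or> y = top then top else x * y)"

text \<open>The square of side length \<open>r\<close> with lower left corner \<open>a\<close>.\<close>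

definition square :: "complex \<Rightarrow> real \<Rightarrow> complex set" where
  "square a r = cbox a (a + Complex r r)"

definition average :: "complex set \<Rightarrow> (complex \<Rightarrow> ennreal) \<Rightarrow> ennreal" where
  "average Q u = (\<integral>\<^sup>+z\<in>Q. u z \<partial>lebesgue) / emeasure lebesgue Q"

definition conj_exponent :: "real \<Rightarrow> real" where
  "conj_exponent p = p / (p - 1)"

lemma conj_exponent_unique:
  assumes "1 < p"
  shows "1 / p + 1 / q = 1 \<longleftrightarrow> q = conj_exponent p"
  using assms by (cases "q = 0") (auto simp: conj_exponent_def field_simps)

text \<open>The quantity whose supremum over the squares of a fixed size defines the class. The
  inverses are taken in \<^typ>\<open>ennreal\<close>, so that \<open>w\<^sup>-\<^sup>1\<close> and \<open>w\<^sup>-\<^sup>p\<^sup>'\<^sup>/\<^sup>p\<close> are \<open>\<infinity>\<close> where \<open>w = 0\<close>.\<close>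

definition A_quantity :: "real \<Rightarrow> (complex \<Rightarrow> real) \<Rightarrow> complex set \<Rightarrow> ennreal" where
  "A_quantity p w Q =
    (if p = 1 then
       mult_top (average Q (\<lambda>z. ennreal (w z)))
         (esssup (lebesgue_on Q) (\<lambda>z. inverse (ennreal (w z))))
     else let q = conj_exponent p in
       mult_top (average Q (\<lambda>z. ennreal (w z)))
         (ennpowr (average Q (\<lambda>z. inverse (ennreal (w z powr (q / p))))) (p / q)))"

definition A_restricted :: "real \<Rightarrow> (complex \<Rightarrow> real) set" where
  "A_restricted p = {w. is_weight w \<and> (\<exists>r>0. (SUP a. A_quantity p w (square a r)) < top)}"

definition A_inf_restricted :: "(complex \<Rightarrow> real) set" where
  "A_inf_restricted = (\<Union>p\<in>{1..}. A_restricted p)"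

section \<open>Weighted Fock spaces\<close>

definition fock_integral ::
    "real \<Rightarrow> real \<Rightarrow> (complex \<Rightarrow> real) \<Rightarrow> (complex \<Rightarrow> complex) \<Rightarrow> ennreal" where
  "fock_integral p \<alpha> w f =
    (\<integral>\<^sup>+z. ennreal (cmod (f z) powr p * exp (- (p * \<alpha> / 2) * (cmod z)\<^sup>2) * w z) \<partial>lebesgue)"

definition fock_space ::
    "real \<Rightarrow> real \<Rightarrow> (complex \<Rightarrow> real) \<Rightarrow> (complex \<Rightarrow> complex) set" where
  "fock_space p \<alpha> w = {f. f holomorphic_on UNIV \<and> fock_integral p \<alpha> w f < top}"

definition fock_norm ::
    "real \<Rightarrow> real \<Rightarrow> (complex \<Rightarrow> real) \<Rightarrow> (complex \<Rightarrow> complex) \<Rightarrow> ennreal" where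
  "fock_norm p \<alpha> w f = ennpowr (fock_integral p \<alpha> w f) (1 / p)"

text \<open>For \<open>p < 1\<close> only the \<open>p\<close>-th power of the quasi-norm satisfies the triangle inequality;
  it induces the quasi-norm topology.\<close>

definition fock_dist ::
    "real \<Rightarrow> real \<Rightarrow> (complex \<Rightarrow> real) \<Rightarrow> (complex \<Rightarrow> complex) \<Rightarrow> (complex \<Rightarrow> complex) \<Rightarrow> real" where
  "fock_dist p \<alpha> w f h = enn2real (fock_norm p \<alpha> w (\<lambda>z. f z - h z)) powr min 1 p"

definition fock_topology ::
    "real \<Rightarrow> real \<Rightarrow> (complex \<Rightarrow> real) \<Rightarrow> (complex \<Rightarrow> complex) topology" where
  "fock_topology p \<alpha> w = Metric_space.mtopology (fock_space p \<alpha> w) (fock_dist p \<alpha> w)"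

section \<open>The Volterra type integration operator\<close>

definition volterra ::
    "(complex \<Rightarrow> complex) \<Rightarrow> (complex \<Rightarrow> complex) \<Rightarrow> complex \<Rightarrow> complex" where
  "volterra g f z = contour_integral (linepath 0 z) (\<lambda>\<xi>. f \<xi> * deriv g \<xi>)"

definition closed_range_on_fock ::
    "real \<Rightarrow> real \<Rightarrow> (complex \<Rightarrow> real) \<Rightarrow> ((complex \<Rightarrow> complex) \<Rightarrow> complex \<Rightarrow> complex) \<Rightarrow> bool" where
  "closed_range_on_fock p \<alpha> w T \<longleftrightarrow> closedin (fock_topology p \<alpha> w) (T ` fock_space p \<alpha> w)"

definition bounded_below_on_fock ::
    "real \<Rightarrow> real \<Rightarrow> (complex \<Rightarrow> real) \<Rightarrow> ((complex \<Rightarrow> complex) \<Rightarrow> complex \<Rightarrow> complex) \<Rightarrow> bool" where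
  "bounded_below_on_fock p \<alpha> w T \<longleftrightarrow>
    (\<exists>C::real. C > 0 \<and> (\<forall>f\<in>fock_space p \<alpha> w. fock_norm p \<alpha> w (T f) \<ge> ennreal C * fock_norm p \<alpha> w f))"

end

theory Submission
  imports Defs
begin

text \<open>
  Write \<open>\<mu> = w dA\<close>. The only consequence of the \<open>A\<^sub>\<infinity>\<close> condition that matters is that, at one fixed scale \<open>R\<close>,
  \<open>\<mu>(D(z, \<rho>)) \<ge> c \<rho>\<^sup>\<kappa> \<mu>(D(z0, R))\<close> whenever \<open>D(z, \<rho>) \<subseteq> D(z0, R)\<close>; it follows from Chebyshev's inequality. It
  makes \<open>\<mu>\<close> doubling at scale \<open>R\<close>, hence of at most exponential growth, and together with Cauchy's
  estimate it bounds \<open>\<bar>h(z0)\<bar>\<^sup>p \<mu>(D(z0, R))\<close> by the integral of \<open>\<bar>h\<bar>\<^sup>p\<close> over \<open>D(z0, R)\<close> for entire \<open>h\<close>.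

  Consequently a pointwise bound of \<open>\<bar>F1(z)\<bar> exp(-\<alpha>\<bar>z\<bar>\<^sup>2/2)\<close> by some value of \<open>\<bar>F2\<bar> exp(-\<alpha>\<bar>\<cdot>\<bar>\<^sup>2/2)\<close>, damped
  exponentially in the distance to \<open>z\<close>, implies a norm bound. Applied to \<open>F' = f g'\<close>, with
  integration along rays in one direction and Cauchy's estimate and the maximum principle near the
  zero of \<open>g'\<close> in the other, this shows that \<open>J\<^sub>g\<close> is bounded, and bounded below if \<open>c2 \<noteq> 0\<close>; the
  closed range then follows by completeness. If \<open>c2 = 0\<close>, the functions \<open>exp(b z)\<close> for \<open>b \<rightarrow> \<infinity>\<close> show
  that \<open>J\<^sub>g\<close> is not bounded below, and by Baire's theorem an injective \<open>J\<^sub>g\<close> with closed range would be.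
\<close>

section \<open>Mass of squares and discs\<close>

text \<open>Two obstacles shape the proof. The hypothesis controls averages at one scale only, so
  \<open>w dA\<close> need not be comparable to area on small discs, and subharmonicity of |h|^p, a
  statement about area, gives no mean value inequality for this measure directly. Moreover, the
  Gaussian varies without bound over discs of fixed radius far from the origin; this is repaired by
  multiplying with an exponential adapted to the centre of the disc. Differentiating that
  exponential costs a factor 1 + |z| in Cauchy's estimate. For c2 \<noteq> 0 this loss has exactly
  the size of g', which is why dividing by g' restores f; for c2 = 0 nothing compensates it. Since
  all p > 0 are treated together and the spaces are only quasi-normed for p < 1, functions are
  compared through a single value at a chosen point y instead of by duality, and Baire's theorem is
  applied to the metric itself.\<close>

lemma borel_measurable_weight:
  assumes "is_weight w"
  shows "w \<in> borel_measurable lebesgue"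
proof (rule borel_measurable_LIMSEQ_real)
  show "(\<lambda>n. indicat_real (cball 0 (real n)) z * w z) \<longlonglongrightarrow> w z" for z
  proof (rule tendsto_eventually)
    obtain N :: nat where "cmod z \<le> real N" using real_arch_simple by blast
    then have "\<forall>n\<ge>N. indicat_real (cball 0 (real n)) z * w z = w z" by (auto simp: indicator_def)
    then show "\<forall>\<^sub>F n in sequentially. indicat_real (cball 0 (real n)) z * w z = w z"
      unfolding eventually_sequentially by blast
  qed
  show "(\<lambda>z. indicat_real (cball 0 (real n)) z * w z) \<in> borel_measurable lebesgue" for n
  proof -
    have "set_integrable lebesgue (cball 0 (real n)) w"
      using assms unfolding is_weight_def by auto
    then show ?thesis unfolding set_integrable_def by (auto dest: borel_measurable_integrable)
  qed
qed

text \<open>The density is formed over \<open>lebesgue\<close> because \<open>w\<close> is only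
  Lebesgue measurable. Pushing forward to \<open>borel\<close> makes continuity sufficient for
  measurability and lets product measurability be checked on Borel sets.\<close>

definition weight_measure :: "(complex \<Rightarrow> real) \<Rightarrow> complex measure" where
  "weight_measure w = distr (density lebesgue (\<lambda>z. ennreal (w z))) borel (\<lambda>z. z)"

lemma sets_weight_measure [simp, measurable_cong]: "sets (weight_measure w) = sets borel"
  and space_weight_measure [simp]: "space (weight_measure w) = UNIV"
  by (simp_all add: weight_measure_def)

lemma nn_integral_weight_measure:
  assumes "is_weight w" and f [measurable]: "f \<in> borel_measurable borel"
  shows "(\<integral>\<^sup>+z. f z \<partial>weight_measure w) = (\<integral>\<^sup>+z. ennreal (w z) * f z \<partial>lebesgue)"
proof -
  have [measurable]: "w \<in> borel_measurable lebesgue" by (rule borel_measurable_weight[OF assms(1)])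
  have [measurable]: "f \<in> borel_measurable lebesgue" by (rule measurable_completion) simp
  have [measurable]: "(\<lambda>z. z) \<in> measurable lebesgue (borel :: complex measure)"
    by (rule measurable_completion) simp
  show ?thesis
    unfolding weight_measure_def
    by (subst nn_integral_distr) (auto simp: nn_integral_density)
qed

lemma emeasure_weight_measure:
  assumes "is_weight w" "E \<in> sets borel"
  shows "emeasure (weight_measure w) E = (\<integral>\<^sup>+z\<in>E. ennreal (w z) \<partial>lebesgue)"
proof -
  have "emeasure (weight_measure w) E = (\<integral>\<^sup>+z. indicator E z \<partial>weight_measure w)"
    using assms by simp
  also have "\<dots> = (\<integral>\<^sup>+z. ennreal (w z) * indicator E z \<partial>lebesgue)"
    using assms by (intro nn_integral_weight_measure) auto
  finally show ?thesis .
qed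

lemma emeasure_weight_measure_bounded:
  assumes "is_weight w" "bounded E"
  shows "emeasure (weight_measure w) E < top"
proof -
  obtain N where "\<forall>z\<in>E. cmod z \<le> N" using \<open>bounded E\<close> unfolding bounded_iff by blast
  then have N: "E \<subseteq> cball 0 N" by auto
  have "set_integrable lebesgue (cball 0 N) w" using assms unfolding is_weight_def by auto
  then have "(\<integral>\<^sup>+z. ennreal (norm (indicat_real (cball 0 N) z *\<^sub>R w z)) \<partial>lebesgue) < \<infinity>"
    unfolding set_integrable_def integrable_iff_bounded by blast
  also have "(\<lambda>z. ennreal (norm (indicat_real (cball 0 N) z *\<^sub>R w z))) = (\<lambda>z. ennreal (w z) * indicator (cball 0 N) z)"
    using assms(1) by (auto simp: indicator_def is_weight_def fun_eq_iff)
  finally have "emeasure (weight_measure w) (cball 0 N) < top"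
    using assms(1) by (subst emeasure_weight_measure) auto
  moreover have "emeasure (weight_measure w) E \<le> emeasure (weight_measure w) (cball 0 N)"
    by (rule emeasure_mono[OF N]) auto
  ultimately show ?thesis by (rule le_less_trans[rotated])
qed

lemma emeasure_eq_measure_weight:
  assumes "is_weight w" "bounded E"
  shows "emeasure (weight_measure w) E = ennreal (measure (weight_measure w) E)"
  using emeasure_weight_measure_bounded[OF assms] by (simp add: emeasure_eq_ennreal_measure)

text \<open>With \<open>L\<close> the essential supremum of 1/w on \<open>Q\<close>, one has 1 \<le>
  L w almost everywhere on \<open>Q\<close>. Integrating over a subset bounds its area by
  \<open>L\<close> times its mass, and the hypothesis bounds \<open>L\<close> times the mass of
  \<open>Q\<close>.\<close>

lemma A_quantity_1_lower_bound:
  assumes w: "is_weight w" and A: "A_quantity 1 w Q \<le> ennreal M" and M: "0 \<le> M"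
    and Q: "compact Q" "0 < measure lebesgue Q"
    and E: "E \<in> sets borel" "E \<subseteq> Q"
  shows "measure lebesgue E * measure (weight_measure w) Q
      \<le> M * measure lebesgue Q * measure (weight_measure w) E"
    and "0 < measure (weight_measure w) Q"
proof -
  let ?\<mu> = "weight_measure w"
  define L where "L = esssup (lebesgue_on Q) (\<lambda>z. inverse (ennreal (w z)))"
  have [measurable]: "w \<in> borel_measurable lebesgue" by (rule borel_measurable_weight[OF w])
  have Qs: "Q \<in> sets lebesgue" "Q \<in> sets borel" "bounded Q"
    using Q(1) by (auto intro: lmeasurable_compact fmeasurableD borel_compact compact_imp_bounded)
  have EQs: "X \<in> sets lebesgue" "bounded X" if "X \<in> sets borel" "X \<subseteq> Q" for X
    using that Qs by (auto intro: bounded_subset)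
  have fm: "emeasure lebesgue X = ennreal (measure lebesgue X)" if "X \<in> sets borel" "X \<subseteq> Q" for X
    using bounded_set_imp_lmeasurable[OF EQs(2)[OF that] EQs(1)[OF that]] by (simp add: emeasure_eq_measure2)
  have A': "mult_top (average Q (\<lambda>z. ennreal (w z))) L \<le> ennreal M"
    using A by (simp add: A_quantity_def L_def)
  then have Ltop: "L < top" unfolding mult_top_def
    by (auto split: if_splits simp: top.not_eq_extremum top_unique)
  have av: "average Q (\<lambda>z. ennreal (w z)) = emeasure ?\<mu> Q / emeasure lebesgue Q"
    using w Qs by (simp add: average_def emeasure_weight_measure)
  have "AE z in lebesgue_on Q. inverse (ennreal (w z)) \<le> L"
    unfolding L_def by (rule esssup_AE)
  then have ae: "AE z in lebesgue. z \<in> Q \<longrightarrow> inverse (ennreal (w z)) \<le> L"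
    by (subst (asm) AE_restrict_space_iff) (use Qs in auto)
  have ae1: "AE z in lebesgue. z \<in> Q \<longrightarrow> 1 \<le> L * ennreal (w z)"
    using ae
  proof (rule AE_mp, intro AE_I2 impI)
    fix z assume *: "z \<in> Q \<longrightarrow> inverse (ennreal (w z)) \<le> L" and "z \<in> Q"
    then have **: "inverse (ennreal (w z)) \<le> L" by blast
    \<comment> \<open>The inverse of 0 is infinite in \<open>ennreal\<close>, so finiteness of
      \<open>L\<close> excludes zeros of \<open>w\<close>.\<close>
    with Ltop have "w z > 0" by (cases "w z > 0") (auto simp: top_unique ennreal_neg)
    then have "1 = inverse (ennreal (w z)) * ennreal (w z)"
      by (simp add: inverse_ennreal ennreal_mult[symmetric] del: ennreal_1 flip: ennreal_1)
    also have "\<dots> \<le> L * ennreal (w z)" by (rule mult_right_mono[OF **]) simp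
    finally show "1 \<le> L * ennreal (w z)" .
  qed
  have key: "emeasure lebesgue X \<le> L * emeasure ?\<mu> X" if X: "X \<in> sets borel" "X \<subseteq> Q" for X
  proof -
    have "emeasure lebesgue X = (\<integral>\<^sup>+z. indicator X z \<partial>lebesgue)" using EQs[OF X] by simp
    also have "\<dots> \<le> (\<integral>\<^sup>+z. L * (ennreal (w z) * indicator X z) \<partial>lebesgue)"
    proof (rule nn_integral_mono_AE, use ae1 in \<open>rule AE_mp\<close>, intro AE_I2 impI)
      fix z assume *: "z \<in> Q \<longrightarrow> 1 \<le> L * ennreal (w z)"
      show "indicator X z \<le> L * (ennreal (w z) * indicator X z)"
        using * X(2) by (cases "z \<in> X") auto
    qed
    also have "\<dots> = L * emeasure ?\<mu> X"
    proof -
      have [measurable]: "X \<in> sets lebesgue" by (rule EQs[OF X])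
      show ?thesis unfolding emeasure_weight_measure[OF w X(1)] by (rule nn_integral_cmult) measurable
    qed
    finally show ?thesis .
  qed
  have fq: "emeasure lebesgue Q = ennreal (measure lebesgue Q)" by (rule fm) (use Qs in auto)
  have "emeasure lebesgue Q \<le> L * emeasure ?\<mu> Q" by (rule key) (use Qs in auto)
  then have "emeasure ?\<mu> Q \<noteq> 0" using fq Q(2) by auto
  then show "0 < measure ?\<mu> Q"
    using emeasure_eq_measure_weight[OF w Qs(3)] by (simp add: zero_less_measure_iff)
  obtain l where l: "L = ennreal l" "0 \<le> l" using Ltop by (cases L) auto
  have *: "measure ?\<mu> Q / measure lebesgue Q * l \<le> M"
  proof -
    have "emeasure ?\<mu> Q / emeasure lebesgue Q = ennreal (measure ?\<mu> Q / measure lebesgue Q)"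
      using Q(2) by (simp add: fq emeasure_eq_measure_weight[OF w Qs(3)] divide_ennreal)
    moreover from this have "mult_top (average Q (\<lambda>z. ennreal (w z))) L
        = ennreal (measure ?\<mu> Q / measure lebesgue Q * l)"
      using Q(2) l by (simp add: mult_top_def av ennreal_mult'[symmetric])
    ultimately show ?thesis using A' M by (simp add: ennreal_le_iff)
  qed
  have "ennreal (measure lebesgue E) \<le> ennreal (l * measure ?\<mu> E)"
    using key[OF E] l fm[OF E] by (simp add: emeasure_eq_measure_weight[OF w EQs(2)[OF E]] ennreal_mult)
  then have "measure lebesgue E \<le> l * measure ?\<mu> E"
    using l by (simp add: ennreal_le_iff)
  then have "measure lebesgue E * measure ?\<mu> Q \<le> l * measure ?\<mu> E * measure ?\<mu> Q"
    by (rule mult_right_mono) simp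
  also have "\<dots> \<le> M * measure lebesgue Q * measure ?\<mu> E"
  proof -
    have "measure ?\<mu> Q * l \<le> M * measure lebesgue Q" using * Q(2) by (simp add: field_simps)
    from mult_right_mono[OF this, of "measure ?\<mu> E"] show ?thesis by (simp add: mult_ac)
  qed
  finally show "measure lebesgue E * measure (weight_measure w) Q
      \<le> M * measure lebesgue Q * measure (weight_measure w) E" .
qed

text \<open>Split at a level t. Where w \<ge> t, area is at most mass / t; where w < t, it is at
  most \<open>t powr e\<close> times the integral of \<open>w powr (- e)\<close>, which the
  hypothesis controls. Balancing the two contributions gives the power \<open>s\<close>, with a loss
  of \<open>2 powr s\<close>.\<close>

lemma A_quantity_lower_bound:
  assumes w: "is_weight w" and s: "1 < s" and A: "A_quantity s w Q \<le> ennreal M" and M: "0 \<le> M"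
    and Q: "compact Q" "0 < measure lebesgue Q"
    and E: "E \<in> sets borel" "E \<subseteq> Q"
  shows "measure lebesgue E powr s * measure (weight_measure w) Q
      \<le> 2 powr s * M * measure lebesgue Q powr s * measure (weight_measure w) E"
    and "0 < measure (weight_measure w) Q"
proof -
  let ?\<mu> = "weight_measure w"
  \<comment> \<open>The exponent p'/p for p = \<open>s\<close>, so that
    \<open>(s - 1) * e = 1\<close>.\<close>
  define e where "e = 1 / (s - 1)"
  have e: "e > 0" "conj_exponent s / s = e" "s / conj_exponent s = s - 1"
    using s by (auto simp: e_def conj_exponent_def field_simps)
  define B where "B = (\<integral>\<^sup>+z\<in>Q. inverse (ennreal (w z powr e)) \<partial>lebesgue)"
  have [measurable]: "w \<in> borel_measurable lebesgue" by (rule borel_measurable_weight[OF w])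
  have Qs: "Q \<in> sets lebesgue" "Q \<in> sets borel" "bounded Q"
    using Q(1) by (auto intro: lmeasurable_compact fmeasurableD borel_compact compact_imp_bounded)
  have EQs: "X \<in> sets lebesgue" "bounded X" if "X \<in> sets borel" "X \<subseteq> Q" for X
    using that Qs by (auto intro: bounded_subset)
  have fm: "emeasure lebesgue X = ennreal (measure lebesgue X)" if "X \<in> sets borel" "X \<subseteq> Q" for X
    using bounded_set_imp_lmeasurable[OF EQs(2)[OF that] EQs(1)[OF that]] by (simp add: emeasure_eq_measure2)
  have fq: "emeasure lebesgue Q = ennreal (measure lebesgue Q)" by (rule fm) (use Qs in auto)
  have av: "average Q (\<lambda>z. ennreal (w z)) = emeasure ?\<mu> Q / emeasure lebesgue Q"
    using w Qs by (simp add: average_def emeasure_weight_measure)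
  have A': "mult_top (average Q (\<lambda>z. ennreal (w z))) (ennpowr (B / emeasure lebesgue Q) (s - 1)) \<le> ennreal M"
    using A s e by (simp add: A_quantity_def average_def B_def Let_def)
  then have "B / emeasure lebesgue Q \<noteq> top"
    unfolding mult_top_def ennpowr_def by (auto split: if_splits simp: top_unique)
  then have "B \<noteq> top" unfolding fq using Q(2) by (auto simp: ennreal_top_divide)
  then obtain b where b: "B = ennreal b" "0 \<le> b" by (cases B) auto
  have quant: "measure ?\<mu> Q / measure lebesgue Q * (b / measure lebesgue Q) powr (s - 1) \<le> M"
  proof -
    have 1: "emeasure ?\<mu> Q / emeasure lebesgue Q = ennreal (measure ?\<mu> Q / measure lebesgue Q)"
      using Q(2) by (simp add: fq emeasure_eq_measure_weight[OF w Qs(3)] divide_ennreal)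
    have 2: "B / emeasure lebesgue Q = ennreal (b / measure lebesgue Q)"
      using Q(2) b by (simp add: fq divide_ennreal)
    have "mult_top (average Q (\<lambda>z. ennreal (w z))) (ennpowr (B / emeasure lebesgue Q) (s - 1))
       = ennreal (measure ?\<mu> Q / measure lebesgue Q * (b / measure lebesgue Q) powr (s - 1))"
      unfolding av 1 2 mult_top_def ennpowr_def using b by (simp add: ennreal_mult'[symmetric])
    then show ?thesis using A' M by (simp add: ennreal_le_iff)
  qed
  have cheb: "measure lebesgue X \<le> measure ?\<mu> X / t + t powr e * b"
    if X: "X \<in> sets borel" "X \<subseteq> Q" and t: "t > 0" for X t
  proof -
    have "emeasure lebesgue X = (\<integral>\<^sup>+z. indicator X z \<partial>lebesgue)" using EQs[OF X] by simp
    also have "\<dots> \<le> (\<integral>\<^sup>+z. ennreal (1/t) * (ennreal (w z) * indicator X z)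
        + ennreal (t powr e) * (inverse (ennreal (w z powr e)) * indicator Q z) \<partial>lebesgue)"
    proof (rule nn_integral_mono)
      fix z
      consider "z \<notin> X" | "z \<in> X" "t \<le> w z" | "z \<in> X" "w z < t" by linarith
      then show "indicator X z \<le> ennreal (1/t) * (ennreal (w z) * indicator X z)
        + ennreal (t powr e) * (inverse (ennreal (w z powr e)) * indicator Q z)"
      proof cases
        case 2
        then have "ennreal 1 \<le> ennreal (1 / t * w z)" using t by (intro ennreal_leI) simp
        also have "\<dots> = ennreal (1 / t) * ennreal (w z)" using t by (intro ennreal_mult') simp
        finally have "1 \<le> ennreal (1 / t) * ennreal (w z)" by simp
        from add_increasing2[OF _ this] 2 show ?thesis by simp
      next
        case 3
        have wz: "0 \<le> w z" using w by (simp add: is_weight_def)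
        have "(1::ennreal) \<le> ennreal (t powr e) * inverse (ennreal (w z powr e))"
        proof (cases "w z = 0")
          case True
          then show ?thesis using t by (simp add: ennreal_mult_top)
        next
          case False
          then have "w z powr e \<le> t powr e" using 3 wz e by (intro powr_mono2) auto
          then have "ennreal 1 \<le> ennreal (t powr e * inverse (w z powr e))"
            using False wz by (intro ennreal_leI) (simp add: field_simps)
          also have "\<dots> = ennreal (t powr e) * ennreal (inverse (w z powr e))" by (intro ennreal_mult') simp
          also have "ennreal (inverse (w z powr e)) = inverse (ennreal (w z powr e))"
            using False wz by (subst inverse_ennreal) auto
          finally show ?thesis by simp
        qed
        from add_increasing[OF _ this] 3 X show ?thesis by auto
      qed auto
    qed
    also have "\<dots> = ennreal (1/t) * emeasure ?\<mu> X + ennreal (t powr e) * B"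
    proof -
      have [measurable]: "X \<in> sets lebesgue" "Q \<in> sets lebesgue" using EQs[OF X] Qs by auto
      show ?thesis
        unfolding emeasure_weight_measure[OF w X(1)] B_def
        by (subst nn_integral_add, measurable, subst nn_integral_cmult, measurable,
            subst nn_integral_cmult, measurable)
    qed
    also have "\<dots> = ennreal (1 / t * measure ?\<mu> X) + ennreal (t powr e * b)"
      unfolding emeasure_eq_measure_weight[OF w EQs(2)[OF X]] b(1)
      using t by (simp only: ennreal_mult'[symmetric] powr_ge_zero divide_nonneg_pos zero_le_one)
    also have "\<dots> = ennreal (1 / t * measure ?\<mu> X + t powr e * b)"
      using t b by (intro ennreal_plus[symmetric]) auto
    finally show ?thesis using b t unfolding fm[OF X] by (subst (asm) ennreal_le_iff) auto
  qed
  \<comment> \<open>The level chosen below divides by \<open>b\<close>. If \<open>b\<close> were 0,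
    the splitting inequality for \<open>Q\<close> at a sufficiently high level would contradict the
    positive area of \<open>Q\<close>.\<close>
  have bpos: "b > 0"
  proof (rule ccontr)
    assume "\<not> b > 0"
    then have "b = 0" using b by simp
    define t where "t = 2 * measure ?\<mu> Q / measure lebesgue Q + 1"
    have "t > 0" using Q(2) by (simp add: t_def add_nonneg_pos)
    then have "measure lebesgue Q * t \<le> measure ?\<mu> Q"
      using cheb[of Q t] Qs \<open>b = 0\<close> by (simp add: pos_le_divide_eq)
    moreover have "measure lebesgue Q * t = 2 * measure ?\<mu> Q + measure lebesgue Q"
      using Q(2) by (simp add: t_def distrib_left)
    ultimately show False using Q(2) measure_nonneg[of ?\<mu> Q] by linarith
  qed
  have key: "measure lebesgue X powr s \<le> 2 powr s * b powr (s - 1) * measure ?\<mu> X"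
    if X: "X \<in> sets borel" "X \<subseteq> Q" for X
  proof (cases "measure lebesgue X = 0")
    case False
    then have pos: "measure lebesgue X > 0" by (simp add: zero_less_measure_iff)
    \<comment> \<open>This level makes the second contribution exactly half of the area, so the
      first must cover the other half.\<close>
    define t where "t = (measure lebesgue X / (2 * b)) powr (s - 1)"
    have t: "t > 0" "t powr e = measure lebesgue X / (2 * b)"
      using pos bpos s by (auto simp: t_def powr_powr e_def)
    have "measure lebesgue X \<le> measure ?\<mu> X / t + measure lebesgue X / 2"
      using cheb[OF X t(1)] t(2) bpos by simp
    then have "measure lebesgue X / 2 \<le> measure ?\<mu> X / t" by linarith
    then have "measure lebesgue X * t \<le> 2 * measure ?\<mu> X" using t(1) by (simp add: pos_le_divide_eq)
    moreover have "measure lebesgue X * t = measure lebesgue X powr s / (2 * b) powr (s - 1)"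
    proof -
      have "measure lebesgue X powr s = measure lebesgue X powr 1 * measure lebesgue X powr (s - 1)"
        by (subst powr_add[symmetric]) simp
      then show ?thesis unfolding t_def using pos bpos by (subst powr_divide) auto
    qed
    ultimately have "measure lebesgue X powr s / (2 * b) powr (s - 1) \<le> 2 * measure ?\<mu> X" by linarith
    then have "measure lebesgue X powr s \<le> 2 * measure ?\<mu> X * (2 * b) powr (s - 1)"
      using bpos by (subst (asm) pos_divide_le_eq) auto
    also have "(2 * b) powr (s - 1) = 2 powr s / 2 * b powr (s - 1)"
    proof -
      have "(2::real) powr s = 2 powr 1 * 2 powr (s - 1)" by (subst powr_add[symmetric]) simp
      then show ?thesis using bpos by (subst powr_mult) auto
    qed
    finally show ?thesis by (simp add: mult_ac)
  qed simp
  have "0 < measure lebesgue Q powr s" using Q(2) by simp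
  also have "\<dots> \<le> 2 powr s * b powr (s - 1) * measure ?\<mu> Q" using key[of Q] Qs by simp
  finally show "0 < measure ?\<mu> Q" using bpos by (simp add: zero_less_mult_iff)
  have "measure ?\<mu> Q * b powr (s - 1) \<le> M * measure lebesgue Q powr s"
  proof -
    have "measure ?\<mu> Q / measure lebesgue Q * (b / measure lebesgue Q) powr (s - 1)
        = measure ?\<mu> Q * b powr (s - 1) / measure lebesgue Q powr s"
    proof -
      have "measure lebesgue Q powr s = measure lebesgue Q powr 1 * measure lebesgue Q powr (s - 1)"
        by (subst powr_add[symmetric]) simp
      then show ?thesis using Q(2) b by (subst powr_divide) auto
    qed
    then have "measure ?\<mu> Q * b powr (s - 1) / measure lebesgue Q powr s \<le> M" using quant by linarith
    then show ?thesis using Q(2) by (subst (asm) pos_divide_le_eq) auto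
  qed
  then have "2 powr s * measure ?\<mu> E * (measure ?\<mu> Q * b powr (s - 1))
      \<le> 2 powr s * measure ?\<mu> E * (M * measure lebesgue Q powr s)"
    by (rule mult_left_mono) simp
  moreover have "measure lebesgue E powr s * measure ?\<mu> Q
      \<le> 2 powr s * b powr (s - 1) * measure ?\<mu> E * measure ?\<mu> Q"
    by (rule mult_right_mono[OF key[OF E]]) simp
  ultimately show "measure lebesgue E powr s * measure ?\<mu> Q
      \<le> 2 powr s * M * measure lebesgue Q powr s * measure ?\<mu> E" by (simp add: mult_ac)
qed

lemma square_props:
  assumes "r > 0"
  shows "compact (square a r)" "measure lebesgue (square a r) = r\<^sup>2"
    "cball a (r / 2) \<subseteq> square (a - Complex (r / 2) (r / 2)) r"
proof -
  show "compact (square a r)" by (simp add: square_def compact_cbox)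
  show "measure lebesgue (square a r) = r\<^sup>2"
    using assms by (simp add: square_def content_cbox_if Basis_complex_def box_eq_empty inner_complex_def power2_eq_square)
  show "cball a (r / 2) \<subseteq> square (a - Complex (r / 2) (r / 2)) r"
  proof
    fix z assume "z \<in> cball a (r/2)"
    then have "\<bar>Re (a - z)\<bar> \<le> r/2" "\<bar>Im (a - z)\<bar> \<le> r/2"
      using abs_Re_le_cmod[of "a - z"] abs_Im_le_cmod[of "a - z"] by (auto simp: dist_norm)
    then show "z \<in> square (a - Complex (r / 2) (r / 2)) r"
      unfolding square_def in_cbox_complex_iff abs_le_iff by auto
  qed
qed

text \<open>The disc of radius \<open>R = r / 2\<close> fits into a square of side \<open>r\<close>.
  Applying the subset bounds to smaller discs, of area pi \<rho>^2, turns the power \<open>s\<close>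
  of the area into the exponent \<kappa> = 2 s.\<close>

lemma A_inf_restricted_ball_growth:
  assumes "w \<in> A_inf_restricted"
  obtains R c \<kappa> where "R > 0" "c > 0" "\<kappa> > 0" "is_weight w"
    "\<And>z z0 \<rho>. \<rho> > 0 \<Longrightarrow> cball z \<rho> \<subseteq> cball z0 R \<Longrightarrow>
      c * \<rho> powr \<kappa> * measure (weight_measure w) (cball z0 R) \<le> measure (weight_measure w) (cball z \<rho>)"
    "\<And>z. 0 < measure (weight_measure w) (cball z R)"
proof -
  let ?\<mu> = "weight_measure w"
  obtain s r where s: "1 \<le> s" and w: "is_weight w" and r: "r > 0"
    and fin: "(SUP a. A_quantity s w (square a r)) < top"
    using assms by (auto simp: A_inf_restricted_def A_restricted_def)
  obtain M where M: "M \<ge> 0" "(SUP a. A_quantity s w (square a r)) = ennreal M"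
    using fin by (cases "SUP a. A_quantity s w (square a r)") auto
  have AM: "A_quantity s w (square a r) \<le> ennreal M" for a
    unfolding M(2)[symmetric] by (rule SUP_upper) simp
  \<comment> \<open>At fixed side length the area of the square is a constant, so both bounds take
    one common form. The summand 1 in the constants below gives positivity without a discussion of M
    = 0.\<close>
  have "\<exists>C>0. \<forall>a E. E \<in> sets borel \<longrightarrow> E \<subseteq> square a r \<longrightarrow>
     measure lebesgue E powr s * measure ?\<mu> (square a r) \<le> C * measure ?\<mu> E \<and> 0 < measure ?\<mu> (square a r)"
  proof (cases "s = 1")
    case True
    have "measure lebesgue E powr s * measure ?\<mu> (square a r) \<le> (M * r\<^sup>2 + 1) * measure ?\<mu> E \<and> 0 < measure ?\<mu> (square a r)"
      if "E \<in> sets borel" "E \<subseteq> square a r" for a E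
    proof -
      note * = A_quantity_1_lower_bound[OF w AM[unfolded True] M(1) _ _ that]
      have "M * r\<^sup>2 * measure ?\<mu> E \<le> (M * r\<^sup>2 + 1) * measure ?\<mu> E" by (rule mult_right_mono) auto
      then show ?thesis using * square_props(1,2)[OF r, of a] r True by auto
    qed
    moreover have "M * r\<^sup>2 + 1 > 0" using M by (simp add: add_nonneg_pos)
    ultimately show ?thesis by blast
  next
    case False
    then have s': "1 < s" using s by simp
    let ?C = "2 powr s * M * (r\<^sup>2) powr s"
    have "measure lebesgue E powr s * measure ?\<mu> (square a r) \<le> (?C + 1) * measure ?\<mu> E \<and> 0 < measure ?\<mu> (square a r)"
      if "E \<in> sets borel" "E \<subseteq> square a r" for a E
    proof -
      note * = A_quantity_lower_bound[OF w s' AM M(1) _ _ that]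
      have "?C * measure ?\<mu> E \<le> (?C + 1) * measure ?\<mu> E" by (rule mult_right_mono) auto
      then show ?thesis using * square_props(1,2)[OF r, of a] r by auto
    qed
    moreover have "?C + 1 > 0" using M by (simp add: add_nonneg_pos)
    ultimately show ?thesis by blast
  qed
  then obtain C where C: "C > 0"
    and *: "\<And>a E. E \<in> sets borel \<Longrightarrow> E \<subseteq> square a r \<Longrightarrow>
     measure lebesgue E powr s * measure ?\<mu> (square a r) \<le> C * measure ?\<mu> E \<and> 0 < measure ?\<mu> (square a r)"
    by blast
  have CE: "measure lebesgue E powr s * measure ?\<mu> (square a r) \<le> C * measure ?\<mu> E"
    if "E \<in> sets borel" "E \<subseteq> square a r" for a E using *[OF that] by blast
  have pos: "0 < measure ?\<mu> (square a r)" for a using *[of "{}" a] by simp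
  define R where "R = r / 2"
  have area: "Sigma_Algebra.measure lborel (cball z \<rho>) = pi * \<rho>\<^sup>2" if "\<rho> > 0" for z :: complex and \<rho>
    using that content_cball[of \<rho> z] by (simp add: unit_ball_vol_2)
  have growth: "(pi powr s / C) * \<rho> powr (2 * s) * measure ?\<mu> (cball z0 R) \<le> measure ?\<mu> (cball z \<rho>)"
    if \<rho>: "\<rho> > 0" and sub: "cball z \<rho> \<subseteq> cball z0 R" for z z0 \<rho>
  proof -
    let ?Q = "square (z0 - Complex (r / 2) (r / 2)) r"
    have sq: "cball z0 R \<subseteq> ?Q" unfolding R_def by (rule square_props(3)[OF r])
    have "measure ?\<mu> (cball z0 R) \<le> measure ?\<mu> ?Q"
    proof (rule measure_mono_fmeasurable[OF sq])
      have "compact ?Q" by (rule square_props(1)[OF r])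
      then show "?Q \<in> fmeasurable ?\<mu>"
        using emeasure_weight_measure_bounded[OF w, of ?Q]
        by (intro fmeasurableI) (auto intro: borel_compact compact_imp_bounded)
    qed simp
    then have "measure lebesgue (cball z \<rho>) powr s * measure ?\<mu> (cball z0 R)
        \<le> measure lebesgue (cball z \<rho>) powr s * measure ?\<mu> ?Q"
      by (rule mult_left_mono) simp
    also have "\<dots> \<le> C * measure ?\<mu> (cball z \<rho>)"
      using sub sq by (intro CE) auto
    also have "measure lebesgue (cball z \<rho>) powr s = pi powr s * \<rho> powr (2 * s)"
      using \<rho> by (simp add: area powr_mult power2_eq_square powr_add[symmetric])
    finally show ?thesis using C by (simp add: pos_divide_le_eq mult_ac)
  qed
  show ?thesis
  proof (rule that)
    show "R > 0" "pi powr s / C > 0" "2 * s > 0" "is_weight w" using r C s w by (auto simp: R_def)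
    show "(pi powr s / C) * \<rho> powr (2 * s) * measure ?\<mu> (cball z0 R) \<le> measure ?\<mu> (cball z \<rho>)"
      if "\<rho> > 0" "cball z \<rho> \<subseteq> cball z0 R" for z z0 \<rho> by (rule growth[OF that])
    show "0 < measure ?\<mu> (cball z R)" for z
    proof -
      have "0 < measure lebesgue (cball z R) powr s * measure ?\<mu> (square (z - Complex (r / 2) (r / 2)) r)"
        using pos[of "z - Complex (r / 2) (r / 2)"] r area[of R z] by (simp add: R_def)
      also have "\<dots> \<le> C * measure ?\<mu> (cball z R)"
        using square_props(3)[OF r, of z] by (intro CE) (auto simp: R_def)
      finally show ?thesis using C by (simp add: zero_less_mult_iff)
    qed
  qed
qed

section \<open>Doubling and local point bounds\<close>

locale ball_growth =
  fixes w :: "complex \<Rightarrow> real" and R c \<kappa> :: real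
  assumes weight: "is_weight w"
    and R_pos: "R > 0" and c_pos: "c > 0" and \<kappa>_pos: "\<kappa> > 0"
    and growth: "\<And>z z0 \<rho>. \<rho> > 0 \<Longrightarrow> cball z \<rho> \<subseteq> cball z0 R \<Longrightarrow>
      c * \<rho> powr \<kappa> * measure (weight_measure w) (cball z0 R) \<le> measure (weight_measure w) (cball z \<rho>)"
    and mass_pos': "\<And>z. 0 < measure (weight_measure w) (cball z R)"
begin

abbreviation \<mu> :: "complex measure" where "\<mu> \<equiv> weight_measure w"

section \<open>Doubling at scale R and exponential growth\<close>

definition mass :: "complex \<Rightarrow> real" where "mass z = measure \<mu> (cball z R)"

lemma mass_pos: "0 < mass z"
  unfolding mass_def by (rule mass_pos')

lemma emeasure_bounded: "bounded E \<Longrightarrow> emeasure \<mu> E = ennreal (measure \<mu> E)"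
  by (rule emeasure_eq_measure_weight[OF weight])

lemma measure_cball_mono:
  assumes "cball a s \<subseteq> cball b t"
  shows "measure \<mu> (cball a s) \<le> measure \<mu> (cball b t)"
  using assms emeasure_weight_measure_bounded[OF weight, of "cball b t"]
  by (intro measure_mono_fmeasurable fmeasurableI) auto

definition K :: real where "K = max 1 (1 / (c * (R / 2) powr \<kappa>))"

lemma K_ge_1: "1 \<le> K" by (simp add: K_def)

text \<open>The disc of radius R/2 about the midpoint lies in both discs: \<open>growth\<close>
  bounds its mass from below by that of the first, monotonicity from above by that of the
  second.\<close>

lemma mass_le_neighbour:
  assumes "dist z z' \<le> R"
  shows "mass z \<le> K * mass z'"
proof -
  define u where "u = midpoint z z'"
  have "dist u z \<le> R / 2" "dist u z' \<le> R / 2"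
    using assms by (auto simp: u_def dist_midpoint)
  moreover have "cball u (R / 2) \<subseteq> cball v R" if "dist u v \<le> R / 2" for v
  proof
    fix x assume "x \<in> cball u (R / 2)"
    then show "x \<in> cball v R" using that dist_triangle3[of v x u] by simp
  qed
  ultimately have sub: "cball u (R / 2) \<subseteq> cball z R" "cball u (R / 2) \<subseteq> cball z' R" by blast+
  have "c * (R / 2) powr \<kappa> * mass z \<le> measure \<mu> (cball u (R / 2))"
    unfolding mass_def using R_pos by (intro growth sub) simp
  also have "\<dots> \<le> mass z'" unfolding mass_def by (rule measure_cball_mono[OF sub(2)])
  finally have "mass z \<le> 1 / (c * (R / 2) powr \<kappa>) * mass z'"
    using c_pos R_pos by (simp add: pos_le_divide_eq mult.commute)
  also have "\<dots> \<le> K * mass z'" using mass_pos[of z'] by (intro mult_right_mono) (auto simp: K_def)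
  finally show ?thesis .
qed

lemma mass_le_chain:
  assumes "dist z z' \<le> real n * R"
  shows "mass z \<le> K ^ n * mass z'"
  using assms
proof (induction n arbitrary: z')
  case 0
  then show ?case by simp
next
  case (Suc n)
  \<comment> \<open>The first of \<open>Suc n\<close> equal steps along the segment from
    \<open>z'\<close> to \<open>z\<close>; the remaining \<open>n\<close> steps are left to the
    induction hypothesis.\<close>
  define v where "v = z' + of_real (1 / real (Suc n)) * (z - z')"
  have "dist v z' = dist z z' / real (Suc n)"
    by (simp add: v_def dist_norm norm_mult norm_divide del: of_nat_Suc)
  also have "\<dots> \<le> R" using Suc.prems by (simp add: divide_le_eq mult.commute del: of_nat_Suc)
  finally have 1: "dist v z' \<le> R" .
  have "z - v = of_real (real n / real (Suc n)) * (z - z')"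
  proof -
    have "real n / real (Suc n) = 1 - 1 / real (Suc n)" by (simp add: field_simps)
    then have "(of_real (real n / real (Suc n)) :: complex) = 1 - of_real (1 / real (Suc n))"
      by (simp only: of_real_diff of_real_1)
    then show ?thesis unfolding v_def by (simp only: left_diff_distrib) simp
  qed
  then have "dist z v = real n / real (Suc n) * dist z z'"
    unfolding dist_norm by (simp add: norm_mult del: of_nat_Suc of_real_divide)
  also have "\<dots> \<le> real n / real (Suc n) * (real (Suc n) * R)"
    using Suc.prems by (intro mult_left_mono) auto
  also have "\<dots> = real n * R" by (simp del: of_nat_Suc)
  finally have "mass z \<le> K ^ n * mass v" by (rule Suc.IH)
  also have "\<dots> \<le> K ^ n * (K * mass z')"
    using mass_le_neighbour[OF 1] K_ge_1 by (intro mult_left_mono) auto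
  finally show ?case by (simp add: mult_ac)
qed

text \<open>Enlarging the radius by \<open>R\<close> costs a fixed factor. Finitely many translates
  of the smaller disc cover the larger one, with centres moved by at most 2R, and comparing the
  masses at these centres costs \<open>K\<^sup>2\<close> each. Hence \<open>L\<close> is built from
  \<open>card P\<close> and \<open>K\<^sup>2\<close>.\<close>

lemma measure_cball_growth:
  obtains L where "1 \<le> L" "\<And>n \<xi>. measure \<mu> (cball \<xi> (real (Suc n) * R)) \<le> L ^ n * mass \<xi>"
proof -
  have cov: "cball (0::complex) (2 * R) \<subseteq> (\<Union>p\<in>cball 0 (2 * R). ball p R)" using R_pos by auto
  obtain P where P: "P \<subseteq> cball (0::complex) (2 * R)" "finite P" "cball 0 (2 * R) \<subseteq> (\<Union>p\<in>P. ball p R)"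
    by (rule compactE_image[OF compact_cball open_ball cov])
  have near: "\<exists>p\<in>P. cmod (u - p) < R" if "cmod u \<le> 2 * R" for u
  proof -
    have "u \<in> (\<Union>p\<in>P. ball p R)" using that P(3) by (intro subsetD[OF P(3)]) simp
    then show ?thesis by (auto simp: dist_norm norm_minus_commute)
  qed
  define L where "L = real (card P) * K\<^sup>2 + 1"
  have L: "1 \<le> L" by (simp add: L_def)
  have "measure \<mu> (cball \<xi> (real (Suc n) * R)) \<le> L ^ n * mass \<xi>" for n \<xi>
  proof (induction n arbitrary: \<xi>)
    case 0
    then show ?case by (simp add: mass_def)
  next
    case (Suc n)
    have cover: "cball \<xi> (real (Suc (Suc n)) * R) \<subseteq> (\<Union>p\<in>P. cball (\<xi> + p) (real (Suc n) * R))"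
    proof
      fix z assume "z \<in> cball \<xi> (real (Suc (Suc n)) * R)"
      then have z: "cmod (z - \<xi>) \<le> real (Suc (Suc n)) * R" by (simp add: dist_norm norm_minus_commute)
      show "z \<in> (\<Union>p\<in>P. cball (\<xi> + p) (real (Suc n) * R))"
      proof (cases "cmod (z - \<xi>) \<le> 2 * R")
        case True
        then obtain p where p: "p \<in> P" "cmod (z - \<xi> - p) < R" using near by blast
        have "R \<le> real (Suc n) * R" using R_pos by simp
        with p have "dist (\<xi> + p) z \<le> real (Suc n) * R"
          by (simp add: dist_norm norm_minus_commute[of "\<xi> + p"] diff_diff_eq)
        with p show ?thesis by auto
      next
        case False
        \<comment> \<open>\<open>v\<close> is the vector of length 2R pointing from \<xi> to
          \<open>z\<close>. Removing it leaves length at most \<open>n * R\<close>, and replacing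
          \<open>v\<close> by a point of the net \<open>P\<close> adds at most
          \<open>R\<close>.\<close>
        define t where "t = 2 * R / cmod (z - \<xi>)"
        have "0 < cmod (z - \<xi>)" using False R_pos by linarith
        then have t: "0 < t" "t < 1" using False R_pos by (auto simp: t_def divide_less_eq)
        define v where "v = of_real t * (z - \<xi>)"
        have "cmod v = t * cmod (z - \<xi>)" using t by (simp only: v_def norm_mult norm_of_real abs_of_pos)
        then have nv: "cmod v = 2 * R" using \<open>0 < cmod (z - \<xi>)\<close> unfolding t_def by auto
        then obtain p where p: "p \<in> P" "cmod (v - p) < R" using near[of v] by auto
        have "cmod (z - \<xi> - v) = cmod (of_real (1 - t) * (z - \<xi>))" by (simp add: v_def algebra_simps)
        also have "\<dots> = cmod (z - \<xi>) - cmod v"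
          using t by (simp only: norm_mult norm_of_real v_def) (simp add: algebra_simps)
        also have "\<dots> \<le> real n * R" using z nv by (simp add: algebra_simps)
        finally have 1: "cmod (z - \<xi> - v) \<le> real n * R" .
        have "cmod (z - (\<xi> + p)) \<le> cmod (z - \<xi> - v) + cmod (v - p)"
          using norm_triangle_ineq[of "z - \<xi> - v" "v - p"] by (simp add: algebra_simps)
        also have "\<dots> \<le> real (Suc n) * R" using 1 p by (simp add: algebra_simps)
        finally show ?thesis using p by (auto simp: dist_norm norm_minus_commute)
      qed
    qed
    have "measure \<mu> (cball \<xi> (real (Suc (Suc n)) * R)) \<le> measure \<mu> (\<Union>p\<in>P. cball (\<xi> + p) (real (Suc n) * R))"
    proof (rule measure_mono_fmeasurable[OF cover])
      have "compact (\<Union>p\<in>P. cball (\<xi> + p) (real (Suc n) * R))" by (intro compact_UN P(2) compact_cball)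
      then show "(\<Union>p\<in>P. cball (\<xi> + p) (real (Suc n) * R)) \<in> fmeasurable \<mu>"
        using emeasure_weight_measure_bounded[OF weight compact_imp_bounded]
        by (intro fmeasurableI) (simp_all only: sets_weight_measure borel_compact infinity_ennreal_def)
    qed simp
    also have "\<dots> \<le> (\<Sum>p\<in>P. measure \<mu> (cball (\<xi> + p) (real (Suc n) * R)))"
      by (rule measure_UNION_le[OF P(2)]) simp
    also have "\<dots> \<le> (\<Sum>p\<in>P. L ^ n * (K\<^sup>2 * mass \<xi>))"
    proof (rule sum_mono)
      fix p assume "p \<in> P"
      then have "dist (\<xi> + p) \<xi> \<le> real 2 * R" using P(1) by (auto simp: dist_norm)
      then have "mass (\<xi> + p) \<le> K\<^sup>2 * mass \<xi>" by (rule mass_le_chain)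
      then have "L ^ n * mass (\<xi> + p) \<le> L ^ n * (K\<^sup>2 * mass \<xi>)"
        using L by (intro mult_left_mono) auto
      with Suc.IH[of "\<xi> + p"] show "measure \<mu> (cball (\<xi> + p) (real (Suc n) * R)) \<le> L ^ n * (K\<^sup>2 * mass \<xi>)"
        by linarith
    qed
    also have "\<dots> = (real (card P) * K\<^sup>2) * (L ^ n * mass \<xi>)" by simp
    also have "\<dots> \<le> L * (L ^ n * mass \<xi>)"
      using L mass_pos[of \<xi>] by (intro mult_right_mono) (auto simp: L_def)
    finally show ?case by (simp add: mult_ac)
  qed
  then show ?thesis using that L by blast
qed

text \<open>The rate is chosen so that each further annulus of width \<open>R\<close> contributes
  the factor 1/(2L), against growth by at most \<open>L\<close>. The ratio 1/2 of the resulting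
  geometric series explains the constant 2.\<close>

lemma exp_decay_integral:
  obtains \<Lambda> where "\<Lambda> > 0"
    "\<And>\<xi>. (\<integral>\<^sup>+z. ennreal (exp (- \<Lambda> * dist z \<xi>)) \<partial>\<mu>) \<le> ennreal (2 * mass \<xi>)"
proof -
  obtain L where L: "1 \<le> L" and gr: "\<And>n \<xi>. measure \<mu> (cball \<xi> (real (Suc n) * R)) \<le> L ^ n * mass \<xi>"
    using measure_cball_growth by blast
  define \<Lambda> where "\<Lambda> = ln (2 * L) / R"
  have \<Lambda>: "\<Lambda> > 0" using L R_pos by (simp add: \<Lambda>_def)
  define q where "q = 1 / (2 * L)"
  have q: "0 < q" using L by (simp add: q_def)
  have eq: "exp (- \<Lambda> * (real n * R)) = q ^ n" for n
  proof -
    have "exp (- \<Lambda> * (real n * R)) = exp (real n * (- ln (2 * L)))" using R_pos by (simp add: \<Lambda>_def)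
    also have "\<dots> = exp (- ln (2 * L)) ^ n" by (rule exp_of_nat_mult)
    also have "exp (- ln (2 * L)) = q" using L by (simp add: exp_minus q_def inverse_eq_divide)
    finally show ?thesis .
  qed
  have "(\<integral>\<^sup>+z. ennreal (exp (- \<Lambda> * dist z \<xi>)) \<partial>\<mu>) \<le> ennreal (2 * mass \<xi>)" for \<xi>
  proof -
    have "(\<integral>\<^sup>+z. ennreal (exp (- \<Lambda> * dist z \<xi>)) \<partial>\<mu>)
        \<le> (\<integral>\<^sup>+z. (\<Sum>n. ennreal (q ^ n) * indicator (cball \<xi> (real (Suc n) * R)) z) \<partial>\<mu>)"
    proof (rule nn_integral_mono)
      fix z
      define n where "n = nat \<lfloor>dist z \<xi> / R\<rfloor>"
      have "0 \<le> dist z \<xi> / R" using R_pos by simp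
      then have "real n \<le> dist z \<xi> / R" "dist z \<xi> / R \<le> real (Suc n)"
        unfolding n_def by linarith+
      then have n: "real n * R \<le> dist z \<xi>" "dist z \<xi> \<le> real (Suc n) * R"
        using R_pos by (auto simp: pos_le_divide_eq pos_divide_le_eq)
      have "- \<Lambda> * dist z \<xi> \<le> - \<Lambda> * (real n * R)" using n \<Lambda> by simp
      then have "exp (- \<Lambda> * dist z \<xi>) \<le> q ^ n" unfolding eq[symmetric] by simp
      then have "ennreal (exp (- \<Lambda> * dist z \<xi>)) \<le> ennreal (q ^ n) * indicator (cball \<xi> (real (Suc n) * R)) z"
        using n(2) by (simp add: dist_commute ennreal_leI del: of_nat_Suc)
      also have "\<dots> \<le> (\<Sum>n. ennreal (q ^ n) * indicator (cball \<xi> (real (Suc n) * R)) z)"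
      proof -
        define F where "F n = ennreal (q ^ n) * indicator (cball \<xi> (real (Suc n) * R)) z" for n
        have "F n \<le> suminf F" using sum_le_suminf[OF summableI, of "{n}" F] by simp
        then show ?thesis unfolding F_def .
      qed
      finally show "ennreal (exp (- \<Lambda> * dist z \<xi>))
          \<le> (\<Sum>n. ennreal (q ^ n) * indicator (cball \<xi> (real (Suc n) * R)) z)" .
    qed
    also have "\<dots> = (\<Sum>n. ennreal (q ^ n) * emeasure \<mu> (cball \<xi> (real (Suc n) * R)))"
    proof -
      have "(\<lambda>z. ennreal (q ^ n) * indicator (cball \<xi> (real (Suc n) * R)) z) \<in> borel_measurable \<mu>" for n
        by (intro borel_measurable_times_ennreal borel_measurable_const borel_measurable_indicator) simp
      from nn_integral_suminf[OF this] show ?thesis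
        by (simp only: nn_integral_cmult_indicator sets_weight_measure borel_closed closed_cball)
    qed
    also have "\<dots> \<le> (\<Sum>n. ennreal ((1/2) ^ n * mass \<xi>))"
    proof (rule suminf_le)
      fix n
      have "q ^ n * measure \<mu> (cball \<xi> (real (Suc n) * R)) \<le> q ^ n * (L ^ n * mass \<xi>)"
        using gr q by (intro mult_left_mono) auto
      also have "\<dots> = (q * L) ^ n * mass \<xi>" by (simp add: power_mult_distrib)
      also have "q * L = 1 / 2" using L by (simp add: q_def)
      finally show "ennreal (q ^ n) * emeasure \<mu> (cball \<xi> (real (Suc n) * R)) \<le> ennreal ((1/2) ^ n * mass \<xi>)"
        using q by (simp add: emeasure_bounded ennreal_mult'[symmetric] ennreal_leI del: of_nat_Suc)
    qed auto
    also have "\<dots> = ennreal (2 * mass \<xi>)"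
    proof (rule suminf_ennreal_eq)
      show "(\<lambda>n. (1/2) ^ n * mass \<xi>) sums (2 * mass \<xi>)"
        using sums_mult2[OF geometric_sums[of "1/2::real"], of "mass \<xi>"] by simp
    qed (use mass_pos[of \<xi>] in auto)
    finally show ?thesis .
  qed
  then show ?thesis using that \<Lambda> by blast
qed

text \<open>Maximizing \<open>(R - \<bar>z - z0\<bar>)\<^sup>\<kappa>\<^sup>/\<^sup>p \<bar>h z\<bar>\<close> over the disc yields a point around which \<open>\<bar>h\<bar>\<close> is
  comparable to its maximum on a disc of radius proportional to the distance \<open>d\<close> to the boundary;
  the weight in the maximum compensates for the loss \<open>d\<^sup>\<kappa>\<close> in the mass of that disc.\<close>

lemma sub_mean_value:
  assumes p: "p > 0"
  obtains C where "C > 0" "\<And>h z0. h holomorphic_on UNIV \<Longrightarrow>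
    ennreal (cmod (h z0) powr p * mass z0) \<le> ennreal C * (\<integral>\<^sup>+z\<in>cball z0 R. ennreal (cmod (h z) powr p) \<partial>\<mu>)"
proof -
  define k where "k = \<kappa> / p"
  have k: "k > 0" using p \<kappa>_pos by (simp add: k_def)
  \<comment> \<open>At the maximizing point |h| equals 4 \<theta> A, where \<open>A\<close> bounds
    |h| on the disc of radius \<open>d\<close> about it. The derivative bound 2A/d changes this by
    at most 2 \<theta> A over a distance \<theta> d, so half the value survives; \<theta> \<le> 1/4
    keeps that disc where the derivative bound holds.\<close>
  define \<theta> where "\<theta> = 2 powr - k / 4"
  have "2 powr - k \<le> (2::real) powr 0" using k by (intro powr_mono) auto
  then have \<theta>: "0 < \<theta>" "\<theta> \<le> 1 / 4" by (auto simp: \<theta>_def)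
  define C where "C = 1 / (R powr \<kappa> * (2 * \<theta>) powr p * c * \<theta> powr \<kappa>)"
  have C: "C > 0" using \<theta> c_pos R_pos by (simp add: C_def)
  have main: "ennreal (cmod (h z0) powr p * mass z0) \<le> ennreal C * (\<integral>\<^sup>+z\<in>cball z0 R. ennreal (cmod (h z) powr p) \<partial>\<mu>)"
    if hol: "h holomorphic_on UNIV" for h z0
  proof (cases "h z0 = 0")
    case True
    then show ?thesis by simp
  next
    case False
    have conth: "continuous_on A h" for A
      using hol by (meson holomorphic_on_imp_continuous_on holomorphic_on_subset subset_UNIV)
    define \<phi> where "\<phi> z = (R - dist z z0) powr k * cmod (h z)" for z
    have "continuous_on (cball z0 R) \<phi>"
      unfolding \<phi>_def using k by (intro continuous_intros continuous_on_powr' conth) (auto simp: dist_commute)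
    moreover have "cball z0 R \<noteq> {}" using R_pos by simp
    ultimately obtain z1 where z1: "z1 \<in> cball z0 R" "\<And>z. z \<in> cball z0 R \<Longrightarrow> \<phi> z \<le> \<phi> z1"
      using continuous_attains_sup[OF compact_cball, of z0 R \<phi>] by blast
    define S where "S = \<phi> z1"
    have S0: "R powr k * cmod (h z0) \<le> S" using z1(2)[of z0] R_pos by (simp add: S_def \<phi>_def)
    then have Spos: "S > 0" using False R_pos by (smt (verit) mult_pos_pos powr_gt_zero zero_less_norm_iff)
    \<comment> \<open>On the boundary circle the weight, and with it \<phi>, vanishes, whereas the
      maximum is positive.\<close>
    then have "dist z1 z0 \<noteq> R" unfolding S_def \<phi>_def by auto
    then have z1R: "dist z1 z0 < R" using z1(1) by (auto simp: dist_commute)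
    define d where "d = (R - dist z1 z0) / 2"
    have d: "d > 0" "R - dist z1 z0 = 2 * d" using z1R by (auto simp: d_def)
    define A where "A = S * d powr - k"
    have A: "A > 0" using Spos d by (simp add: A_def)
    have hA: "cmod (h z) \<le> A" if "dist z1 z \<le> d" for z
    proof -
      have "dist z z0 \<le> dist z1 z + dist z1 z0" by (rule dist_triangle3)
      then have dz: "d \<le> R - dist z z0" using that d by linarith
      then have "z \<in> cball z0 R" using d by (simp add: dist_commute)
      then have "(R - dist z z0) powr k * cmod (h z) \<le> S" using z1(2) by (simp add: S_def \<phi>_def)
      moreover have "d powr k * cmod (h z) \<le> (R - dist z z0) powr k * cmod (h z)"
        using dz d k by (intro mult_right_mono powr_mono2) auto
      ultimately have "d powr k * cmod (h z) \<le> S" by linarith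
      then show ?thesis unfolding A_def using d by (simp add: powr_minus field_simps)
    qed
    have h1: "cmod (h z1) = 4 * \<theta> * A"
    proof -
      have "S = (2 * d) powr k * cmod (h z1)" using d by (simp add: S_def \<phi>_def)
      also have "(2 * d) powr k = 2 powr k * d powr k" using d by (subst powr_mult) auto
      finally show ?thesis unfolding A_def \<theta>_def using d by (simp add: powr_minus)
    qed
    have deriv_bd: "cmod (deriv h z) \<le> 2 * A / d" if "z \<in> cball z1 (d / 2)" for z
    proof -
      have "cmod ((deriv ^^ 1) h z) \<le> fact 1 * A / (d / 2) ^ 1"
      proof (rule Cauchy_inequality)
        fix x assume "cmod (z - x) = d / 2"
        then have "dist z1 x \<le> d" using that dist_triangle[of z1 x z] by (simp add: dist_norm)
        then show "cmod (h x) \<le> A" by (rule hA)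
      qed (use d hol in \<open>auto intro: conth holomorphic_on_subset\<close>)
      then show ?thesis by (simp add: mult.commute)
    qed
    have lower: "2 * \<theta> * A \<le> cmod (h z)" if z: "z \<in> cball z1 (\<theta> * d)" for z
    proof -
      have "\<theta> * d \<le> 1 / 4 * d" using \<theta> d by (intro mult_right_mono) auto
      then have z': "z \<in> cball z1 (d / 2)" using z d unfolding mem_cball by linarith
      have "cmod (h z1 - h z) \<le> 2 * A / d * cmod (z1 - z)"
      proof (rule field_differentiable_bound[where S = "cball z1 (d / 2)" and f' = "deriv h"])
        show "(h has_field_derivative deriv h u) (at u within cball z1 (d / 2))" for u
          using hol by (meson UNIV_I holomorphic_derivI open_UNIV)
      qed (use z' d deriv_bd in auto)
      also have "\<dots> \<le> 2 * A / d * (\<theta> * d)" using z A d by (intro mult_left_mono) (auto simp: dist_norm)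
      also have "\<dots> = 2 * \<theta> * A" using d by simp
      finally have "cmod (h z1) - cmod (h z) \<le> 2 * \<theta> * A" using norm_triangle_ineq2[of "h z1" "h z"] by linarith
      then show ?thesis using h1 by (simp add: mult_ac)
    qed
    have \<theta>d: "0 < \<theta> * d" "\<theta> * d \<le> d" using \<theta> d by (auto intro: mult_left_le_one_le)
    have sub: "cball z1 (\<theta> * d) \<subseteq> cball z0 R"
    proof
      fix z assume "z \<in> cball z1 (\<theta> * d)"
      then have "dist z1 z \<le> d" using \<theta>d by simp
      then show "z \<in> cball z0 R" using d dist_triangle3[of z z0 z1] by (simp add: dist_commute)
    qed
    have "cmod (h z0) powr p * mass z0 \<le> C * ((2 * \<theta> * A) powr p * measure \<mu> (cball z1 (\<theta> * d)))"
    proof -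
      have Apow: "A powr p = S powr p * d powr - \<kappa>"
        unfolding A_def using Spos d p by (subst powr_mult) (auto simp: powr_powr k_def)
      have "R powr \<kappa> * cmod (h z0) powr p = (R powr k * cmod (h z0)) powr p"
        using R_pos p by (subst powr_mult) (auto simp: powr_powr k_def)
      also have "\<dots> \<le> S powr p" using S0 p by (intro powr_mono2) auto
      finally have 1: "R powr \<kappa> * cmod (h z0) powr p \<le> S powr p" .
      have 2: "c * (\<theta> powr \<kappa> * d powr \<kappa>) * mass z0 \<le> measure \<mu> (cball z1 (\<theta> * d))"
        using growth[OF \<theta>d(1) sub] \<theta> d unfolding mass_def by (simp add: powr_mult)
      have "cmod (h z0) powr p * mass z0
          = C * (R powr \<kappa> * cmod (h z0) powr p) * ((2 * \<theta>) powr p * (c * \<theta> powr \<kappa>) * mass z0)"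
        using R_pos \<theta> c_pos by (simp add: C_def)
      also have "\<dots> \<le> C * S powr p * ((2 * \<theta>) powr p * (c * \<theta> powr \<kappa>) * mass z0)"
        using 1 C \<theta> c_pos mass_pos[of z0] by (intro mult_right_mono mult_left_mono) auto
      also have "\<dots> = C * ((2 * \<theta>) powr p * (S powr p * d powr - \<kappa>) * (c * (\<theta> powr \<kappa> * d powr \<kappa>) * mass z0))"
        using d by (simp add: powr_minus)
      also have "(2 * \<theta>) powr p * (S powr p * d powr - \<kappa>) = (2 * \<theta> * A) powr p"
        unfolding Apow[symmetric] using \<theta> A by (subst powr_mult) auto
      also have "C * ((2 * \<theta> * A) powr p * (c * (\<theta> powr \<kappa> * d powr \<kappa>) * mass z0))
          \<le> C * ((2 * \<theta> * A) powr p * measure \<mu> (cball z1 (\<theta> * d)))"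
        using 2 C by (intro mult_left_mono) auto
      finally show ?thesis .
    qed
    then have "ennreal (cmod (h z0) powr p * mass z0)
        \<le> ennreal (C * ((2 * \<theta> * A) powr p * measure \<mu> (cball z1 (\<theta> * d))))" by (rule ennreal_leI)
    also have "\<dots> = ennreal C * (ennreal ((2 * \<theta> * A) powr p) * emeasure \<mu> (cball z1 (\<theta> * d)))"
      using C by (simp add: emeasure_bounded ennreal_mult)
    also have "ennreal ((2 * \<theta> * A) powr p) * emeasure \<mu> (cball z1 (\<theta> * d))
        = (\<integral>\<^sup>+z\<in>cball z1 (\<theta> * d). ennreal ((2 * \<theta> * A) powr p) \<partial>\<mu>)"
      by (simp add: nn_integral_cmult_indicator)
    also have "ennreal C * \<dots> \<le> ennreal C * (\<integral>\<^sup>+z\<in>cball z0 R. ennreal (cmod (h z) powr p) \<partial>\<mu>)"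
    proof (intro mult_left_mono nn_integral_mono)
      fix z
      show "ennreal ((2 * \<theta> * A) powr p) * indicator (cball z1 (\<theta> * d)) z
          \<le> ennreal (cmod (h z) powr p) * indicator (cball z0 R) z"
      proof (cases "z \<in> cball z1 (\<theta> * d)")
        case True
        then have "(2 * \<theta> * A) powr p \<le> cmod (h z) powr p"
          using lower[OF True] \<theta> A p by (intro powr_mono2) auto
        then show ?thesis using True sub by (auto simp: ennreal_leI)
      qed simp
    qed simp
    finally show ?thesis .
  qed
  show ?thesis using that[OF C main] by blast
qed

end

section \<open>The Schur test\<close>

lemma volterra_entire:
  assumes f: "f holomorphic_on UNIV" and g: "g holomorphic_on UNIV"
  shows "volterra g f holomorphic_on UNIV"
    and "deriv (volterra g f) z = f z * deriv g z"
    and "volterra g f 0 = 0"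
proof -
  have "(\<lambda>\<xi>. f \<xi> * deriv g \<xi>) holomorphic_on UNIV"
    using f g by (intro holomorphic_intros holomorphic_deriv) auto
  then obtain P where P: "\<And>z. (P has_field_derivative f z * deriv g z) (at z)"
    using holomorphic_convex_primitive'[of UNIV "\<lambda>\<xi>. f \<xi> * deriv g \<xi>"] by auto
  have "((\<lambda>\<xi>. f \<xi> * deriv g \<xi>) has_contour_integral (P z - P 0)) (linepath 0 z)" for z
    using contour_integral_primitive[of UNIV P "\<lambda>\<xi>. f \<xi> * deriv g \<xi>" "linepath 0 z"] P by simp
  then have eq: "volterra g f = (\<lambda>z. P z - P 0)"
    by (auto simp: volterra_def fun_eq_iff intro: contour_integral_unique)
  have der: "(volterra g f has_field_derivative f z * deriv g z) (at z)" for z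
    unfolding eq by (auto intro!: derivative_eq_intros P)
  show "volterra g f holomorphic_on UNIV"
    using der by (auto simp: holomorphic_on_def field_differentiable_def)
  show "deriv (volterra g f) z = f z * deriv g z" by (rule DERIV_imp_deriv[OF der])
  show "volterra g f 0 = 0" by (simp add: eq)
qed

context ball_growth
begin

lemma sigma_finite_weight_measure: "sigma_finite_measure \<mu>"
proof
  show "\<exists>A. countable A \<and> A \<subseteq> sets \<mu> \<and> \<Union> A = space \<mu> \<and> (\<forall>a\<in>A. emeasure \<mu> a \<noteq> \<infinity>)"
  proof (intro exI[of _ "range (\<lambda>n::nat. cball 0 (real n))"] conjI)
    show "\<Union> (range (\<lambda>n::nat. cball 0 (real n))) = space \<mu>"
      using real_arch_simple by auto
    show "\<forall>a\<in>range (\<lambda>n::nat. cball 0 (real n)). emeasure \<mu> a \<noteq> \<infinity>"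
      by (auto simp: emeasure_bounded)
  qed auto
qed

text \<open>The kernel of the Schur test divides by \<open>mass\<close>, and Fubini needs it jointly
  measurable. The discs are sections of one closed set in the product, so the standard result on
  measures of sections applies.\<close>

lemma mass_measurable [measurable]: "mass \<in> borel_measurable borel"
proof -
  interpret sigma_finite_measure \<mu> by (rule sigma_finite_weight_measure)
  have "closed {x :: complex \<times> complex. dist (fst x) (snd x) \<le> R}"
    by (intro closed_Collect_le continuous_intros)
  then have "{x :: complex \<times> complex. dist (fst x) (snd x) \<le> R} \<in> sets (borel \<Otimes>\<^sub>M borel)"
    unfolding borel_prod by (rule borel_closed)
  then have "{x :: complex \<times> complex. dist (fst x) (snd x) \<le> R} \<in> sets (borel \<Otimes>\<^sub>M \<mu>)"
    using sets_pair_measure_cong[OF refl sets_weight_measure, of borel w] by simp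
  from measurable_emeasure_Pair[OF this]
  have "(\<lambda>z. emeasure \<mu> (cball z R)) \<in> borel_measurable borel" by (simp add: vimage_def cball_def)
  then show ?thesis unfolding mass_def measure_def by measurable
qed

end

locale fock_weight = ball_growth +
  fixes p \<alpha> :: real
  assumes p_pos: "p > 0" and \<alpha>_pos: "\<alpha> > 0"
begin

section \<open>Point bounds for the damped modulus\<close>

definition damped :: "(complex \<Rightarrow> complex) \<Rightarrow> complex \<Rightarrow> real" where
  "damped f z = cmod (f z) * exp (- (\<alpha> / 2) * (cmod z)\<^sup>2)"

lemma damped_nonneg [simp]: "0 \<le> damped f z"
  by (simp add: damped_def)

lemma continuous_on_damped:
  assumes "f holomorphic_on UNIV"
  shows "continuous_on A (damped f)"
proof -
  have "continuous_on A f" using assms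
    by (meson holomorphic_on_imp_continuous_on holomorphic_on_subset subset_UNIV)
  then show ?thesis unfolding damped_def by (intro continuous_intros)
qed

lemma damped_measurable: "f holomorphic_on UNIV \<Longrightarrow> damped f \<in> borel_measurable borel"
  by (intro borel_measurable_continuous_onI continuous_on_damped)

lemma fock_integral_eq:
  assumes "f holomorphic_on UNIV"
  shows "fock_integral p \<alpha> w f = (\<integral>\<^sup>+z. ennreal (damped f z powr p) \<partial>\<mu>)"
proof -
  have [measurable]: "damped f \<in> borel_measurable borel" by (rule damped_measurable[OF assms])
  have eq: "damped f z powr p = cmod (f z) powr p * exp (- (p * \<alpha> / 2) * (cmod z)\<^sup>2)" for z
    by (simp add: damped_def powr_mult exp_powr_real mult_ac)
  show ?thesis
    unfolding fock_integral_def
  proof (subst nn_integral_weight_measure[OF weight], measurable, rule nn_integral_cong)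
    fix z
    show "ennreal (cmod (f z) powr p * exp (- (p * \<alpha> / 2) * (cmod z)\<^sup>2) * w z)
        = ennreal (w z) * ennreal (damped f z powr p)"
      unfolding eq[symmetric]
      using weight by (subst ennreal_mult) (auto simp: is_weight_def mult.commute)
  qed
qed

text \<open>In the variable u = z - z0 this is the Weyl translation of \<open>F\<close> by -z0. It
  keeps \<open>F\<close> holomorphic, and its modulus differs from \<open>damped F\<close> only by a
  factor depending on |z - z0|, which is bounded on discs of fixed radius uniformly in the
  centre.\<close>

definition twist :: "complex \<Rightarrow> (complex \<Rightarrow> complex) \<Rightarrow> complex \<Rightarrow> complex" where
  "twist z0 F z = F z * exp (of_real (\<alpha> / 2 * (cmod z0)\<^sup>2) - of_real \<alpha> * z * cnj z0)"

lemma norm_twist: "cmod (twist z0 F z) = damped F z * exp (\<alpha> / 2 * (cmod (z - z0))\<^sup>2)"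
proof -
  have "(cmod (z - z0))\<^sup>2 = (cmod z)\<^sup>2 + (cmod z0)\<^sup>2 - 2 * Re (z * cnj z0)"
    unfolding cmod_power2 by (simp add: power2_eq_square algebra_simps)
  then show ?thesis
    by (simp add: twist_def damped_def norm_mult norm_exp_eq_Re flip: exp_add)
       (simp add: algebra_simps)
qed

lemma holomorphic_twist: "F holomorphic_on A \<Longrightarrow> twist z0 F holomorphic_on A"
  unfolding twist_def by (intro holomorphic_intros)

text \<open>The entire function to which the mean value inequality is applied is the twist of
  \<open>F\<close> at \<open>z0\<close>. At the centre its modulus is \<open>damped F z0\<close>; on
  the disc it exceeds \<open>damped F\<close> by at most exp(\<alpha> R^2 / 2), whose p-th power is
  \<open>E\<close>.\<close>

lemma local_point_bound:
  obtains C where "C > 0" "\<And>F z0. F holomorphic_on UNIV \<Longrightarrow>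
    ennreal (damped F z0 powr p * mass z0) \<le> ennreal C * (\<integral>\<^sup>+z\<in>cball z0 R. ennreal (damped F z powr p) \<partial>\<mu>)"
proof -
  obtain C where C: "C > 0" and bd: "\<And>h z0. h holomorphic_on UNIV \<Longrightarrow>
    ennreal (cmod (h z0) powr p * mass z0) \<le> ennreal C * (\<integral>\<^sup>+z\<in>cball z0 R. ennreal (cmod (h z) powr p) \<partial>\<mu>)"
    using sub_mean_value[OF p_pos] by blast
  define E where "E = exp (\<alpha> / 2 * R\<^sup>2) powr p"
  have E: "E > 0" by (simp add: E_def)
  have "ennreal (damped F z0 powr p * mass z0) \<le> ennreal (C * E) * (\<integral>\<^sup>+z\<in>cball z0 R. ennreal (damped F z powr p) \<partial>\<mu>)"
    if F: "F holomorphic_on UNIV" for F z0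
  proof -
    have [measurable]: "damped F \<in> borel_measurable borel" "cball z0 R \<in> sets borel"
      using damped_measurable[OF F] by auto
    have "ennreal (damped F z0 powr p * mass z0) = ennreal (cmod (twist z0 F z0) powr p * mass z0)"
      by (simp add: norm_twist)
    also have "\<dots> \<le> ennreal C * (\<integral>\<^sup>+z\<in>cball z0 R. ennreal (cmod (twist z0 F z) powr p) \<partial>\<mu>)"
      by (intro bd holomorphic_twist F)
    also have "\<dots> \<le> ennreal C * (\<integral>\<^sup>+z. ennreal E * (ennreal (damped F z powr p) * indicator (cball z0 R) z) \<partial>\<mu>)"
    proof (intro mult_left_mono nn_integral_mono)
      fix z
      have "cmod (twist z0 F z) powr p \<le> E * damped F z powr p" if "z \<in> cball z0 R"
      proof -
        have "(cmod (z - z0))\<^sup>2 \<le> R\<^sup>2"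
          using that by (intro power_mono) (auto simp: dist_norm norm_minus_commute)
        then have "exp (\<alpha> / 2 * (cmod (z - z0))\<^sup>2) \<le> exp (\<alpha> / 2 * R\<^sup>2)" using \<alpha>_pos by simp
        then have "cmod (twist z0 F z) \<le> damped F z * exp (\<alpha> / 2 * R\<^sup>2)"
          unfolding norm_twist by (rule mult_left_mono) simp
        then have "cmod (twist z0 F z) powr p \<le> (damped F z * exp (\<alpha> / 2 * R\<^sup>2)) powr p"
          using p_pos by (intro powr_mono2) auto
        then show ?thesis by (simp add: E_def powr_mult mult.commute)
      qed
      then show "ennreal (cmod (twist z0 F z) powr p) * indicator (cball z0 R) z
         \<le> ennreal E * (ennreal (damped F z powr p) * indicator (cball z0 R) z)"
        using E by (cases "z \<in> cball z0 R") (auto simp: ennreal_mult'[symmetric] intro!: ennreal_leI)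
    qed simp
    also have "\<dots> = ennreal C * (ennreal E * (\<integral>\<^sup>+z\<in>cball z0 R. ennreal (damped F z powr p) \<partial>\<mu>))"
      by (subst nn_integral_cmult, measurable)
    finally show ?thesis using C E by (simp add: ennreal_mult' mult.assoc)
  qed
  then show ?thesis using that[of "C * E"] C E by simp
qed

lemma point_bound:
  obtains C where "C > 0" "\<And>F z. F holomorphic_on UNIV \<Longrightarrow>
    ennreal (damped F z powr p * mass z) \<le> ennreal C * fock_integral p \<alpha> w F"
proof -
  obtain C where C: "C > 0" and bd: "\<And>F z0. F holomorphic_on UNIV \<Longrightarrow>
    ennreal (damped F z0 powr p * mass z0) \<le> ennreal C * (\<integral>\<^sup>+z\<in>cball z0 R. ennreal (damped F z powr p) \<partial>\<mu>)"
    using local_point_bound by blast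
  have "ennreal (damped F z0 powr p * mass z0) \<le> ennreal C * fock_integral p \<alpha> w F"
    if F: "F holomorphic_on UNIV" for F z0
  proof -
    note bd[OF F, of z0]
    also have "ennreal C * (\<integral>\<^sup>+z\<in>cball z0 R. ennreal (damped F z powr p) \<partial>\<mu>) \<le> ennreal C * fock_integral p \<alpha> w F"
      unfolding fock_integral_eq[OF F]
      by (intro mult_left_mono nn_integral_mono) (auto simp: indicator_def)
    finally show ?thesis .
  qed
  then show ?thesis using that C by blast
qed

text \<open>A Schur test: inserting the local point bound at \<open>y\<close> turns the pointwise hypothesis into
  domination by an integral operator with kernel \<open>exp (- p \<eta> \<bar>z - \<xi>\<bar>) / mass \<xi>\<close>.\<close>

lemma schur_test:
  obtains \<eta> C where "\<eta> > 0" "C > 0"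
    "\<And>F1 F2 A. F1 holomorphic_on UNIV \<Longrightarrow> F2 holomorphic_on UNIV \<Longrightarrow> A \<ge> 0 \<Longrightarrow>
      (\<And>z. \<exists>y. damped F1 z \<le> A * damped F2 y * exp (- \<eta> * dist z y)) \<Longrightarrow>
      fock_integral p \<alpha> w F1 \<le> ennreal (C * A powr p) * fock_integral p \<alpha> w F2"
proof -
  obtain \<Lambda> where \<Lambda>: "\<Lambda> > 0" and int: "\<And>\<xi>. (\<integral>\<^sup>+z. ennreal (exp (- \<Lambda> * dist z \<xi>)) \<partial>\<mu>) \<le> ennreal (2 * mass \<xi>)"
    using exp_decay_integral by blast
  obtain C0 where C0: "C0 > 0" and bd: "\<And>F z0. F holomorphic_on UNIV \<Longrightarrow>
    ennreal (damped F z0 powr p * mass z0) \<le> ennreal C0 * (\<integral>\<^sup>+z\<in>cball z0 R. ennreal (damped F z powr p) \<partial>\<mu>)"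
    using local_point_bound by blast
  \<comment> \<open>The p-th power of exp(-\<eta> dist) is then exactly the integrable kernel with
    rate \<Lambda>.\<close>
  define \<eta> where "\<eta> = \<Lambda> / p"
  define C where "C = 2 * C0 * K * exp (\<Lambda> * R)"
  have \<eta>: "\<eta> > 0" using \<Lambda> p_pos by (simp add: \<eta>_def)
  have C: "C > 0" using C0 K_ge_1 by (simp add: C_def)
  have main: "fock_integral p \<alpha> w F1 \<le> ennreal (C * A powr p) * fock_integral p \<alpha> w F2"
    if F1: "F1 holomorphic_on UNIV" and F2: "F2 holomorphic_on UNIV" and A: "A \<ge> 0"
      and ex: "\<And>z. \<exists>y. damped F1 z \<le> A * damped F2 y * exp (- \<eta> * dist z y)" for F1 F2 A
  proof -
    have [measurable]: "damped F2 \<in> borel_measurable borel" by (rule damped_measurable[OF F2])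
    \<comment> \<open>The point y depends on \<open>z\<close> in an arbitrary, possibly
      non-measurable way, so the kernel must not mention it. As \<xi> lies within \<open>R\<close>
      of y, replacing \<open>mass y\<close> by \<open>mass \<xi>\<close> costs \<open>K\<close>, and
      replacing the distance to y by that to \<xi> costs exp(\<Lambda> R).\<close>
    define B where "B = A powr p * C0 * K * exp (\<Lambda> * R)"
    have B: "B \<ge> 0" using C0 K_ge_1 by (simp add: B_def)
    define k where "k z \<xi> = ennreal (damped F2 \<xi> powr p) * (ennreal (B / mass \<xi>) * ennreal (exp (- \<Lambda> * dist z \<xi>)))" for z \<xi>
    have dom: "ennreal (damped F1 z powr p) \<le> (\<integral>\<^sup>+\<xi>. k z \<xi> \<partial>\<mu>)" for z
    proof -
      obtain y where y: "damped F1 z \<le> A * damped F2 y * exp (- \<eta> * dist z y)" using ex by blast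
      define D where "D = A powr p * exp (- \<Lambda> * dist z y) / mass y"
      have D: "D \<ge> 0" using mass_pos[of y] by (simp add: D_def)
      have "damped F1 z powr p \<le> (A * damped F2 y * exp (- \<eta> * dist z y)) powr p"
        using y p_pos by (intro powr_mono2) auto
      also have "\<dots> = A powr p * damped F2 y powr p * exp (- \<eta> * dist z y) powr p"
        using A by (simp add: powr_mult)
      also have "exp (- \<eta> * dist z y) powr p = exp (- \<Lambda> * dist z y)"
        using p_pos by (simp add: exp_powr_real \<eta>_def)
      also have "A powr p * damped F2 y powr p * exp (- \<Lambda> * dist z y) = D * (damped F2 y powr p * mass y)"
        using mass_pos[of y] by (simp add: D_def)
      finally have "ennreal (damped F1 z powr p) \<le> ennreal D * ennreal (damped F2 y powr p * mass y)"
        using D by (simp add: ennreal_mult'[symmetric] ennreal_leI)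
      also have "\<dots> \<le> ennreal D * (ennreal C0 * (\<integral>\<^sup>+\<xi>\<in>cball y R. ennreal (damped F2 \<xi> powr p) \<partial>\<mu>))"
        by (intro mult_left_mono bd F2) simp
      also have "\<dots> = (\<integral>\<^sup>+\<xi>. ennreal (D * C0) * (ennreal (damped F2 \<xi> powr p) * indicator (cball y R) \<xi>) \<partial>\<mu>)"
      proof -
        have [measurable]: "cball y R \<in> sets borel" by simp
        show ?thesis using D by (subst nn_integral_cmult, measurable) (simp add: ennreal_mult' mult.assoc)
      qed
      also have "\<dots> \<le> (\<integral>\<^sup>+\<xi>. k z \<xi> \<partial>\<mu>)"
      proof (rule nn_integral_mono)
        fix \<xi>
        have "D * C0 \<le> B / mass \<xi> * exp (- \<Lambda> * dist z \<xi>)" if "\<xi> \<in> cball y R"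
        proof -
          have d: "dist \<xi> y \<le> R" using that by (simp add: dist_commute)
          then have "mass \<xi> \<le> K * mass y" by (rule mass_le_neighbour)
          then have 1: "1 / mass y \<le> K / mass \<xi>" using mass_pos[of y] mass_pos[of \<xi>] by (simp add: field_simps)
          have "dist z \<xi> \<le> dist z y + R" using d dist_triangle2[of z \<xi> y] by linarith
          then have "\<Lambda> * dist z \<xi> \<le> \<Lambda> * (dist z y + R)" using \<Lambda> by (intro mult_left_mono) auto
          then have 2: "exp (- \<Lambda> * dist z y) \<le> exp (\<Lambda> * R) * exp (- \<Lambda> * dist z \<xi>)"
            by (simp add: algebra_simps flip: exp_add)
          have "D * C0 = A powr p * C0 * (exp (- \<Lambda> * dist z y) * (1 / mass y))" by (simp add: D_def)
          also have "\<dots> \<le> A powr p * C0 * ((exp (\<Lambda> * R) * exp (- \<Lambda> * dist z \<xi>)) * (K / mass \<xi>))"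
            using 1 2 C0 mass_pos[of y] mass_pos[of \<xi>] K_ge_1 by (intro mult_left_mono mult_mono) auto
          also have "\<dots> = B / mass \<xi> * exp (- \<Lambda> * dist z \<xi>)" by (simp add: B_def)
          finally show ?thesis .
        qed
        then have *: "ennreal (D * C0) \<le> ennreal (B / mass \<xi>) * ennreal (exp (- \<Lambda> * dist z \<xi>))" if "\<xi> \<in> cball y R"
          using that B mass_pos[of \<xi>] by (simp add: ennreal_mult'[symmetric] ennreal_leI)
        show "ennreal (D * C0) * (ennreal (damped F2 \<xi> powr p) * indicator (cball y R) \<xi>) \<le> k z \<xi>"
        proof (cases "\<xi> \<in> cball y R")
          case True
          have "ennreal (damped F2 \<xi> powr p) * ennreal (D * C0) \<le> k z \<xi>"
            unfolding k_def by (intro mult_left_mono * True) simp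
          then show ?thesis using True by (simp add: mult.commute)
        qed simp
      qed
      finally show ?thesis .
    qed
    interpret sigma_finite_measure \<mu> by (rule sigma_finite_weight_measure)
    interpret pair_sigma_finite \<mu> \<mu> ..
    have km: "(\<lambda>(z, \<xi>). k z \<xi>) \<in> borel_measurable (\<mu> \<Otimes>\<^sub>M \<mu>)"
      unfolding k_def by measurable
    have "fock_integral p \<alpha> w F1 \<le> (\<integral>\<^sup>+z. \<integral>\<^sup>+\<xi>. k z \<xi> \<partial>\<mu> \<partial>\<mu>)"
      unfolding fock_integral_eq[OF F1] by (intro nn_integral_mono dom)
    \<comment> \<open>Integrating over \<open>z\<close> first produces at most 2
      \<open>mass \<xi>\<close>, which cancels the denominator of the kernel.\<close>
    also have "\<dots> = (\<integral>\<^sup>+\<xi>. \<integral>\<^sup>+z. k z \<xi> \<partial>\<mu> \<partial>\<mu>)"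
      by (rule Fubini'[OF km, symmetric])
    also have "\<dots> \<le> (\<integral>\<^sup>+\<xi>. ennreal (2 * B) * ennreal (damped F2 \<xi> powr p) \<partial>\<mu>)"
    proof (rule nn_integral_mono)
      fix \<xi>
      have "(\<integral>\<^sup>+z. k z \<xi> \<partial>\<mu>) = ennreal (damped F2 \<xi> powr p) * (ennreal (B / mass \<xi>) * (\<integral>\<^sup>+z. ennreal (exp (- \<Lambda> * dist z \<xi>)) \<partial>\<mu>))"
        unfolding k_def by (subst nn_integral_cmult, measurable, subst nn_integral_cmult, measurable)
      also have "\<dots> \<le> ennreal (damped F2 \<xi> powr p) * (ennreal (B / mass \<xi>) * ennreal (2 * mass \<xi>))"
        by (intro mult_left_mono int) auto
      also have "ennreal (B / mass \<xi>) * ennreal (2 * mass \<xi>) = ennreal (2 * B)"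
        using mass_pos[of \<xi>] B by (simp add: ennreal_mult'[symmetric])
      finally show "(\<integral>\<^sup>+z. k z \<xi> \<partial>\<mu>) \<le> ennreal (2 * B) * ennreal (damped F2 \<xi> powr p)" by (simp add: mult.commute)
    qed
    also have "\<dots> = ennreal (2 * B) * fock_integral p \<alpha> w F2"
      unfolding fock_integral_eq[OF F2] by (subst nn_integral_cmult) auto
    also have "2 * B = C * A powr p" by (simp add: B_def C_def)
    finally show ?thesis .
  qed
  show ?thesis using that[OF \<eta> C main] by blast
qed

text \<open>Cauchy's estimate is applied to \<open>twist z F\<close> at its own centre
  \<open>z\<close>. There its derivative has the modulus of (F' - \<alpha> \<open>cnj z\<close> F)
  times the Gaussian; moving the second term to the other side is what brings in the factor 1 +
  |z|.\<close>

lemma damped_deriv_bound: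
  obtains C where "C > 0" "\<And>F z. F holomorphic_on UNIV \<Longrightarrow>
    \<exists>y\<in>cball z R. damped (deriv F) z \<le> C * (1 + cmod z) * damped F y"
proof -
  define E where "E = exp (\<alpha> / 2 * R\<^sup>2) / R"
  have E: "E > 0" using R_pos by (simp add: E_def)
  have "\<exists>y\<in>cball z R. damped (deriv F) z \<le> (E + \<alpha>) * (1 + cmod z) * damped F y"
    if F: "F holomorphic_on UNIV" for F z
  proof -
    have "cball z R \<noteq> {}" using R_pos by simp
    then obtain y where y: "y \<in> cball z R" "\<And>u. u \<in> cball z R \<Longrightarrow> damped F u \<le> damped F y"
      using continuous_attains_sup[OF compact_cball _ continuous_on_damped[OF F], of z R] by blast
    have hol: "twist z F holomorphic_on UNIV" by (rule holomorphic_twist[OF F])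
    have "cmod ((deriv ^^ 1) (twist z F) z) \<le> fact 1 * (damped F y * exp (\<alpha> / 2 * R\<^sup>2)) / R ^ 1"
    proof (rule Cauchy_inequality)
      fix u assume u: "cmod (z - u) = R"
      then have "damped F u \<le> damped F y" by (intro y(2)) (simp add: dist_norm)
      then show "cmod (twist z F u) \<le> damped F y * exp (\<alpha> / 2 * R\<^sup>2)"
        using u by (simp add: norm_twist norm_minus_commute)
    qed (use hol R_pos in \<open>auto intro: holomorphic_on_subset holomorphic_on_imp_continuous_on\<close>)
    then have 1: "cmod (deriv (twist z F) z) \<le> E * damped F y" by (simp add: E_def mult.commute)
    have dF: "(F has_field_derivative deriv F z) (at z)" using F by (auto intro: holomorphic_derivI)
    have "(twist z F has_field_derivative
       (deriv F z - of_real \<alpha> * cnj z * F z) * exp (of_real (\<alpha> / 2 * (cmod z)\<^sup>2) - of_real \<alpha> * z * cnj z)) (at z)"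
      unfolding twist_def by (auto intro!: derivative_eq_intros dF simp: algebra_simps)
    then have "deriv (twist z F) z
       = (deriv F z - of_real \<alpha> * cnj z * F z) * exp (of_real (\<alpha> / 2 * (cmod z)\<^sup>2) - of_real \<alpha> * z * cnj z)"
      by (rule DERIV_imp_deriv)
    also have "of_real (\<alpha> / 2 * (cmod z)\<^sup>2) - of_real \<alpha> * z * cnj z = of_real (- (\<alpha> / 2) * (cmod z)\<^sup>2)"
      using complex_norm_square[of z] by (simp add: mult.assoc)
    finally have "cmod (deriv (twist z F) z) = cmod (deriv F z - of_real \<alpha> * cnj z * F z) * exp (- (\<alpha> / 2) * (cmod z)\<^sup>2)"
      by (simp only: norm_mult norm_exp_eq_Re Re_complex_of_real)
    moreover have "cmod (deriv F z) - \<alpha> * cmod z * cmod (F z) \<le> cmod (deriv F z - of_real \<alpha> * cnj z * F z)"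
      using norm_triangle_ineq2[of "deriv F z" "of_real \<alpha> * cnj z * F z"] \<alpha>_pos by (simp add: norm_mult)
    ultimately have "(cmod (deriv F z) - \<alpha> * cmod z * cmod (F z)) * exp (- (\<alpha> / 2) * (cmod z)\<^sup>2) \<le> E * damped F y"
      using 1 by (smt (verit, best) exp_ge_zero mult_right_mono)
    then have "damped (deriv F) z \<le> E * damped F y + \<alpha> * cmod z * damped F z"
      by (simp add: damped_def left_diff_distrib mult.assoc)
    also have "\<dots> \<le> E * (1 + cmod z) * damped F y + \<alpha> * (1 + cmod z) * damped F y"
      using E \<alpha>_pos y(2)[of z] R_pos by (intro add_mono mult_mono) auto
    finally show ?thesis using y(1) by (auto simp: distrib_right)
  qed
  then show ?thesis using that[of "E + \<alpha>"] E \<alpha>_pos by (simp add: add_pos_pos)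
qed

end

section \<open>Comparing an entire function with its derivative\<close>

context fock_weight
begin

text \<open>At distance at least \<open>R\<close> from \<zeta>, the factor 1 + |z| of the derivative
  bound is at most a constant times |z - \<zeta>|, so it cancels on division by the affine factor.
  Closer to \<zeta> one first passes to the circle of radius \<open>R\<close>.\<close>

lemma damped_le_of_deriv_eq_affine_mult:
  assumes a: "a \<noteq> 0" and \<eta>: "\<eta> > 0"
  obtains A where "A \<ge> 0" "\<And>F f z. F holomorphic_on UNIV \<Longrightarrow> f holomorphic_on UNIV \<Longrightarrow>
    (\<And>z. deriv F z = f z * (a * (z - \<zeta>))) \<Longrightarrow> \<exists>y. damped f z \<le> A * damped F y * exp (- \<eta> * dist z y)"
proof -
  obtain C where C: "C > 0" and bd: "\<And>F z. F holomorphic_on UNIV \<Longrightarrow>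
    \<exists>y\<in>cball z R. damped (deriv F) z \<le> C * (1 + cmod z) * damped F y"
    using damped_deriv_bound by blast
  define A1 where "A1 = C * ((1 + cmod \<zeta>) / R + 1) / cmod a"
  \<comment> \<open>Bounds the reciprocal of the Gaussian on the circle of radius \<open>R\<close>
    about \<zeta>, where the maximum principle puts the comparison point.\<close>
  define A2 where "A2 = exp (\<alpha> / 2 * (cmod \<zeta> + R)\<^sup>2)"
  define A where "A = A1 * A2 * exp (\<eta> * (3 * R))"
  have A1: "A1 > 0" using C R_pos a by (simp add: A1_def add_nonneg_pos)
  have A2: "A2 \<ge> 1" using \<alpha>_pos by (simp add: A2_def)
  have A: "A \<ge> 0" using A1 A2 by (simp add: A_def)
  have main: "\<exists>y. damped f z \<le> A * damped F y * exp (- \<eta> * dist z y)"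
    if F: "F holomorphic_on UNIV" and f: "f holomorphic_on UNIV"
      and eq: "\<And>z. deriv F z = f z * (a * (z - \<zeta>))" for F f z
  proof -
    have far: "\<exists>y\<in>cball z R. damped f z \<le> A1 * damped F y" if z: "R \<le> cmod (z - \<zeta>)" for z
    proof -
      obtain y where y: "y \<in> cball z R" "damped (deriv F) z \<le> C * (1 + cmod z) * damped F y"
        using bd[OF F] by blast
      have "1 + cmod z \<le> (1 + cmod \<zeta>) + cmod (z - \<zeta>)"
        using norm_triangle_ineq[of "z - \<zeta>" \<zeta>] by simp
      also have "1 + cmod \<zeta> \<le> (1 + cmod \<zeta>) / R * cmod (z - \<zeta>)"
        using z R_pos by (simp add: pos_le_divide_eq mult_left_mono)
      finally have "1 + cmod z \<le> ((1 + cmod \<zeta>) / R + 1) * cmod (z - \<zeta>)" by (simp add: distrib_right)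
      then have "C * (1 + cmod z) * damped F y \<le> C * (((1 + cmod \<zeta>) / R + 1) * cmod (z - \<zeta>)) * damped F y"
        using C by (intro mult_right_mono mult_left_mono) auto
      also have "\<dots> = (cmod a * cmod (z - \<zeta>)) * (A1 * damped F y)" using a by (simp add: A1_def)
      finally have "(cmod a * cmod (z - \<zeta>)) * damped f z \<le> (cmod a * cmod (z - \<zeta>)) * (A1 * damped F y)"
        using y(2) by (simp add: damped_def eq norm_mult mult_ac)
      moreover have "0 < cmod (z - \<zeta>)" using z R_pos by linarith
      then have "0 < cmod a * cmod (z - \<zeta>)" using a by (intro mult_pos_pos) auto
      ultimately have "damped f z \<le> A1 * damped F y" by (simp only: mult_le_cancel_left_pos)
      then show ?thesis using y(1) by blast
    qed
    \<comment> \<open>Near \<zeta> the path from \<open>z\<close> via \<zeta> and the circle to y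
      has three pieces of length at most \<open>R\<close>; otherwise one piece is enough. With the
      distance bounded, the damping costs only a constant, whatever \<eta> is.\<close>
    have "\<exists>y. dist z y \<le> 3 * R \<and> damped f z \<le> A1 * A2 * damped F y"
    proof (cases "R \<le> cmod (z - \<zeta>)")
      case True
      then obtain y where y: "y \<in> cball z R" "damped f z \<le> A1 * damped F y" using far by blast
      have "A1 * damped F y * 1 \<le> A1 * damped F y * A2" using A1 A2 by (intro mult_left_mono) auto
      then have "damped f z \<le> A1 * A2 * damped F y" using y(2) by (simp add: mult_ac)
      moreover have "dist z y \<le> 3 * R" using y(1) R_pos by simp
      ultimately show ?thesis by blast
    next
      case False
      then have z: "z \<in> ball \<zeta> R" by (simp add: dist_norm norm_minus_commute)
      have contf: "continuous_on X f" for X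
        using f by (meson holomorphic_on_imp_continuous_on holomorphic_on_subset subset_UNIV)
      have "sphere \<zeta> R \<noteq> {}" using R_pos by simp
      then obtain y0 where y0: "y0 \<in> sphere \<zeta> R" "\<And>u. u \<in> sphere \<zeta> R \<Longrightarrow> cmod (f u) \<le> cmod (f y0)"
        using continuous_attains_sup[OF compact_sphere, of \<zeta> R "\<lambda>u. cmod (f u)"] contf
        by (metis continuous_on_norm)
      have "cmod (f z) \<le> cmod (f y0)"
      proof (rule maximum_modulus_frontier[of f "ball \<zeta> R"])
        show "f holomorphic_on interior (ball \<zeta> R)" using f by (rule holomorphic_on_subset) simp
        show "cmod (f u) \<le> cmod (f y0)" if "u \<in> frontier (ball \<zeta> R)" for u
          using that R_pos y0(2) by (simp add: frontier_ball)
      qed (use z contf in auto)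
      moreover have "damped f z \<le> cmod (f z)"
        using \<alpha>_pos by (simp add: damped_def mult_left_le)
      moreover have "cmod (f y0) \<le> A2 * damped f y0"
      proof -
        have "cmod y0 \<le> cmod \<zeta> + R"
          using y0(1) norm_triangle_ineq[of "y0 - \<zeta>" \<zeta>] by (simp add: dist_norm norm_minus_commute)
        then have "(cmod y0)\<^sup>2 \<le> (cmod \<zeta> + R)\<^sup>2" by (intro power_mono) auto
        then have "exp (\<alpha> / 2 * (cmod y0)\<^sup>2) \<le> A2" using \<alpha>_pos by (simp add: A2_def)
        then have "exp (\<alpha> / 2 * (cmod y0)\<^sup>2) * damped f y0 \<le> A2 * damped f y0" by (intro mult_right_mono) auto
        moreover have "exp (\<alpha> / 2 * (cmod y0)\<^sup>2) * damped f y0 = cmod (f y0)"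
          by (simp add: damped_def flip: exp_add)
        ultimately show ?thesis by simp
      qed
      moreover obtain y where y: "y \<in> cball y0 R" "damped f y0 \<le> A1 * damped F y"
        using far[of y0] y0(1) by (auto simp: dist_norm norm_minus_commute)
      then have "A2 * damped f y0 \<le> A2 * (A1 * damped F y)" using A2 by (intro mult_left_mono) auto
      ultimately have "damped f z \<le> A1 * A2 * damped F y" by (simp add: mult_ac)
      moreover have "dist z y \<le> 3 * R"
        using z y0(1) y(1) dist_triangle[of z y \<zeta>] dist_triangle[of \<zeta> y y0] by (simp add: dist_commute)
      ultimately show ?thesis by blast
    qed
    then obtain y where y: "dist z y \<le> 3 * R" "damped f z \<le> A1 * A2 * damped F y" by blast
    have "A1 * A2 * damped F y * 1 \<le> A1 * A2 * damped F y * (exp (\<eta> * (3 * R)) * exp (- \<eta> * dist z y))"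
    proof (rule mult_left_mono)
      have "\<eta> * dist z y \<le> \<eta> * (3 * R)" using y(1) \<eta> by (intro mult_left_mono) auto
      then show "1 \<le> exp (\<eta> * (3 * R)) * exp (- \<eta> * dist z y)" by (simp flip: exp_add)
    qed (use A1 A2 in auto)
    then have "damped f z \<le> A * damped F y * exp (- \<eta> * dist z y)" using y(2) by (simp add: A_def mult_ac)
    then show ?thesis by blast
  qed
  show ?thesis using that[OF A main] by blast
qed

text \<open>Along the ray to z, t^2 \<le> t shows that the growth factor exp(\<alpha> |tz|^2 / 2) is
  smaller than its value at t = 1 by at least exp(-\<alpha> |z|^2 (1 - t) / 2). One half of this
  decay is kept to make t integrable: the integral is at most of order 1/|z|^2 and absorbs the
  length |z| of the ray together with |b|. The other half yields the damping in the distance to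
  y.\<close>

lemma damped_primitive_le:
  assumes B: "B \<ge> 0" and \<eta>: "\<eta> > 0"
  obtains A where "A \<ge> 0" "\<And>F f b z. F holomorphic_on UNIV \<Longrightarrow> f holomorphic_on UNIV \<Longrightarrow>
    (\<And>z. deriv F z = f z * b z) \<Longrightarrow> (\<And>z. cmod (b z) \<le> B * (1 + cmod z)) \<Longrightarrow> F 0 = 0 \<Longrightarrow>
    \<exists>y. damped F z \<le> A * damped f y * exp (- \<eta> * dist z y)"
proof -
  \<comment> \<open>Half of the rate \<alpha> / 2 that is available along the ray; it is used
    twice.\<close>
  define \<beta> where "\<beta> = \<alpha> / 4"
  have \<beta>: "\<beta> > 0" using \<alpha>_pos by (simp add: \<beta>_def)
  define A where "A = B * (2 + 2 / \<beta>) * exp (\<eta> * \<eta> / \<beta>)"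
  have A: "A \<ge> 0" using B \<beta> by (simp add: A_def)
  have main: "\<exists>y. damped F z \<le> A * damped f y * exp (- \<eta> * dist z y)"
    if F: "F holomorphic_on UNIV" and f: "f holomorphic_on UNIV"
      and eq: "\<And>z. deriv F z = f z * b z" and b: "\<And>z. cmod (b z) \<le> B * (1 + cmod z)" and F0: "F 0 = 0"
    for F f b z
  proof (cases "z = 0")
    case True
    then have "damped F z = 0" using F0 by (simp add: damped_def)
    then have "damped F z \<le> A * damped f 0 * exp (- \<eta> * dist z 0)" using A by simp
    then show ?thesis by blast
  next
    case False
    define x where "x = cmod z"
    have x: "x > 0" using False by (simp add: x_def)
    \<comment> \<open>The point y is \<open>t0 * z\<close> with \<open>t0\<close> maximizing \<psi>;
      the exponential in \<psi> later supplies the damping.\<close>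
    define \<psi> where "\<psi> t = damped f (of_real t * z) * exp (- \<beta> * x\<^sup>2 * (1 - t))" for t
    have "continuous_on {0..1} (\<lambda>t. damped f (of_real t * z))"
      by (rule continuous_on_compose2[OF continuous_on_damped[OF f, of UNIV]]) (auto intro!: continuous_intros)
    then have "continuous_on {0..1} \<psi>" unfolding \<psi>_def by (intro continuous_intros)
    then obtain t0 where t0: "t0 \<in> {0..1}" "\<And>t. t \<in> {0..1} \<Longrightarrow> \<psi> t \<le> \<psi> t0"
      using continuous_attains_sup[of "{0..1::real}" \<psi>] by auto
    define M where "M = \<psi> t0"
    have M: "M \<ge> 0" by (simp add: M_def \<psi>_def)
    define N where "N = B * (1 + x) / (\<beta> * x) * M * exp (\<alpha> / 2 * x\<^sup>2)"
    \<comment> \<open>An explicit primitive of the bound for the derivative of F along the ray, so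
      that a mean value inequality replaces the integral. \<open>N\<close> is normalized by dividing
      by \<beta> x^2.\<close>
    define \<phi> where "\<phi> t = N * exp (- \<beta> * x\<^sup>2 * (1 - t))" for t
    have "norm (F (of_real 1 * z) - F (of_real 0 * z)) \<le> \<phi> 1 - \<phi> 0"
    proof (rule differentiable_bound_general[where f' = "\<lambda>t. z * deriv F (of_real t * z)"
          and \<phi>' = "\<lambda>t. N * (\<beta> * x\<^sup>2) * exp (- \<beta> * x\<^sup>2 * (1 - t))"])
      have vd: "((\<lambda>t. F (of_real t * z)) has_vector_derivative z * deriv F (of_real t * z)) (at t)" for t :: real
      proof -
        have "(F has_field_derivative deriv F (of_real t * z)) (at (of_real t * z))"
          using F by (auto intro: holomorphic_derivI)
        moreover have "((\<lambda>t. of_real t * z) has_vector_derivative z) (at t)"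
          by (auto intro!: derivative_eq_intros simp: has_vector_derivative_def scaleR_conv_of_real)
        ultimately show ?thesis
          using field_vector_diff_chain_at[of "\<lambda>t. of_real t * z" z t F "deriv F (of_real t * z)"] by (simp add: o_def)
      qed
      then show "((\<lambda>t. F (of_real t * z)) has_vector_derivative z * deriv F (of_real t * z)) (at t)" for t .
      show "continuous_on {0..1} (\<lambda>t. F (of_real t * z))"
        by (intro continuous_at_imp_continuous_on ballI has_vector_derivative_continuous[OF vd])
      show "(\<phi> has_vector_derivative N * (\<beta> * x\<^sup>2) * exp (- \<beta> * x\<^sup>2 * (1 - t))) (at t)" for t
        unfolding has_real_derivative_iff_has_vector_derivative[symmetric] \<phi>_def
        by (auto intro!: derivative_eq_intros)
      show "continuous_on {0..1} \<phi>" unfolding \<phi>_def by (intro continuous_intros)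
      show "norm (z * deriv F (of_real t * z)) \<le> N * (\<beta> * x\<^sup>2) * exp (- \<beta> * x\<^sup>2 * (1 - t))"
        if t: "0 < t" "t < 1" for t
      proof -
        have nt: "cmod (of_real t * z) = t * x" using t by (simp add: norm_mult x_def)
        have "cmod (b (of_real t * z)) \<le> B * (1 + t * x)" using b[of "of_real t * z"] by (simp only: nt)
        also have "\<dots> \<le> B * (1 + x)" using B t x by (intro mult_left_mono) auto
        finally have 1: "cmod (b (of_real t * z)) \<le> B * (1 + x)" .
        have "damped f (of_real t * z) * exp (- \<beta> * x\<^sup>2 * (1 - t)) \<le> M"
          using t0(2)[of t] t by (simp add: M_def \<psi>_def)
        then have "damped f (of_real t * z) * exp (- \<beta> * x\<^sup>2 * (1 - t)) * exp (\<beta> * x\<^sup>2 * (1 - t)) \<le> M * exp (\<beta> * x\<^sup>2 * (1 - t))"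
          by (rule mult_right_mono) simp
        then have 2: "damped f (of_real t * z) \<le> M * exp (\<beta> * x\<^sup>2 * (1 - t))"
          by (simp add: mult.assoc flip: exp_add)
        have "t\<^sup>2 \<le> t" using t by (simp add: power2_eq_square mult_left_le)
        then have "(t * x)\<^sup>2 \<le> t * x\<^sup>2" by (simp add: power_mult_distrib mult_right_mono)
        then have 3: "exp (\<alpha> / 2 * (t * x)\<^sup>2) \<le> exp (\<alpha> / 2 * (t * x\<^sup>2))" using \<alpha>_pos by simp
        have "cmod (f (of_real t * z)) = damped f (of_real t * z) * exp (\<alpha> / 2 * (t * x)\<^sup>2)"
          unfolding damped_def nt by (simp add: mult.assoc flip: exp_add)
        also have "\<dots> \<le> (M * exp (\<beta> * x\<^sup>2 * (1 - t))) * exp (\<alpha> / 2 * (t * x\<^sup>2))"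
          using 2 3 M by (intro mult_mono) auto
        also have "\<dots> = M * exp (\<alpha> / 2 * x\<^sup>2) * exp (- \<beta> * x\<^sup>2 * (1 - t))"
          unfolding mult.assoc exp_add[symmetric] \<beta>_def by (simp add: algebra_simps)
        finally have 4: "cmod (f (of_real t * z)) \<le> M * exp (\<alpha> / 2 * x\<^sup>2) * exp (- \<beta> * x\<^sup>2 * (1 - t))" .
        have "norm (z * deriv F (of_real t * z)) = x * (cmod (f (of_real t * z)) * cmod (b (of_real t * z)))"
          by (simp add: eq norm_mult x_def)
        also have "\<dots> \<le> x * ((M * exp (\<alpha> / 2 * x\<^sup>2) * exp (- \<beta> * x\<^sup>2 * (1 - t))) * (B * (1 + x)))"
          using 1 4 x M by (intro mult_left_mono mult_mono) auto
        also have "\<dots> = N * (\<beta> * x\<^sup>2) * exp (- \<beta> * x\<^sup>2 * (1 - t))"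
          using x \<beta> by (simp add: N_def power2_eq_square)
        finally show ?thesis .
      qed
    qed simp
    then have "cmod (F z) \<le> N * (1 - exp (- \<beta> * x\<^sup>2))" using F0 by (simp add: \<phi>_def right_diff_distrib)
    then have "damped F z \<le> N * (1 - exp (- \<beta> * x\<^sup>2)) * exp (- (\<alpha> / 2) * x\<^sup>2)"
      unfolding damped_def x_def[symmetric] by (rule mult_right_mono) simp
    also have "\<dots> = B * M * ((1 + x) / (\<beta> * x) * (1 - exp (- \<beta> * x\<^sup>2)))"
      by (simp add: N_def exp_minus)
    also have "\<dots> \<le> B * M * (2 + 2 / \<beta>)"
    proof (rule mult_left_mono)
      \<comment> \<open>For small x the singular 1/x is compensated by 1 - exp(-\<beta> x^2) \<le>
        \<beta> x^2; for x > 1 the trivial bound 1 on this difference suffices.\<close>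
      show "(1 + x) / (\<beta> * x) * (1 - exp (- \<beta> * x\<^sup>2)) \<le> 2 + 2 / \<beta>"
      proof (cases "x \<le> 1")
        case True
        have "1 - exp (- \<beta> * x\<^sup>2) \<le> \<beta> * x\<^sup>2" using exp_ge_add_one_self[of "- \<beta> * x\<^sup>2"] by linarith
        then have "(1 + x) / (\<beta> * x) * (1 - exp (- \<beta> * x\<^sup>2)) \<le> (1 + x) / (\<beta> * x) * (\<beta> * x\<^sup>2)"
          using x \<beta> by (intro mult_left_mono) auto
        also have "\<dots> = (1 + x) * x" using x \<beta> by (simp add: power2_eq_square)
        also have "\<dots> \<le> 2 * 1" using x True by (intro mult_mono) auto
        also have "\<dots> \<le> 2 + 2 / \<beta>" using \<beta> by simp
        finally show ?thesis .
      next
        case False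
        have "(1 + x) / (\<beta> * x) * (1 - exp (- \<beta> * x\<^sup>2)) \<le> (1 + x) / (\<beta> * x) * 1"
          using x \<beta> by (intro mult_left_mono) auto
        also have "\<dots> \<le> (2 * x) / (\<beta> * x)" using False x \<beta> unfolding mult_1_right by (intro divide_right_mono) auto
        also have "\<dots> \<le> 2 + 2 / \<beta>" using x by simp
        finally show ?thesis .
      qed
    qed (use B M in auto)
    also have "\<dots> \<le> B * (damped f (of_real t0 * z) * (exp (\<eta> * \<eta> / \<beta>) * exp (- \<eta> * dist z (of_real t0 * z)))) * (2 + 2 / \<beta>)"
    proof (intro mult_right_mono mult_left_mono)
      have "z - of_real t0 * z = of_real (1 - t0) * z" by (simp add: algebra_simps)
      then have d: "dist z (of_real t0 * z) = (1 - t0) * x"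
        using t0(1) unfolding dist_norm by (simp only: norm_mult norm_of_real x_def) simp
      \<comment> \<open>The left side is \<eta> times the distance from \<open>z\<close> to y. If
        \<beta> x \<ge> \<eta>, the decay dominates it outright; otherwise the distance is at most
        \<eta> / \<beta>, at a cost of \<eta>^2 / \<beta>.\<close>
      have "\<eta> * ((1 - t0) * x) \<le> \<eta> * \<eta> / \<beta> + \<beta> * x\<^sup>2 * (1 - t0)"
      proof (cases "\<eta> \<le> \<beta> * x")
        case True
        have "\<eta> * ((1 - t0) * x) \<le> (\<beta> * x) * ((1 - t0) * x)"
          using True t0(1) x by (intro mult_right_mono) auto
        also have "\<dots> = \<beta> * x\<^sup>2 * (1 - t0)" by (simp add: power2_eq_square)
        finally show ?thesis using \<beta> \<eta> by (simp add: add_increasing)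
      next
        case False
        then have "x \<le> \<eta> / \<beta>" using \<beta> by (simp add: pos_le_divide_eq mult.commute)
        then have "\<eta> * ((1 - t0) * x) \<le> \<eta> * (1 * (\<eta> / \<beta>))"
          using t0(1) x \<eta> by (intro mult_left_mono mult_mono) auto
        moreover have "0 \<le> \<beta> * x\<^sup>2 * (1 - t0)" using \<beta> t0(1) by simp
        ultimately show ?thesis by simp
      qed
      then have "exp (- \<beta> * x\<^sup>2 * (1 - t0)) \<le> exp (\<eta> * \<eta> / \<beta>) * exp (- \<eta> * dist z (of_real t0 * z))"
        unfolding d by (simp flip: exp_add)
      then show "M \<le> damped f (of_real t0 * z) * (exp (\<eta> * \<eta> / \<beta>) * exp (- \<eta> * dist z (of_real t0 * z)))"
        unfolding M_def \<psi>_def by (intro mult_left_mono) auto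
    qed (use B \<beta> in auto)
    also have "\<dots> = A * damped f (of_real t0 * z) * exp (- \<eta> * dist z (of_real t0 * z))"
      by (simp add: A_def mult_ac)
    finally show ?thesis by blast
  qed
  show ?thesis
  proof (rule that[OF A])
    fix F f b z
    assume "F holomorphic_on UNIV" "f holomorphic_on UNIV" "\<And>z. deriv F z = f z * b z"
      "\<And>z. cmod (b z) \<le> B * (1 + cmod z)" "F 0 = 0"
    then show "\<exists>y. damped F z \<le> A * damped f y * exp (- \<eta> * dist z y)" by (rule main[of F f b])
  qed
qed

lemma fock_integral_le_of_deriv_eq_affine_mult:
  assumes a: "a \<noteq> 0"
  obtains C where "C > 0" "\<And>F f. F holomorphic_on UNIV \<Longrightarrow> f holomorphic_on UNIV \<Longrightarrow>
    (\<And>z. deriv F z = f z * (a * (z - \<zeta>))) \<Longrightarrow> fock_integral p \<alpha> w f \<le> ennreal C * fock_integral p \<alpha> w F"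
proof -
  obtain \<eta> C where \<eta>: "\<eta> > 0" and C: "C > 0" and schur: "\<And>F1 F2 A. F1 holomorphic_on UNIV \<Longrightarrow> F2 holomorphic_on UNIV \<Longrightarrow> A \<ge> 0 \<Longrightarrow>
      (\<And>z. \<exists>y. damped F1 z \<le> A * damped F2 y * exp (- \<eta> * dist z y)) \<Longrightarrow>
      fock_integral p \<alpha> w F1 \<le> ennreal (C * A powr p) * fock_integral p \<alpha> w F2"
    using schur_test by blast
  obtain A where A: "A \<ge> 0" and AF: "\<And>F f z. F holomorphic_on UNIV \<Longrightarrow> f holomorphic_on UNIV \<Longrightarrow>
    (\<And>z. deriv F z = f z * (a * (z - \<zeta>))) \<Longrightarrow> \<exists>y. damped f z \<le> A * damped F y * exp (- \<eta> * dist z y)"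
    using damped_le_of_deriv_eq_affine_mult[OF a \<eta>] by blast
  show ?thesis
  proof (rule that)
    \<comment> \<open>\<open>A\<close> may be 0, hence the summand 1.\<close>
    show "C * A powr p + 1 > 0" using C by (simp add: add_nonneg_pos)
    show "fock_integral p \<alpha> w f \<le> ennreal (C * A powr p + 1) * fock_integral p \<alpha> w F"
      if "F holomorphic_on UNIV" "f holomorphic_on UNIV" "\<And>z. deriv F z = f z * (a * (z - \<zeta>))" for F f
    proof -
      have "fock_integral p \<alpha> w f \<le> ennreal (C * A powr p) * fock_integral p \<alpha> w F"
        by (rule schur[OF that(2,1) A AF[OF that]])
      also have "\<dots> \<le> ennreal (C * A powr p + 1) * fock_integral p \<alpha> w F"
        by (intro mult_right_mono ennreal_leI) auto
      finally show ?thesis .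
    qed
  qed
qed

lemma fock_integral_primitive_le:
  assumes B: "B \<ge> 0"
  obtains C where "C > 0" "\<And>F f b. F holomorphic_on UNIV \<Longrightarrow> f holomorphic_on UNIV \<Longrightarrow>
    (\<And>z. deriv F z = f z * b z) \<Longrightarrow> (\<And>z. cmod (b z) \<le> B * (1 + cmod z)) \<Longrightarrow> F 0 = 0 \<Longrightarrow>
    fock_integral p \<alpha> w F \<le> ennreal C * fock_integral p \<alpha> w f"
proof -
  obtain \<eta> C where \<eta>: "\<eta> > 0" and C: "C > 0" and schur: "\<And>F1 F2 A. F1 holomorphic_on UNIV \<Longrightarrow> F2 holomorphic_on UNIV \<Longrightarrow> A \<ge> 0 \<Longrightarrow>
      (\<And>z. \<exists>y. damped F1 z \<le> A * damped F2 y * exp (- \<eta> * dist z y)) \<Longrightarrow>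
      fock_integral p \<alpha> w F1 \<le> ennreal (C * A powr p) * fock_integral p \<alpha> w F2"
    using schur_test by blast
  obtain A where A: "A \<ge> 0" and AF: "\<And>F f b z. F holomorphic_on UNIV \<Longrightarrow> f holomorphic_on UNIV \<Longrightarrow>
    (\<And>z. deriv F z = f z * b z) \<Longrightarrow> (\<And>z. cmod (b z) \<le> B * (1 + cmod z)) \<Longrightarrow> F 0 = 0 \<Longrightarrow>
    \<exists>y. damped F z \<le> A * damped f y * exp (- \<eta> * dist z y)"
    using damped_primitive_le[OF B \<eta>] by blast
  show ?thesis
  proof (rule that)
    show "C * A powr p + 1 > 0" using C by (simp add: add_nonneg_pos)
    show "fock_integral p \<alpha> w F \<le> ennreal (C * A powr p + 1) * fock_integral p \<alpha> w f"
      if "F holomorphic_on UNIV" "f holomorphic_on UNIV" "\<And>z. deriv F z = f z * b z"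
        "\<And>z. cmod (b z) \<le> B * (1 + cmod z)" "F 0 = 0" for F f b
    proof -
      have "fock_integral p \<alpha> w F \<le> ennreal (C * A powr p) * fock_integral p \<alpha> w f"
        by (rule schur[OF that(1,2) A AF[OF that]])
      also have "\<dots> \<le> ennreal (C * A powr p + 1) * fock_integral p \<alpha> w f"
        by (intro mult_right_mono ennreal_leI) auto
      finally show ?thesis .
    qed
  qed
qed

end

section \<open>The metric of the weighted Fock space\<close>

lemma powr_add_le:
  fixes a b p :: real
  assumes "0 \<le> a" "0 \<le> b" "0 < p" "p \<le> 1"
  shows "(a + b) powr p \<le> a powr p + b powr p"
proof (cases "a + b = 0")
  case False
  then have s: "a + b > 0" using assms by linarith
  have "x \<le> x powr p" if "0 \<le> x" "x \<le> 1" for x :: real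
    using powr_mono'[of p 1 x] that assms by simp
  from this[of "a / (a + b)"] this[of "b / (a + b)"] assms s
  have "a / (a + b) + b / (a + b) \<le> (a / (a + b)) powr p + (b / (a + b)) powr p"
    by (intro add_mono) (auto simp: divide_le_eq)
  also have "a / (a + b) + b / (a + b) = 1" using s by (simp add: add_divide_distrib[symmetric])
  also have "(a / (a + b)) powr p + (b / (a + b)) powr p = (a powr p + b powr p) / (a + b) powr p"
    using assms s by (simp add: powr_divide add_divide_distrib)
  finally show ?thesis using s by (simp add: le_divide_eq)
qed (use assms in auto)

text \<open>Convexity of the power function at the points x/t and y/(1 - t). The free parameter t is
  optimized later, which yields Minkowski's inequality.\<close>

lemma powr_add_le_weighted:
  fixes x y t p :: real
  assumes "0 \<le> x" "0 \<le> y" "0 < t" "t < 1" "1 \<le> p"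
  shows "(x + y) powr p \<le> t powr (1 - p) * x powr p + (1 - t) powr (1 - p) * y powr p"
proof -
  have tp: "s * (u / s) powr p = s powr (1 - p) * u powr p" if "s > 0" "u \<ge> 0" for s u :: real
    using that by (simp add: powr_divide powr_diff)
  consider "x = 0" | "y = 0" | "x > 0" "y > 0" using assms by linarith
  then show ?thesis
  proof cases
    case 1
    have "1 \<le> (1 - t) powr (1 - p)" using assms powr_mono'[of "1 - p" 0 "1 - t"] by simp
    then have "1 * y powr p \<le> (1 - t) powr (1 - p) * y powr p" by (rule mult_right_mono) simp
    then show ?thesis using 1 by simp
  next
    case 2
    have "1 \<le> t powr (1 - p)" using assms powr_mono'[of "1 - p" 0 t] by simp
    then have "1 * x powr p \<le> t powr (1 - p) * x powr p" by (rule mult_right_mono) simp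
    then show ?thesis using 2 by simp
  next
    case 3
    have "((1 - t) *\<^sub>R (y / (1 - t)) + t *\<^sub>R (x / t)) powr p \<le> (1 - t) * (y / (1 - t)) powr p + t * (x / t) powr p"
      using assms 3 by (intro convex_onD[OF powr_convex]) auto
    moreover have "(1 - t) *\<^sub>R (y / (1 - t)) + t *\<^sub>R (x / t) = x + y" using assms by simp
    ultimately show ?thesis using assms by (simp add: tp add.commute)
  qed
qed

context fock_weight
begin

section \<open>The triangle inequality and point evaluations\<close>

abbreviation \<open>fock \<equiv> fock_space p \<alpha> w\<close>
abbreviation \<open>fint \<equiv> fock_integral p \<alpha> w\<close>
abbreviation \<open>fdist \<equiv> fock_dist p \<alpha> w\<close>

text \<open>The p-th power of the quasi-norm as a real number. Since \<open>enn2real\<close> sends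
  infinity to 0, the value is meaningful on \<open>fock\<close> only, so estimates are paired with
  membership.\<close>

definition fpow :: "(complex \<Rightarrow> complex) \<Rightarrow> real" where
  "fpow f = enn2real (fint f)"

lemma fock_entire: "f \<in> fock \<Longrightarrow> f holomorphic_on UNIV"
  and fock_finite: "f \<in> fock \<Longrightarrow> fint f = ennreal (fpow f)"
  by (auto simp: fock_space_def fpow_def)

lemma fpow_nonneg [simp]: "0 \<le> fpow f"
  by (simp add: fpow_def)

lemma fint_le_imp:
  assumes "f holomorphic_on UNIV" "fint f \<le> ennreal b" "0 \<le> b"
  shows "f \<in> fock" "fpow f \<le> b"
proof -
  show "f \<in> fock" using assms by (auto simp: fock_space_def intro: le_less_trans)
  then show "fpow f \<le> b" using assms fock_finite[of f] by (simp add: ennreal_le_iff)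
qed

lemma fint_cmult:
  fixes f :: "complex \<Rightarrow> complex"
  assumes "f holomorphic_on UNIV"
  shows "fint (\<lambda>z. b * f z) = ennreal (cmod b powr p) * fint f"
proof -
  have [measurable]: "damped f \<in> borel_measurable borel" by (rule damped_measurable[OF assms])
  have "(\<lambda>z. b * f z) holomorphic_on UNIV" using assms by (intro holomorphic_intros)
  moreover have "ennreal (damped (\<lambda>z. b * f z) z powr p) = ennreal (cmod b powr p) * ennreal (damped f z powr p)" for z
    by (simp add: damped_def norm_mult powr_mult mult.assoc ennreal_mult'[symmetric])
  ultimately show ?thesis
    unfolding fock_integral_eq[OF assms] by (simp add: fock_integral_eq nn_integral_cmult)
qed

lemma fock_cmult:
  fixes f :: "complex \<Rightarrow> complex"
  assumes "f \<in> fock"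
  shows "(\<lambda>z. b * f z) \<in> fock" "fpow (\<lambda>z. b * f z) = cmod b powr p * fpow f"
proof -
  have h: "f holomorphic_on UNIV" "(\<lambda>z. b * f z) holomorphic_on UNIV"
    using fock_entire[OF assms] by (auto intro!: holomorphic_intros)
  have "fint (\<lambda>z. b * f z) = ennreal (cmod b powr p * fpow f)"
    using fint_cmult[OF h(1)] fock_finite[OF assms] by (simp add: ennreal_mult')
  then show "(\<lambda>z. b * f z) \<in> fock" "fpow (\<lambda>z. b * f z) = cmod b powr p * fpow f"
    using h by (auto simp: fock_space_def fpow_def)
qed

text \<open>The scalar inequality is a parameter because three versions are used: subadditivity for
  p \<le> 1, the weighted form for p > 1, and a crude one with constant
  \<open>2 powr p\<close>.\<close>

lemma fint_add_le:
  assumes f: "f holomorphic_on UNIV" and h: "h holomorphic_on UNIV" and ab: "0 \<le> a" "0 \<le> b"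
    and le: "\<And>x y. 0 \<le> x \<Longrightarrow> 0 \<le> y \<Longrightarrow> (x + y) powr p \<le> a * x powr p + b * y powr p"
  shows "fint (\<lambda>z. f z + h z) \<le> ennreal a * fint f + ennreal b * fint h"
proof -
  have [measurable]: "damped f \<in> borel_measurable borel" "damped h \<in> borel_measurable borel"
    by (rule damped_measurable[OF f], rule damped_measurable[OF h])
  have "(\<lambda>z. f z + h z) holomorphic_on UNIV" using f h by (intro holomorphic_intros)
  then have "fint (\<lambda>z. f z + h z) = (\<integral>\<^sup>+z. ennreal (damped (\<lambda>z. f z + h z) z powr p) \<partial>\<mu>)"
    by (rule fock_integral_eq)
  also have "\<dots> \<le> (\<integral>\<^sup>+z. ennreal a * ennreal (damped f z powr p) + ennreal b * ennreal (damped h z powr p) \<partial>\<mu>)"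
  proof (rule nn_integral_mono)
    fix z
    have "damped (\<lambda>z. f z + h z) z \<le> damped f z + damped h z"
      unfolding damped_def distrib_right[symmetric] by (intro mult_right_mono norm_triangle_ineq) simp
    then have "damped (\<lambda>z. f z + h z) z powr p \<le> (damped f z + damped h z) powr p"
      using p_pos by (intro powr_mono2) auto
    also have "\<dots> \<le> a * damped f z powr p + b * damped h z powr p" by (intro le) auto
    finally show "ennreal (damped (\<lambda>z. f z + h z) z powr p)
        \<le> ennreal a * ennreal (damped f z powr p) + ennreal b * ennreal (damped h z powr p)"
      using ab by (simp add: ennreal_mult'[symmetric] ennreal_leI flip: ennreal_plus)
  qed
  also have "\<dots> = ennreal a * fint f + ennreal b * fint h"
    unfolding fock_integral_eq[OF f] fock_integral_eq[OF h]
    by (subst nn_integral_add, measurable, subst nn_integral_cmult, measurable, subst nn_integral_cmult, measurable)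
  finally show ?thesis .
qed

lemma fock_add_le:
  assumes "f \<in> fock" "h \<in> fock" and ab: "0 \<le> a" "0 \<le> b"
    and le: "\<And>x y. 0 \<le> x \<Longrightarrow> 0 \<le> y \<Longrightarrow> (x + y) powr p \<le> a * x powr p + b * y powr p"
  shows "(\<lambda>z. f z + h z) \<in> fock" "fpow (\<lambda>z. f z + h z) \<le> a * fpow f + b * fpow h"
proof -
  have hol: "f holomorphic_on UNIV" "h holomorphic_on UNIV" "(\<lambda>z. f z + h z) holomorphic_on UNIV"
    using assms(1,2) by (auto intro!: holomorphic_intros dest: fock_entire)
  have *: "fint (\<lambda>z. f z + h z) \<le> ennreal (a * fpow f + b * fpow h)"
    using fint_add_le[OF hol(1,2) ab le] ab assms(1,2) by (simp add: fock_finite ennreal_mult')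
  show "(\<lambda>z. f z + h z) \<in> fock" "fpow (\<lambda>z. f z + h z) \<le> a * fpow f + b * fpow h"
    using fint_le_imp[OF hol(3) *] ab by auto
qed

lemma fock_add:
  assumes "f \<in> fock" "h \<in> fock"
  shows "(\<lambda>z. f z + h z) \<in> fock" "fpow (\<lambda>z. f z + h z) \<le> 2 powr p * fpow f + 2 powr p * fpow h"
proof -
  have "(x + y) powr p \<le> 2 powr p * x powr p + 2 powr p * y powr p" if "0 \<le> x" "0 \<le> y" for x y :: real
  proof -
    have "(x + y) powr p \<le> (2 * max x y) powr p" using that p_pos by (intro powr_mono2) auto
    also have "\<dots> = 2 powr p * max x y powr p" using that by (simp add: powr_mult)
    also have "\<dots> \<le> 2 powr p * (x powr p + y powr p)" by (intro mult_left_mono) (auto simp: max_def)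
    finally show ?thesis by (simp add: distrib_left)
  qed
  from fock_add_le[OF assms _ _ this] show "(\<lambda>z. f z + h z) \<in> fock"
    "fpow (\<lambda>z. f z + h z) \<le> 2 powr p * fpow f + 2 powr p * fpow h" by auto
qed

lemma fock_diff:
  assumes "f \<in> fock" "h \<in> fock"
  shows "(\<lambda>z. f z - h z) \<in> fock" "fpow (\<lambda>z. f z - h z) \<le> 2 powr p * fpow f + 2 powr p * fpow h"
  using fock_add[OF assms(1) fock_cmult(1)[OF assms(2), where b = "-1"]] fock_cmult(2)[OF assms(2), where b = "-1"] by auto

text \<open>On a bounded disc the Gaussian is bounded below, and so is \<open>mass\<close>, by
  chaining from the origin; the point bound then has a constant independent of the point.\<close>

lemma eval_bound:
  "\<exists>C>0. \<forall>f\<in>fock. \<forall>z. cmod z \<le> N \<longrightarrow> cmod (f z) powr p \<le> C * fpow f"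
proof -
  obtain C0 where C0: "C0 > 0" and bd: "\<And>F z. F holomorphic_on UNIV \<Longrightarrow>
    ennreal (damped F z powr p * mass z) \<le> ennreal C0 * fint F" using point_bound by blast
  obtain n :: nat where n: "N / R \<le> real n" using real_arch_simple by blast
  define e where "e = exp (- (\<alpha> / 2) * N\<^sup>2) powr p"
  define C where "C = C0 * K ^ n / (e * mass 0)"
  have e: "e > 0" by (simp add: e_def)
  have Kn: "K ^ n > 0" using K_ge_1 by simp
  have C: "C > 0" using C0 e Kn mass_pos[of 0] by (simp add: C_def)
  have "cmod (f z) powr p \<le> C * fpow f" if f: "f \<in> fock" and z: "cmod z \<le> N" for f z
  proof -
    have "ennreal (damped f z powr p * mass z) \<le> ennreal (C0 * fpow f)"
      using bd[OF fock_entire[OF f], of z] C0 by (simp add: fock_finite[OF f] ennreal_mult')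
    then have 1: "damped f z powr p * mass z \<le> C0 * fpow f" using C0 by (simp add: ennreal_le_iff)
    have "N \<le> real n * R" using n R_pos by (simp add: pos_divide_le_eq)
    then have "dist 0 z \<le> real n * R" using z by simp
    then have 2: "mass 0 \<le> K ^ n * mass z" by (rule mass_le_chain)
    have "(cmod z)\<^sup>2 \<le> N\<^sup>2" using z by (intro power_mono) auto
    then have "\<alpha> / 2 * (cmod z)\<^sup>2 \<le> \<alpha> / 2 * N\<^sup>2" using \<alpha>_pos by (intro mult_left_mono) auto
    then have "exp (- (\<alpha> / 2) * N\<^sup>2) \<le> exp (- (\<alpha> / 2) * (cmod z)\<^sup>2)" by simp
    then have "cmod (f z) * exp (- (\<alpha> / 2) * N\<^sup>2) \<le> damped f z" unfolding damped_def by (rule mult_left_mono) simp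
    from powr_mono2[OF less_imp_le[OF p_pos] _ this]
    have "(cmod (f z) * exp (- (\<alpha> / 2) * N\<^sup>2)) powr p \<le> damped f z powr p" by simp
    then have 3: "cmod (f z) powr p * e \<le> damped f z powr p" unfolding e_def by (simp only: powr_mult)
    have "cmod (f z) powr p * e * mass 0 \<le> damped f z powr p * (K ^ n * mass z)"
      by (rule mult_mono[OF 3 2]) (use mass_pos[of 0] in \<open>simp_all add: less_imp_le\<close>)
    also have "\<dots> = K ^ n * (damped f z powr p * mass z)" by (simp only: mult_ac)
    also have "\<dots> \<le> K ^ n * (C0 * fpow f)" using 1 Kn by (intro mult_left_mono) auto
    finally have "cmod (f z) powr p * (e * mass 0) \<le> K ^ n * (C0 * fpow f)" unfolding mult.assoc .
    then have "cmod (f z) powr p \<le> K ^ n * (C0 * fpow f) / (e * mass 0)"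
      by (rule iffD2[OF pos_le_divide_eq[OF mult_pos_pos[OF e mass_pos]]])
    also have "\<dots> = C * fpow f" unfolding C_def by simp
    finally show ?thesis .
  qed
  with C show ?thesis by blast
qed

text \<open>Vanishing everywhere, not just almost everywhere, is what makes \<open>fdist\<close>
  separate functions; it comes from point evaluation.\<close>

lemma fpow_eq_0:
  assumes "f \<in> fock" "fpow f = 0"
  shows "f z = 0"
proof -
  obtain C where "\<forall>f\<in>fock. \<forall>u. cmod u \<le> cmod z \<longrightarrow> cmod (f u) powr p \<le> C * fpow f"
    using eval_bound[of "cmod z"] by blast
  then have "cmod (f z) powr p \<le> C * fpow f" using assms(1) by blast
  then show ?thesis using assms(2) by simp
qed

lemma fint_minus_commute: "fint (\<lambda>z. f z - h z) = fint (\<lambda>z. h z - f z)"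
  unfolding fock_integral_def by (simp add: norm_minus_commute)

text \<open>The power turning \<open>fpow\<close> into the metric: 1 for p \<le> 1 and 1/p for p >
  1.\<close>

definition fexp :: real where "fexp = min 1 p / p"

lemma fexp_pos: "fexp > 0" using p_pos by (simp add: fexp_def)

lemma fdist_eq: "fdist f h = fpow (\<lambda>z. f z - h z) powr fexp"
  using p_pos
  by (simp add: fock_dist_def fock_norm_def ennpowr_def fpow_def fexp_def powr_powr)

lemma fdist_less_iff:
  assumes "\<epsilon> > 0"
  shows "fdist f h < \<epsilon> powr fexp \<longleftrightarrow> fpow (\<lambda>z. f z - h z) < \<epsilon>"
  unfolding fdist_eq
  using assms fexp_pos powr_less_mono2[of fexp "fpow (\<lambda>z. f z - h z)" \<epsilon>]
    powr_mono2[of fexp \<epsilon> "fpow (\<lambda>z. f z - h z)"] by (cases "fpow (\<lambda>z. f z - h z) < \<epsilon>") auto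

lemma fpow_add_powr_le:
  assumes f: "f \<in> fock" and h: "h \<in> fock"
  shows "fpow (\<lambda>z. f z + h z) powr fexp \<le> fpow f powr fexp + fpow h powr fexp"
proof (cases "p \<le> 1")
  case True
  then have "fexp = 1" using p_pos by (simp add: fexp_def)
  moreover have "fpow (\<lambda>z. f z + h z) \<le> 1 * fpow f + 1 * fpow h"
    using powr_add_le True p_pos by (intro fock_add_le(2) f h) auto
  ultimately show ?thesis by simp
next
  case False
  then have p: "1 \<le> p" "fexp = 1 / p" by (auto simp: fexp_def)
  define a b where "a = fpow f powr fexp" and "b = fpow h powr fexp"
  have ab: "fpow f = a powr p" "fpow h = b powr p"
    using p by (auto simp: a_def b_def powr_powr)
  have "a \<ge> 0" "b \<ge> 0" by (simp_all add: a_def b_def)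
  then consider "a = 0" | "b = 0" | "a > 0" "b > 0" by linarith
  then show ?thesis
  proof cases
    case 1
    then have "f z = 0" for z using fpow_eq_0[OF f] ab p_pos by simp
    then show ?thesis by simp
  next
    case 2
    then have "h z = 0" for z using fpow_eq_0[OF h] ab p_pos by simp
    then show ?thesis by simp
  next
    case 3
    \<comment> \<open>The optimal parameter: the two terms become (a + b)^(p-1) a and (a + b)^(p-1)
      b, with sum (a + b)^p. It lies strictly between 0 and 1 only if both norms are positive, hence
      the separate cases.\<close>
    define t where "t = a / (a + b)"
    have t: "0 < t" "t < 1" "1 - t = b / (a + b)" using 3 by (auto simp: t_def field_simps)
    have s: "(u / (a + b)) powr (1 - p) * u powr p = (a + b) powr (p - 1) * u" if "u > 0" for u
    proof -
      have "(u / (a + b)) powr (1 - p) * u powr p = u powr ((1 - p) + p) / (a + b) powr (1 - p)"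
        unfolding powr_add using that 3 by (simp add: powr_divide)
      then show ?thesis using that 3 by (simp add: powr_diff)
    qed
    have "fpow (\<lambda>z. f z + h z) \<le> t powr (1 - p) * fpow f + (1 - t) powr (1 - p) * fpow h"
      by (intro fock_add_le(2) f h powr_add_le_weighted) (use t(1,2) p in auto)
    also have "\<dots> = (a + b) powr (p - 1) * a + (a + b) powr (p - 1) * b"
      unfolding ab t(3) unfolding t_def using 3 by (simp add: s)
    also have "\<dots> = (a + b) powr p" unfolding distrib_left[symmetric] using 3 by (simp add: powr_diff)
    finally have "fpow (\<lambda>z. f z + h z) powr fexp \<le> ((a + b) powr p) powr fexp"
      using fexp_pos by (intro powr_mono2) auto
    also have "\<dots> = a + b" using p 3 by (simp add: powr_powr)
    finally show ?thesis by (simp add: a_def b_def)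
  qed
qed

sublocale fock: Metric_space fock fdist
proof
  fix f g h :: "complex \<Rightarrow> complex"
  show "0 \<le> fdist f g" by (simp add: fdist_eq)
  show "fdist f g = fdist g f" by (simp add: fdist_eq fpow_def fint_minus_commute[of f g])
  show "fdist f g = 0 \<longleftrightarrow> f = g" if "f \<in> fock" "g \<in> fock"
  proof
    assume "fdist f g = 0"
    then have "fpow (\<lambda>z. f z - g z) = 0" by (simp add: fdist_eq)
    from fpow_eq_0[OF fock_diff(1)[OF that] this] show "f = g" by auto
  next
    assume "f = g"
    then show "fdist f g = 0"
      using p_pos by (simp add: fdist_eq fpow_def fock_integral_def)
  qed
  show "fdist f h \<le> fdist f g + fdist g h" if "f \<in> fock" "g \<in> fock" "h \<in> fock"
    using fpow_add_powr_le[OF fock_diff(1)[OF that(1,2)] fock_diff(1)[OF that(2,3)]] by (simp add: fdist_eq)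
qed

lemma fock_topology_eq: "fock_topology p \<alpha> w = fock.mtopology"
  by (simp add: fock_topology_def)

text \<open>Raising to the power \<open>fexp\<close> is an increasing bijection of the half-line, so
  convergence, and likewise the Cauchy property, can be tested with \<open>fpow\<close>, in which
  the operator estimates are linear.\<close>

lemma limitin_fock_iff:
  "limitin fock.mtopology \<sigma> l sequentially \<longleftrightarrow>
    l \<in> fock \<and> (\<forall>\<epsilon>>0. \<forall>\<^sub>F n in sequentially. \<sigma> n \<in> fock \<and> fpow (\<lambda>z. \<sigma> n z - l z) < \<epsilon>)"
proof -
  have "(\<forall>\<epsilon>>0. \<forall>\<^sub>F n in sequentially. \<sigma> n \<in> fock \<and> fdist (\<sigma> n) l < \<epsilon>)
    \<longleftrightarrow> (\<forall>\<epsilon>>0. \<forall>\<^sub>F n in sequentially. \<sigma> n \<in> fock \<and> fpow (\<lambda>z. \<sigma> n z - l z) < \<epsilon>)" (is "?L \<longleftrightarrow> ?R")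
  proof
    assume ?L
    show ?R
    proof (intro allI impI)
      fix \<epsilon> :: real assume "\<epsilon> > 0"
      then show "\<forall>\<^sub>F n in sequentially. \<sigma> n \<in> fock \<and> fpow (\<lambda>z. \<sigma> n z - l z) < \<epsilon>"
        using \<open>?L\<close>[rule_format, of "\<epsilon> powr fexp"] by (simp add: fdist_less_iff)
    qed
  next
    assume ?R
    show ?L
    proof (intro allI impI)
      fix \<epsilon> :: real assume "\<epsilon> > 0"
      then show "\<forall>\<^sub>F n in sequentially. \<sigma> n \<in> fock \<and> fdist (\<sigma> n) l < \<epsilon>"
        using \<open>?R\<close>[rule_format, of "\<epsilon> powr (1 / fexp)"] fdist_less_iff[of "\<epsilon> powr (1 / fexp)"] fexp_pos
        by (simp add: powr_powr)
    qed
  qed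
  then show ?thesis unfolding fock.limitin_metric by simp
qed

lemma MCauchy_fock_iff:
  "fock.MCauchy \<sigma> \<longleftrightarrow> range \<sigma> \<subseteq> fock \<and> (\<forall>\<epsilon>>0. \<exists>N. \<forall>n n'. N \<le> n \<longrightarrow> N \<le> n' \<longrightarrow> fpow (\<lambda>z. \<sigma> n z - \<sigma> n' z) < \<epsilon>)"
proof -
  have "(\<forall>\<epsilon>>0. \<exists>N. \<forall>n n'. N \<le> n \<longrightarrow> N \<le> n' \<longrightarrow> fdist (\<sigma> n) (\<sigma> n') < \<epsilon>)
    \<longleftrightarrow> (\<forall>\<epsilon>>0. \<exists>N. \<forall>n n'. N \<le> n \<longrightarrow> N \<le> n' \<longrightarrow> fpow (\<lambda>z. \<sigma> n z - \<sigma> n' z) < \<epsilon>)" (is "?L \<longleftrightarrow> ?R")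
  proof
    assume ?L
    show ?R
    proof (intro allI impI)
      fix \<epsilon> :: real assume "\<epsilon> > 0"
      then show "\<exists>N. \<forall>n n'. N \<le> n \<longrightarrow> N \<le> n' \<longrightarrow> fpow (\<lambda>z. \<sigma> n z - \<sigma> n' z) < \<epsilon>"
        using \<open>?L\<close>[rule_format, of "\<epsilon> powr fexp"] by (simp add: fdist_less_iff)
    qed
  next
    assume ?R
    show ?L
    proof (intro allI impI)
      fix \<epsilon> :: real assume "\<epsilon> > 0"
      then show "\<exists>N. \<forall>n n'. N \<le> n \<longrightarrow> N \<le> n' \<longrightarrow> fdist (\<sigma> n) (\<sigma> n') < \<epsilon>"
        using \<open>?R\<close>[rule_format, of "\<epsilon> powr (1 / fexp)"] fdist_less_iff[of "\<epsilon> powr (1 / fexp)"] fexp_pos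
        by (simp add: powr_powr)
    qed
  qed
  then show ?thesis unfolding fock.MCauchy_def by simp
qed

section \<open>Fatou's lemma and completeness\<close>

lemma fint_limit_le:
  assumes hol: "\<And>n. \<sigma> n holomorphic_on UNIV" "f holomorphic_on UNIV"
    and lim: "\<And>z. (\<lambda>n. \<sigma> n z) \<longlonglongrightarrow> f z" and le: "\<forall>\<^sub>F n in sequentially. fint (\<sigma> n) \<le> B"
  shows "fint f \<le> B"
proof -
  have [measurable]: "damped (\<sigma> n) \<in> borel_measurable borel" for n by (rule damped_measurable[OF hol(1)])
  have "(\<lambda>n. ennreal (damped (\<sigma> n) z powr p)) \<longlonglongrightarrow> ennreal (damped f z powr p)" for z
    unfolding damped_def using p_pos
    by (intro tendsto_ennrealI tendsto_powr' tendsto_mult tendsto_norm lim tendsto_const) auto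
  then have "ennreal (damped f z powr p) = liminf (\<lambda>n. ennreal (damped (\<sigma> n) z powr p))" for z
    by (intro lim_imp_Liminf[symmetric]) auto
  then have "fint f = (\<integral>\<^sup>+z. liminf (\<lambda>n. ennreal (damped (\<sigma> n) z powr p)) \<partial>\<mu>)"
    unfolding fock_integral_eq[OF hol(2)] by simp
  also have "\<dots> \<le> liminf (\<lambda>n. \<integral>\<^sup>+z. ennreal (damped (\<sigma> n) z powr p) \<partial>\<mu>)"
    by (rule nn_integral_liminf) measurable
  also have "\<dots> = liminf (\<lambda>n. fint (\<sigma> n))" by (simp add: fock_integral_eq[OF hol(1)])
  also have "\<dots> \<le> B" using le by (intro Liminf_le) auto
  finally show ?thesis .
qed

text \<open>Point evaluations make a Cauchy sequence uniformly Cauchy on unit discs, so its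
  pointwise limit is entire. Fatou's lemma in the second index, with the first one fixed, shows that
  the differences from the limit lie in the space and are small.\<close>

lemma mcomplete_fock: "fock.mcomplete"
  unfolding fock.mcomplete_def
proof (intro allI impI)
  fix \<sigma> assume "fock.MCauchy \<sigma>"
  then have \<sigma>: "\<And>n. \<sigma> n \<in> fock"
    and cau: "\<And>\<epsilon>. \<epsilon> > 0 \<Longrightarrow> \<exists>N. \<forall>n n'. N \<le> n \<longrightarrow> N \<le> n' \<longrightarrow> fpow (\<lambda>z. \<sigma> n z - \<sigma> n' z) < \<epsilon>"
    unfolding MCauchy_fock_iff by auto
  define l where "l z = lim (\<lambda>n. \<sigma> n z)" for z
  have unif: "uniform_limit (cball z 1) \<sigma> l sequentially" for z
  proof -
    obtain C where C: "C > 0" and ev: "\<forall>f\<in>fock. \<forall>u. cmod u \<le> cmod z + 1 \<longrightarrow> cmod (f u) powr p \<le> C * fpow f"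
      using eval_bound[of "cmod z + 1"] by blast
    have "uniformly_Cauchy_on (cball z 1) \<sigma>"
    proof (rule uniformly_Cauchy_onI)
      fix e :: real assume e: "e > 0"
      then have "e powr p / C > 0" using C by simp
      from cau[OF this] obtain N where N: "\<And>n n'. N \<le> n \<Longrightarrow> N \<le> n' \<Longrightarrow> fpow (\<lambda>z. \<sigma> n z - \<sigma> n' z) < e powr p / C"
        by blast
      have "dist (\<sigma> m u) (\<sigma> n u) < e" if "u \<in> cball z 1" "N \<le> m" "N \<le> n" for u m n
      proof -
        have "cmod u \<le> cmod z + 1"
          using that(1) norm_triangle_ineq[of "u - z" z] by (simp add: dist_norm norm_minus_commute)
        then have "cmod (\<sigma> m u - \<sigma> n u) powr p \<le> C * fpow (\<lambda>z. \<sigma> m z - \<sigma> n z)"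
          using bspec[OF ev fock_diff(1)[OF \<sigma>[of m] \<sigma>[of n]]] by simp
        also have "\<dots> < e powr p" using N[OF that(2,3)] C by (simp add: pos_less_divide_eq mult.commute)
        finally have "cmod (\<sigma> m u - \<sigma> n u) < e" 
          using powr_mono2[of p e "cmod (\<sigma> m u - \<sigma> n u)"] e p_pos by (auto simp: not_less[symmetric])
        then show ?thesis by (simp add: dist_norm)
      qed
      then show "\<exists>M. \<forall>x\<in>cball z 1. \<forall>m\<ge>M. \<forall>n\<ge>M. dist (\<sigma> m x) (\<sigma> n x) < e"
        by (intro exI[of _ N]) simp
    qed
    then have "uniformly_convergent_on (cball z 1) \<sigma>" by (rule Cauchy_uniformly_convergent)
    then show ?thesis unfolding uniformly_convergent_uniform_limit_iff l_def .
  qed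
  have hol: "l holomorphic_on UNIV"
  proof (rule holomorphic_uniform_sequence[of UNIV \<sigma>])
    show "\<exists>d>0. cball z d \<subseteq> UNIV \<and> uniform_limit (cball z d) \<sigma> l sequentially" for z
      using unif[of z] by (intro exI[of _ 1]) simp
  qed (simp_all add: fock_entire[OF \<sigma>])
  have lim: "(\<lambda>n. \<sigma> n z) \<longlonglongrightarrow> l z" for z
    by (rule tendsto_uniform_limitI[OF unif[of z]]) simp
  have close: "\<exists>N. \<forall>n\<ge>N. (\<lambda>z. \<sigma> n z - l z) \<in> fock \<and> fpow (\<lambda>z. \<sigma> n z - l z) \<le> \<epsilon>" if eps: "\<epsilon> > 0" for \<epsilon>
  proof -
    obtain N where N: "\<And>n n'. N \<le> n \<Longrightarrow> N \<le> n' \<Longrightarrow> fpow (\<lambda>z. \<sigma> n z - \<sigma> n' z) < \<epsilon>" using cau[OF eps] by blast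
    have "(\<lambda>z. \<sigma> n z - l z) \<in> fock \<and> fpow (\<lambda>z. \<sigma> n z - l z) \<le> \<epsilon>" if n: "n \<ge> N" for n
    proof -
      have h: "(\<lambda>z. \<sigma> n z - l z) holomorphic_on UNIV" using fock_entire[OF \<sigma>] hol by (intro holomorphic_intros)
      have "fint (\<lambda>z. \<sigma> n z - l z) \<le> ennreal \<epsilon>"
      proof (rule fint_limit_le[where \<sigma> = "\<lambda>m z. \<sigma> n z - \<sigma> m z"])
        show "(\<lambda>z. \<sigma> n z - \<sigma> m z) holomorphic_on UNIV" for m by (rule fock_entire[OF fock_diff(1)[OF \<sigma> \<sigma>]])
        show "(\<lambda>m. \<sigma> n z - \<sigma> m z) \<longlonglongrightarrow> \<sigma> n z - l z" for z by (intro tendsto_intros lim)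
        show "\<forall>\<^sub>F m in sequentially. fint (\<lambda>z. \<sigma> n z - \<sigma> m z) \<le> ennreal \<epsilon>"
          unfolding eventually_sequentially
        proof (intro exI[of _ N] allI impI)
          fix m assume "m \<ge> N"
          then have "fpow (\<lambda>z. \<sigma> n z - \<sigma> m z) \<le> \<epsilon>" using N[OF n] by (simp add: less_imp_le)
          then show "fint (\<lambda>z. \<sigma> n z - \<sigma> m z) \<le> ennreal \<epsilon>"
            unfolding fock_finite[OF fock_diff(1)[OF \<sigma>[of n] \<sigma>[of m]]] by (rule ennreal_leI)
        qed
      qed (rule h)
      then show ?thesis using fint_le_imp[OF h, of \<epsilon>] \<open>\<epsilon> > 0\<close> by auto
    qed
    then show ?thesis by blast
  qed
  have "l \<in> fock"
  proof -
    obtain N where "(\<lambda>z. \<sigma> N z - l z) \<in> fock" using close[of 1] by auto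
    from fock_diff(1)[OF \<sigma>[of N] this] show ?thesis by simp
  qed
  moreover have "\<forall>\<^sub>F n in sequentially. \<sigma> n \<in> fock \<and> fpow (\<lambda>z. \<sigma> n z - l z) < \<epsilon>" if eps: "\<epsilon> > 0" for \<epsilon>
  proof -
    have "\<epsilon> / 2 > 0" using eps by simp
    then obtain N where N: "\<forall>n\<ge>N. fpow (\<lambda>z. \<sigma> n z - l z) \<le> \<epsilon> / 2" using close by blast
    have "fpow (\<lambda>z. \<sigma> n z - l z) < \<epsilon>" if "n \<ge> N" for n
    proof -
      have "fpow (\<lambda>z. \<sigma> n z - l z) \<le> \<epsilon> / 2" using N that by blast
      also have "\<dots> < \<epsilon>" using eps by simp
      finally show ?thesis .
    qed
    then show ?thesis using \<sigma> unfolding eventually_sequentially by blast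
  qed
  ultimately have "limitin fock.mtopology \<sigma> l sequentially" unfolding limitin_fock_iff by blast
  then show "\<exists>x. limitin fock.mtopology \<sigma> x sequentially" by blast
qed

end

section \<open>Bounded below and closed range\<close>

lemma volterra_eqI:
  assumes "\<And>z. (F has_field_derivative f z * deriv g z) (at z)" "F 0 = 0"
  shows "volterra g f = F"
proof
  fix z
  have "((\<lambda>\<xi>. f \<xi> * deriv g \<xi>) has_contour_integral (F z - F 0)) (linepath 0 z)"
    using contour_integral_primitive[of UNIV F "\<lambda>\<xi>. f \<xi> * deriv g \<xi>" "linepath 0 z"] assms(1) by simp
  then show "volterra g f z = F z" using assms(2) by (simp add: volterra_def contour_integral_unique)
qed

lemma volterra_has_derivative:
  assumes "f holomorphic_on UNIV" "g holomorphic_on UNIV"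
  shows "(volterra g f has_field_derivative f z * deriv g z) (at z)"
  using holomorphic_derivI[OF volterra_entire(1)[OF assms] open_UNIV UNIV_I] volterra_entire(2)[OF assms] by simp

lemma volterra_linear:
  assumes "f holomorphic_on UNIV" "h holomorphic_on UNIV" "g holomorphic_on UNIV"
  shows "volterra g (\<lambda>z. f z + h z) = (\<lambda>z. volterra g f z + volterra g h z)"
    and "volterra g (\<lambda>z. f z - h z) = (\<lambda>z. volterra g f z - volterra g h z)"
    and "volterra g (\<lambda>z. b * f z) = (\<lambda>z. b * volterra g f z)"
  using assms
  by (intro volterra_eqI;
      force intro!: derivative_eq_intros volterra_has_derivative simp: volterra_entire(3) algebra_simps)+

lemma quadratic_entire:
  fixes g :: "complex \<Rightarrow> complex"
  assumes "\<And>z. g z = c2 * z\<^sup>2 + c1 * z + c0"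
  shows "g holomorphic_on UNIV" "deriv g z = 2 * c2 * z + c1"
proof -
  have "g = (\<lambda>z. c2 * z\<^sup>2 + c1 * z + c0)" using assms by auto
  then show "g holomorphic_on UNIV" by (auto intro!: holomorphic_intros)
  have "(g has_field_derivative 2 * c2 * z + c1) (at z)"
    unfolding \<open>g = _\<close> by (auto intro!: derivative_eq_intros)
  then show "deriv g z = 2 * c2 * z + c1" by (rule DERIV_imp_deriv)
qed

context fock_weight
begin

lemma fock_norm_eq: "f \<in> fock \<Longrightarrow> fock_norm p \<alpha> w f = ennreal (fpow f powr (1 / p))"
  by (simp add: fock_norm_def ennpowr_def fock_finite)

text \<open>For g' = c1 the function f is recovered from its image as (J_g f)' / c1; this bound
  turns convergence of images into pointwise convergence of preimages.\<close>

lemma deriv_eval_bound: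
  "\<exists>C>0. \<forall>f\<in>fock. cmod (deriv f z) powr p \<le> C * fpow f"
proof -
  obtain C1 where C1: "C1 > 0" and bd: "\<And>F z. F holomorphic_on UNIV \<Longrightarrow>
    \<exists>y\<in>cball z R. damped (deriv F) z \<le> C1 * (1 + cmod z) * damped F y"
    using damped_deriv_bound by blast
  obtain C2 where C2: "C2 > 0" and ev: "\<forall>f\<in>fock. \<forall>u. cmod u \<le> cmod z + R \<longrightarrow> cmod (f u) powr p \<le> C2 * fpow f"
    using eval_bound[of "cmod z + R"] by blast
  define B where "B = exp (\<alpha> / 2 * (cmod z)\<^sup>2) * (C1 * (1 + cmod z))"
  have B: "B > 0" using C1 by (simp add: B_def add_pos_nonneg)
  have "cmod (deriv f z) powr p \<le> (B powr p * C2) * fpow f" if f: "f \<in> fock" for f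
  proof -
    obtain y where y: "y \<in> cball z R" "damped (deriv f) z \<le> C1 * (1 + cmod z) * damped f y"
      using bd[OF fock_entire[OF f]] by blast
    have "cmod y \<le> cmod z + R"
      using y(1) norm_triangle_ineq[of "y - z" z] by (simp add: dist_norm norm_minus_commute)
    then have 1: "cmod (f y) powr p \<le> C2 * fpow f" using ev f by blast
    have "damped f y \<le> cmod (f y)" using \<alpha>_pos by (simp add: damped_def mult_left_le)
    then have "C1 * (1 + cmod z) * damped f y \<le> C1 * (1 + cmod z) * cmod (f y)"
      using C1 by (intro mult_left_mono) auto
    then have "damped (deriv f) z \<le> C1 * (1 + cmod z) * cmod (f y)" using y(2) by linarith
    then have "exp (\<alpha> / 2 * (cmod z)\<^sup>2) * damped (deriv f) z \<le> exp (\<alpha> / 2 * (cmod z)\<^sup>2) * (C1 * (1 + cmod z) * cmod (f y))"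
      by (rule mult_left_mono) simp
    moreover have "exp (\<alpha> / 2 * (cmod z)\<^sup>2) * damped (deriv f) z = cmod (deriv f z)"
      by (simp add: damped_def flip: exp_add)
    ultimately have "cmod (deriv f z) \<le> exp (\<alpha> / 2 * (cmod z)\<^sup>2) * (C1 * (1 + cmod z) * cmod (f y))" by linarith
    then have "cmod (deriv f z) \<le> B * cmod (f y)" by (simp only: B_def mult.assoc)
    then have "cmod (deriv f z) powr p \<le> (B * cmod (f y)) powr p" using p_pos by (intro powr_mono2) auto
    also have "\<dots> = B powr p * cmod (f y) powr p" by (rule powr_mult)
    also have "\<dots> \<le> B powr p * (C2 * fpow f)" using 1 by (rule mult_left_mono) simp
    finally show ?thesis by (simp only: mult.assoc)
  qed
  moreover have "B powr p * C2 > 0" using B C2 by simp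
  ultimately show ?thesis by (intro exI[of _ "B powr p * C2"]) simp
qed

text \<open>Covers c2 = 0 as well. Besides continuity it gives that the range lies in
  \<open>fock\<close>, which every later use of \<open>fpow\<close> on images depends on.\<close>

lemma volterra_quadratic_bounded:
  assumes g: "\<And>z. g z = c2 * z\<^sup>2 + c1 * z + c0"
  shows "\<exists>C>0. \<forall>f\<in>fock. volterra g f \<in> fock \<and> fpow (volterra g f) \<le> C * fpow f"
proof -
  have gh: "g holomorphic_on UNIV" and dg: "\<And>z. deriv g z = 2 * c2 * z + c1"
    using quadratic_entire[OF g] by auto
  define B where "B = 2 * cmod c2 + cmod c1"
  have "B \<ge> 0" by (simp add: B_def)
  from fock_integral_primitive_le[OF this] obtain C where C: "C > 0" and le: "\<And>F f b. F holomorphic_on UNIV \<Longrightarrow> f holomorphic_on UNIV \<Longrightarrow>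
    (\<And>z. deriv F z = f z * b z) \<Longrightarrow> (\<And>z. cmod (b z) \<le> B * (1 + cmod z)) \<Longrightarrow> F 0 = 0 \<Longrightarrow>
    fint F \<le> ennreal C * fint f" by metis
  have "volterra g f \<in> fock \<and> fpow (volterra g f) \<le> C * fpow f" if f: "f \<in> fock" for f
  proof -
    note fh = fock_entire[OF f]
    note V = volterra_entire[OF fh gh]
    have "cmod (deriv g z) \<le> B * (1 + cmod z)" for z
    proof -
      have "cmod (deriv g z) \<le> 2 * cmod c2 * cmod z + cmod c1"
        unfolding dg using norm_triangle_ineq[of "2 * c2 * z" c1] by (simp add: norm_mult)
      also have "\<dots> \<le> B * (1 + cmod z)" by (simp add: B_def algebra_simps)
      finally show ?thesis .
    qed
    then have "fint (volterra g f) \<le> ennreal C * fint f"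
      by (intro le[of _ _ "deriv g"] V fh)
    then have "fint (volterra g f) \<le> ennreal (C * fpow f)"
      using C by (simp add: fock_finite[OF f] ennreal_mult')
    then show ?thesis using fint_le_imp[OF V(1), of "C * fpow f"] C by simp
  qed
  then show ?thesis using C by blast
qed

lemma volterra_quadratic_lower_bound:
  assumes g: "\<And>z. g z = c2 * z\<^sup>2 + c1 * z + c0" and c2: "c2 \<noteq> 0"
  shows "\<exists>C>0. \<forall>f\<in>fock. fpow f \<le> C * fpow (volterra g f)"
proof -
  have gh: "g holomorphic_on UNIV" and dg: "\<And>z. deriv g z = 2 * c2 * (z - (- c1 / (2 * c2)))"
    using quadratic_entire[OF g] c2 by (auto simp: algebra_simps)
  have "2 * c2 \<noteq> 0" using c2 by simp
  from fock_integral_le_of_deriv_eq_affine_mult[OF this, of "- c1 / (2 * c2)"]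
  obtain C where C: "C > 0" and le: "\<And>F f. F holomorphic_on UNIV \<Longrightarrow> f holomorphic_on UNIV \<Longrightarrow>
    (\<And>z. deriv F z = f z * (2 * c2 * (z - (- c1 / (2 * c2))))) \<Longrightarrow> fint f \<le> ennreal C * fint F" by metis
  have "fpow f \<le> C * fpow (volterra g f)" if f: "f \<in> fock" for f
  proof -
    note fh = fock_entire[OF f]
    note V = volterra_entire[OF fh gh]
    have T: "volterra g f \<in> fock" using volterra_quadratic_bounded[OF g] f by blast
    have "fint f \<le> ennreal C * fint (volterra g f)"
      by (rule le[OF V(1) fh]) (simp only: V(2) dg)
    then have "fint f \<le> ennreal (C * fpow (volterra g f))"
      using C by (simp add: fock_finite[OF T] ennreal_mult')
    then show ?thesis using fint_le_imp[OF fh] C by simp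
  qed
  then show ?thesis using C by blast
qed

text \<open>The constants correspond by taking p-th powers and roots. The hypothesis on
  \<open>T\<close> keeps \<open>fpow (T f)\<close> from being the default value 0 of an infinite
  integral.\<close>

lemma bounded_below_iff:
  assumes T: "\<And>f. f \<in> fock \<Longrightarrow> T f \<in> fock"
  shows "bounded_below_on_fock p \<alpha> w T \<longleftrightarrow> (\<exists>C>0. \<forall>f\<in>fock. fpow f \<le> C * fpow (T f))"
proof
  assume "bounded_below_on_fock p \<alpha> w T"
  then obtain C where C: "C > 0" and le: "\<And>f. f \<in> fock \<Longrightarrow> ennreal C * fock_norm p \<alpha> w f \<le> fock_norm p \<alpha> w (T f)"
    unfolding bounded_below_on_fock_def by blast
  have "fpow f \<le> (1 / C) powr p * fpow (T f)" if f: "f \<in> fock" for f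
  proof -
    have "ennreal (C * fpow f powr (1 / p)) \<le> ennreal (fpow (T f) powr (1 / p))"
      using le[OF f] C by (simp add: fock_norm_eq f T ennreal_mult')
    then have "C * fpow f powr (1 / p) \<le> fpow (T f) powr (1 / p)" by (simp add: ennreal_le_iff)
    then have "fpow f powr (1 / p) \<le> 1 / C * fpow (T f) powr (1 / p)" using C by (simp add: pos_le_divide_eq mult.commute)
    from powr_mono2[OF less_imp_le[OF p_pos] _ this]
    have "(fpow f powr (1 / p)) powr p \<le> (1 / C * fpow (T f) powr (1 / p)) powr p" by simp
    then show ?thesis using p_pos unfolding powr_mult by (simp add: powr_powr)
  qed
  then show "\<exists>C>0. \<forall>f\<in>fock. fpow f \<le> C * fpow (T f)" using C by (intro exI[of _ "(1 / C) powr p"]) simp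
next
  assume "\<exists>C>0. \<forall>f\<in>fock. fpow f \<le> C * fpow (T f)"
  then obtain C where C: "C > 0" and le: "\<And>f. f \<in> fock \<Longrightarrow> fpow f \<le> C * fpow (T f)" by blast
  define D where "D = (1 / C) powr (1 / p)"
  have D: "D > 0" using C by (simp add: D_def)
  have "ennreal D * fock_norm p \<alpha> w f \<le> fock_norm p \<alpha> w (T f)" if f: "f \<in> fock" for f
  proof -
    have "1 / C * fpow f \<le> fpow (T f)" using le[OF f] C by (simp add: pos_divide_le_eq mult.commute)
    then have "(1 / C * fpow f) powr (1 / p) \<le> fpow (T f) powr (1 / p)"
      using C p_pos by (intro powr_mono2) auto
    then have "D * fpow f powr (1 / p) \<le> fpow (T f) powr (1 / p)" unfolding D_def powr_mult .
    then show ?thesis using D by (simp add: fock_norm_eq f T ennreal_mult'[symmetric] ennreal_leI)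
  qed
  then show "bounded_below_on_fock p \<alpha> w T" unfolding bounded_below_on_fock_def using D by blast
qed

text \<open>The lower bound carries the Cauchy property from the images to the preimages; their
  limit is mapped to \<open>l\<close> by the upper bound and uniqueness of limits.\<close>

lemma volterra_quadratic_closed_range:
  assumes g: "\<And>z. g z = c2 * z\<^sup>2 + c1 * z + c0" and c2: "c2 \<noteq> 0"
  shows "closed_range_on_fock p \<alpha> w (volterra g)"
proof -
  note gh = quadratic_entire(1)[OF g]
  obtain C1 where C1: "C1 > 0" and up: "\<forall>f\<in>fock. volterra g f \<in> fock \<and> fpow (volterra g f) \<le> C1 * fpow f"
    using volterra_quadratic_bounded[OF g] by blast
  obtain C2 where C2: "C2 > 0" and low: "\<forall>f\<in>fock. fpow f \<le> C2 * fpow (volterra g f)"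
    using volterra_quadratic_lower_bound[OF g c2] by blast
  have diff: "(\<lambda>z. volterra g f z - volterra g h z) = volterra g (\<lambda>z. f z - h z)" if "f \<in> fock" "h \<in> fock" for f h
    using volterra_linear(2)[OF fock_entire[OF that(1)] fock_entire[OF that(2)] gh] by simp
  have "l \<in> volterra g ` fock"
    if ran: "range \<sigma> \<subseteq> volterra g ` fock" and lim: "limitin fock.mtopology \<sigma> l sequentially" for \<sigma> l
  proof -
    have "\<forall>n. \<exists>f\<in>fock. \<sigma> n = volterra g f" using ran by auto
    then obtain f where f: "\<And>n. f n \<in> fock" "\<And>n. \<sigma> n = volterra g (f n)" by metis
    have "range \<sigma> \<subseteq> fock" using f up by auto
    from fock.convergent_imp_MCauchy[OF this lim]
    have cau: "\<And>\<epsilon>. \<epsilon> > 0 \<Longrightarrow> \<exists>N. \<forall>n n'. N \<le> n \<longrightarrow> N \<le> n' \<longrightarrow> fpow (\<lambda>z. \<sigma> n z - \<sigma> n' z) < \<epsilon>"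
      unfolding MCauchy_fock_iff by blast
    have "fock.MCauchy f"
      unfolding MCauchy_fock_iff
    proof (intro conjI allI impI)
      fix \<epsilon> :: real assume "\<epsilon> > 0"
      then have "\<epsilon> / C2 > 0" using C2 by simp
      from cau[OF this] obtain N where N: "\<forall>n n'. N \<le> n \<longrightarrow> N \<le> n' \<longrightarrow> fpow (\<lambda>z. \<sigma> n z - \<sigma> n' z) < \<epsilon> / C2" by blast
      have "fpow (\<lambda>z. f n z - f n' z) < \<epsilon>" if "N \<le> n" "N \<le> n'" for n n'
      proof -
        have "fpow (\<lambda>z. f n z - f n' z) \<le> C2 * fpow (volterra g (\<lambda>z. f n z - f n' z))"
          using low fock_diff(1)[OF f(1)[of n] f(1)[of n']] by blast
        also have "volterra g (\<lambda>z. f n z - f n' z) = (\<lambda>z. \<sigma> n z - \<sigma> n' z)"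
          using diff[OF f(1) f(1)] by (simp add: f(2))
        also have "C2 * fpow (\<lambda>z. \<sigma> n z - \<sigma> n' z) < C2 * (\<epsilon> / C2)"
          using N that C2 by (intro mult_strict_left_mono) auto
        finally show ?thesis using C2 by simp
      qed
      then show "\<exists>N. \<forall>n n'. N \<le> n \<longrightarrow> N \<le> n' \<longrightarrow> fpow (\<lambda>z. f n z - f n' z) < \<epsilon>" by blast
    qed (use f in auto)
    then obtain h where h: "limitin fock.mtopology f h sequentially"
      using mcomplete_fock unfolding fock.mcomplete_def by blast
    then have hf: "h \<in> fock" by (simp add: limitin_fock_iff)
    have "limitin fock.mtopology \<sigma> (volterra g h) sequentially"
      unfolding limitin_fock_iff
    proof (intro conjI allI impI)
      show "volterra g h \<in> fock" using up hf by blast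
      fix \<epsilon> :: real assume "\<epsilon> > 0"
      then have "\<epsilon> / C1 > 0" using C1 by simp
      then have "\<forall>\<^sub>F n in sequentially. f n \<in> fock \<and> fpow (\<lambda>z. f n z - h z) < \<epsilon> / C1"
        using h by (simp add: limitin_fock_iff)
      then show "\<forall>\<^sub>F n in sequentially. \<sigma> n \<in> fock \<and> fpow (\<lambda>z. \<sigma> n z - volterra g h z) < \<epsilon>"
      proof eventually_elim
        case (elim n)
        have "fpow (\<lambda>z. \<sigma> n z - volterra g h z) = fpow (volterra g (\<lambda>z. f n z - h z))"
          using diff[OF f(1) hf] by (simp add: f(2))
        also have "\<dots> \<le> C1 * fpow (\<lambda>z. f n z - h z)" using up fock_diff(1)[OF f(1)[of n] hf] by blast
        also have "\<dots> < C1 * (\<epsilon> / C1)" using elim C1 by (intro mult_strict_left_mono) auto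
        finally show ?case using C1 f up by simp
      qed
    qed
    then have "l = volterra g h" using lim fock.limitin_metric_unique trivial_limit_sequentially by blast
    then show ?thesis using hf by blast
  qed
  moreover have "volterra g ` fock \<subseteq> fock" using up by auto
  ultimately show ?thesis
    unfolding closed_range_on_fock_def fock_topology_eq fock.metric_closedin_iff_sequentially_closed by blast
qed

text \<open>Completing the square leaves room for an extra linear term: the Gaussian beats exp((b +
  \<Lambda>/p) |z|) up to a constant, and the remaining exp(-(\<Lambda>/p) |z|) has an integrable
  p-th power. The case b = 0 gives the constants.\<close>

lemma exp_in_fock:
  assumes "b \<ge> 0"
  shows "(\<lambda>z. exp (of_real b * z)) \<in> fock"
proof -
  obtain \<Lambda> where \<Lambda>: "\<Lambda> > 0" and int: "\<And>\<xi>. (\<integral>\<^sup>+z. ennreal (exp (- \<Lambda> * dist z \<xi>)) \<partial>\<mu>) \<le> ennreal (2 * mass \<xi>)"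
    using exp_decay_integral by blast
  let ?f = "\<lambda>z::complex. exp (of_real b * z)"
  have hol: "?f holomorphic_on UNIV" by (intro holomorphic_intros)
  define q where "q = b + \<Lambda> / p"
  define D where "D = exp (q\<^sup>2 / (2 * \<alpha>)) powr p"
  have "damped ?f z powr p \<le> D * exp (- \<Lambda> * dist z 0)" for z
  proof -
    have "0 \<le> (\<alpha> * cmod z - q)\<^sup>2 / (2 * \<alpha>)" using \<alpha>_pos by simp
    also have "\<dots> = q\<^sup>2 / (2 * \<alpha>) + \<alpha> / 2 * (cmod z)\<^sup>2 - q * cmod z"
      using \<alpha>_pos by (simp add: power2_eq_square field_simps)
    finally have "q * cmod z \<le> q\<^sup>2 / (2 * \<alpha>) + \<alpha> / 2 * (cmod z)\<^sup>2" by simp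
    moreover have "b * Re z \<le> b * cmod z" using assms complex_Re_le_cmod by (rule mult_left_mono[rotated])
    ultimately have "b * Re z - \<alpha> / 2 * (cmod z)\<^sup>2 \<le> q\<^sup>2 / (2 * \<alpha>) + - (\<Lambda> / p) * cmod z"
      by (simp add: q_def distrib_right)
    then have "damped ?f z \<le> exp (q\<^sup>2 / (2 * \<alpha>)) * exp (- (\<Lambda> / p) * cmod z)"
      unfolding damped_def norm_exp_eq_Re exp_add[symmetric] by simp
    from powr_mono2[OF less_imp_le[OF p_pos] _ this]
    have "damped ?f z powr p \<le> (exp (q\<^sup>2 / (2 * \<alpha>)) * exp (- (\<Lambda> / p) * cmod z)) powr p" by simp
    also have "\<dots> = D * exp (- (\<Lambda> / p) * cmod z) powr p" unfolding powr_mult D_def ..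
    also have "exp (- (\<Lambda> / p) * cmod z) powr p = exp (- \<Lambda> * dist z 0)"
      using p_pos by (simp add: exp_powr_real)
    finally show ?thesis .
  qed
  then have "fint ?f \<le> (\<integral>\<^sup>+z. ennreal D * ennreal (exp (- \<Lambda> * dist z 0)) \<partial>\<mu>)"
    unfolding fock_integral_eq[OF hol]
    by (intro nn_integral_mono) (simp add: ennreal_mult'[symmetric] D_def ennreal_leI)
  also have "\<dots> = ennreal D * (\<integral>\<^sup>+z. ennreal (exp (- \<Lambda> * dist z 0)) \<partial>\<mu>)"
    by (subst nn_integral_cmult, measurable)
  also have "\<dots> \<le> ennreal D * ennreal (2 * mass 0)" by (intro mult_left_mono int) simp
  also have "\<dots> = ennreal (D * (2 * mass 0))" by (intro ennreal_mult'[symmetric]) (simp add: D_def)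
  finally show ?thesis using mass_pos[of 0] by (intro fint_le_imp(1)[OF hol]) (auto simp: D_def)
qed

text \<open>For \<open>g' = c1\<close> the functions \<open>exp (\<alpha> a z)\<close> with large \<open>a\<close> are almost annihilated: their
  primitives gain a factor \<open>1 / (\<alpha> a)\<close>, and the constant of integration is controlled by the point
  evaluation at \<open>0\<close>.\<close>

lemma volterra_linear_not_bounded_below:
  assumes g: "\<And>z. g z = c1 * z + c0" and c1: "c1 \<noteq> 0" and \<epsilon>: "\<epsilon> > 0"
  shows "\<exists>f\<in>fock. 0 < fpow f \<and> fpow (volterra g f) \<le> \<epsilon> * fpow f"
proof -
  have g': "g z = 0 * z\<^sup>2 + c1 * z + c0" for z by (simp add: g)
  have dg: "deriv g z = c1" for z using quadratic_entire(2)[OF g'] by simp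
  have one: "(\<lambda>z. 1) \<in> fock" using exp_in_fock[of 0] by simp
  obtain C where C: "C > 0" and ev: "\<forall>f\<in>fock. \<forall>z. cmod z \<le> 0 \<longrightarrow> cmod (f z) powr p \<le> C * fpow f"
    using eval_bound[of 0] by blast
  \<comment> \<open>For every f with f 0 = 1, evaluation at 0 gives 1 \<le> C \<open>fpow f\<close>,
    so f - 1 costs at most the factor \<open>Q\<close>. This is uniform over all the exponentials,
    so \<open>Q\<close> can be fixed before \<open>b\<close>.\<close>
  define Q where "Q = 2 powr p * (1 + C * fpow (\<lambda>z. 1))"
  have Q: "Q > 0" using C by (simp add: Q_def add_pos_nonneg)
  \<comment> \<open>Solves (|c1| / b)^p = \<epsilon> / Q.\<close>
  define b where "b = cmod c1 * (Q / \<epsilon>) powr (1 / p)"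
  have b: "b > 0" using c1 Q \<epsilon> by (simp add: b_def)
  define f where "f z = exp (of_real b * z)" for z :: complex
  have f: "f \<in> fock" unfolding f_def using b by (intro exp_in_fock) simp
  have "f 0 = 1" by (simp add: f_def)
  then have 1: "1 \<le> C * fpow f" using bspec[OF ev f] by (metis norm_one norm_zero order_refl powr_one_eq_one)
  have "0 < C * fpow f" using 1 by linarith
  then have pos: "0 < fpow f" using C by (simp add: zero_less_mult_iff)
  have eq: "volterra g f = (\<lambda>z. (c1 / of_real b) * (f z - 1))"
    using b by (intro volterra_eqI) (auto simp: f_def dg intro!: derivative_eq_intros)
  have "fpow (volterra g f) = cmod (c1 / of_real b) powr p * fpow (\<lambda>z. f z - 1)"
    unfolding eq by (rule fock_cmult(2)[OF fock_diff(1)[OF f one]])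
  also have "\<dots> \<le> cmod (c1 / of_real b) powr p * (Q * fpow f)"
  proof (rule mult_left_mono)
    have "fpow (\<lambda>z. f z - 1) \<le> 2 powr p * fpow f + 2 powr p * fpow (\<lambda>z. 1)" by (rule fock_diff(2)[OF f one])
    also have "\<dots> \<le> 2 powr p * fpow f + 2 powr p * (C * fpow f * fpow (\<lambda>z. 1))"
      using mult_right_mono[OF 1, of "fpow (\<lambda>z. 1)"] by simp
    also have "\<dots> = Q * fpow f" by (simp add: Q_def algebra_simps)
    finally show "fpow (\<lambda>z. f z - 1) \<le> Q * fpow f" .
  qed simp
  also have "cmod (c1 / of_real b) powr p = \<epsilon> / Q"
  proof -
    have "cmod (c1 / of_real b) = cmod c1 / b" using b by (simp add: norm_divide)
    also have "\<dots> = (\<epsilon> / Q) powr (1 / p)" using c1 Q \<epsilon> by (simp add: b_def powr_divide)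
    finally have "cmod (c1 / of_real b) = (\<epsilon> / Q) powr (1 / p)" .
    then show ?thesis using Q \<epsilon> p_pos by (simp add: powr_powr)
  qed
  finally have "fpow (volterra g f) \<le> \<epsilon> * fpow f" using Q by simp
  then show ?thesis using f pos by blast
qed

text \<open>The sublevel sets of the inverse of \<open>volterra g\<close> are closed in the range by Fatou's lemma, so
  that Baire's theorem bounds the inverse near some point of a closed range.\<close>

lemma volterra_linear_not_closed_range:
  assumes g: "\<And>z. g z = c1 * z + c0" and c1: "c1 \<noteq> 0"
  shows "\<not> closed_range_on_fock p \<alpha> w (volterra g)"
proof
  assume "closed_range_on_fock p \<alpha> w (volterra g)"
  then have clo: "closedin fock.mtopology (volterra g ` fock)"
    by (simp add: closed_range_on_fock_def fock_topology_eq)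
  have g': "g z = 0 * z\<^sup>2 + c1 * z + c0" for z by (simp add: g)
  have gh: "g holomorphic_on UNIV" and dg: "deriv g z = c1" for z using quadratic_entire[OF g'] by auto
  have T: "volterra g f \<in> fock" if "f \<in> fock" for f using volterra_quadratic_bounded[OF g'] that by blast
  have dT: "deriv (volterra g f) z = f z * c1" if "f \<in> fock" for f z
    using volterra_entire(2)[OF fock_entire[OF that] gh] by (simp add: dg)
  have inj: "f = h" if "f \<in> fock" "h \<in> fock" "volterra g f = volterra g h" for f h
    using dT[OF that(1)] dT[OF that(2)] that(3) c1 by (metis ext mult_right_cancel)
  have sub: "volterra g ` fock \<subseteq> fock" using T by auto
  \<comment> \<open>Closedness of the range enters here: it makes the range a complete metric space,
    as Baire's theorem requires.\<close>
  interpret S: Submetric fock fdist "volterra g ` fock" by standard (rule sub)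
  have comp: "S.sub.mcomplete" by (rule S.closedin_mcomplete_imp_mcomplete[OF clo mcomplete_fock])
  define E where "E n = volterra g ` {f \<in> fock. fpow f \<le> real n}" for n :: nat
  have closedE: "closedin S.sub.mtopology (E n)" for n
    unfolding S.sub.metric_closedin_iff_sequentially_closed
  proof (intro conjI allI impI)
    show "E n \<subseteq> volterra g ` fock" by (auto simp: E_def)
    fix \<sigma> l assume *: "range \<sigma> \<subseteq> E n \<and> limitin S.sub.mtopology \<sigma> l sequentially"
    then have "\<forall>k. \<exists>f. f \<in> fock \<and> fpow f \<le> real n \<and> \<sigma> k = volterra g f" by (auto simp: E_def image_iff subset_iff)
    then obtain f where f: "\<And>k. f k \<in> fock" "\<And>k. fpow (f k) \<le> real n" "\<And>k. \<sigma> k = volterra g (f k)" by metis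
    have lim: "limitin fock.mtopology \<sigma> l sequentially" and "l \<in> volterra g ` fock"
      using * by (auto simp: S.limitin_submetric_iff)
    then obtain h where h: "h \<in> fock" "l = volterra g h" by blast
    \<comment> \<open>Only pointwise convergence of the preimages is available, through derivative
      evaluation; Fatou's lemma needs no more.\<close>
    have "(\<lambda>k. f k z) \<longlonglongrightarrow> h z" for z
    proof (rule LIMSEQ_I)
      fix e :: real assume e: "e > 0"
      obtain C where C: "C > 0" and ev: "\<forall>f\<in>fock. cmod (deriv f z) powr p \<le> C * fpow f"
        using deriv_eval_bound by blast
      define \<epsilon> where "\<epsilon> = (e * cmod c1) powr p / C"
      have "\<epsilon> > 0" using e c1 C by (simp add: \<epsilon>_def)
      then have "\<forall>\<^sub>F k in sequentially. fpow (\<lambda>z. \<sigma> k z - l z) < \<epsilon>"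
        using lim unfolding limitin_fock_iff by (auto elim: eventually_mono)
      then have "\<forall>\<^sub>F k in sequentially. norm (f k z - h z) < e"
      proof eventually_elim
        case (elim k)
        have d: "(\<lambda>z. \<sigma> k z - l z) = volterra g (\<lambda>z. f k z - h z)"
          using volterra_linear(2)[OF fock_entire[OF f(1)[of k]] fock_entire[OF h(1)] gh] by (simp add: f(3) h(2))
        have m: "(\<lambda>z. f k z - h z) \<in> fock" by (rule fock_diff(1)[OF f(1) h(1)])
        have "cmod (deriv (volterra g (\<lambda>z. f k z - h z)) z) powr p \<le> C * fpow (volterra g (\<lambda>z. f k z - h z))"
          using ev T[OF m] by blast
        also have "\<dots> < C * \<epsilon>" using elim C unfolding d by (rule mult_strict_left_mono)
        also have "\<dots> = (e * cmod c1) powr p" using C by (simp add: \<epsilon>_def)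
        finally have "(cmod (f k z - h z) * cmod c1) powr p < (e * cmod c1) powr p"
          unfolding dT[OF m] norm_mult .
        then have "\<not> e * cmod c1 \<le> cmod (f k z - h z) * cmod c1"
          using powr_mono2[of p "e * cmod c1" "cmod (f k z - h z) * cmod c1"] p_pos e by auto
        then show ?case using c1 by simp
      qed
      then show "\<exists>N. \<forall>k\<ge>N. norm (f k z - h z) < e" unfolding eventually_sequentially .
    qed
    then have "fint h \<le> ennreal (real n)"
      using f(1,2) by (intro fint_limit_le[of f h]) (auto intro: fock_entire h simp: fock_finite ennreal_leI)
    then have "fpow h \<le> real n" using fint_le_imp(2)[OF fock_entire[OF h(1)]] by simp
    then show "l \<in> E n" using h by (auto simp: E_def)
  qed
  \<comment> \<open>Every \<open>fpow\<close> is a finite real, so the sets \<open>E n\<close>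
    exhaust the range and cannot all have empty interior.\<close>
  have "\<exists>n. S.sub.mtopology interior_of (E n) \<noteq> {}"
  proof (rule ccontr)
    assume "\<nexists>n. S.sub.mtopology interior_of (E n) \<noteq> {}"
    then have "S.sub.mtopology interior_of \<Union> (range E) = {}"
      using closedE by (intro S.sub.metric_Baire_category_alt comp) auto
    moreover have "\<Union> (range E) = volterra g ` fock"
      using real_arch_simple by (fastforce simp: E_def)
    moreover have "S.sub.mtopology interior_of (volterra g ` fock) = volterra g ` fock"
      using interior_of_topspace[of S.sub.mtopology] by simp
    ultimately show False using exp_in_fock[of 0] by auto
  qed
  then obtain n F0 where "F0 \<in> S.sub.mtopology interior_of (E n)" by blast
  then obtain U where U: "openin S.sub.mtopology U" "F0 \<in> U" "U \<subseteq> E n" by (auto simp: interior_of_def)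
  then obtain r where r: "r > 0" "S.sub.mball F0 r \<subseteq> E n"
    unfolding S.sub.openin_mtopology by blast
  obtain f0 where f0: "f0 \<in> fock" "F0 = volterra g f0" using U by (auto simp: E_def)
  \<comment> \<open>The radius \<open>r\<close>, measured in \<open>fpow\<close> instead of
    \<open>fdist\<close>.\<close>
  define \<epsilon> where "\<epsilon> = r powr (1 / fexp)"
  have \<epsilon>: "\<epsilon> > 0" "\<epsilon> powr fexp = r" using r fexp_pos by (auto simp: \<epsilon>_def powr_powr)
  define B where "B = 2 powr p * real n + 2 powr p * fpow f0"
  have B: "B \<ge> 0" by (simp add: B_def)
  \<comment> \<open>Moves the ball about \<open>F0\<close> to the origin: the image of
    \<open>f0 + f\<close> lies in \<open>E n\<close>, and injectivity identifies
    \<open>f0 + f\<close> with the preimage of small norm provided by \<open>E n\<close>.\<close>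
  have bound: "fpow f \<le> B" if f: "f \<in> fock" and small: "fpow (volterra g f) < \<epsilon>" for f
  proof -
    have m: "(\<lambda>z. f0 z + f z) \<in> fock" by (rule fock_add(1)[OF f0(1) f])
    have "(\<lambda>z. F0 z - volterra g (\<lambda>z. f0 z + f z) z) = (\<lambda>z. (-1) * volterra g f z)"
      using volterra_linear(1)[OF fock_entire[OF f0(1)] fock_entire[OF f] gh] by (simp add: f0(2))
    then have "fpow (\<lambda>z. F0 z - volterra g (\<lambda>z. f0 z + f z) z) < \<epsilon>"
      using small fock_cmult(2)[OF T[OF f], of "-1"] by simp
    then have "fdist F0 (volterra g (\<lambda>z. f0 z + f z)) < r" using fdist_less_iff[OF \<epsilon>(1)] \<epsilon>(2) by simp
    then have "volterra g (\<lambda>z. f0 z + f z) \<in> S.sub.mball F0 r"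
      using m f0 by (simp add: S.sub.in_mball)
    then have "volterra g (\<lambda>z. f0 z + f z) \<in> E n" using r(2) by blast
    then obtain f1 where "f1 \<in> fock" "fpow f1 \<le> real n" "volterra g (\<lambda>z. f0 z + f z) = volterra g f1"
      by (auto simp: E_def)
    then have le: "fpow (\<lambda>z. f0 z + f z) \<le> real n" using inj[OF m] by simp
    have "fpow f = fpow (\<lambda>z. (f0 z + f z) - f0 z)" by simp
    also have "\<dots> \<le> 2 powr p * fpow (\<lambda>z. f0 z + f z) + 2 powr p * fpow f0" by (rule fock_diff(2)[OF m f0(1)])
    also have "\<dots> \<le> B" using le by (simp add: B_def)
    finally show ?thesis .
  qed
  \<comment> \<open>The ratio is such that rescaling f to \<open>fpow\<close> equal to B + 1, just
    beyond the bound \<open>B\<close>, leaves its image at most \<epsilon> / 2.\<close>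
  have "\<epsilon> / (2 * (B + 1)) > 0" using \<epsilon> B by simp
  from volterra_linear_not_bounded_below[OF g c1 this]
  obtain f where f: "f \<in> fock" "0 < fpow f" "fpow (volterra g f) \<le> \<epsilon> / (2 * (B + 1)) * fpow f" by blast
  define b where "b = ((B + 1) / fpow f) powr (1 / p)"
  have bp: "cmod (of_real b) powr p = (B + 1) / fpow f"
    using f(2) B p_pos by (simp add: b_def powr_powr)
  have "fpow (\<lambda>z. of_real b * f z) = B + 1"
    using fock_cmult(2)[OF f(1), of "of_real b"] f(2) bp by simp
  moreover have "fpow (volterra g (\<lambda>z. of_real b * f z)) < \<epsilon>"
  proof -
    have "fpow (volterra g (\<lambda>z. of_real b * f z)) = (B + 1) / fpow f * fpow (volterra g f)"
      unfolding volterra_linear(3)[OF fock_entire[OF f(1)] fock_entire[OF f(1)] gh] fock_cmult(2)[OF T[OF f(1)]] bp ..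
    also have "\<dots> \<le> (B + 1) / fpow f * (\<epsilon> / (2 * (B + 1)) * fpow f)"
      using f B by (intro mult_left_mono) auto
    also have "\<dots> = \<epsilon> / 2"
    proof -
      have "D / F * (\<epsilon> / (2 * D) * F) = \<epsilon> / 2" if "D > 0" "F > 0" for D F :: real using that by simp
      from this[of "B + 1" "fpow f"] show ?thesis using f(2) B by simp
    qed
    finally show ?thesis using \<epsilon>(1) by simp
  qed
  ultimately show False using bound[OF fock_cmult(1)[OF f(1), of "of_real b"]] by simp
qed

end

theorem theorem5p3:
  fixes p \<alpha> :: real and w :: "complex \<Rightarrow> real" and g :: "complex \<Rightarrow> complex"
    and c0 c1 c2 :: complex
  assumes "0 < p" and "0 < \<alpha>"
    and "w \<in> A_inf_restricted"
    and "\<And>z. g z = c2 * z\<^sup>2 + c1 * z + c0"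
    and "cmod c1 + cmod c2 > 0"
  shows "(closed_range_on_fock p \<alpha> w (volterra g) \<longleftrightarrow> bounded_below_on_fock p \<alpha> w (volterra g))
    \<and> (bounded_below_on_fock p \<alpha> w (volterra g) \<longleftrightarrow> c2 \<noteq> 0)"
proof -
  obtain R c \<kappa> where *: "R > 0" "c > 0" "\<kappa> > 0" "is_weight w"
    "\<And>z z0 \<rho>. \<rho> > 0 \<Longrightarrow> cball z \<rho> \<subseteq> cball z0 R \<Longrightarrow>
      c * \<rho> powr \<kappa> * measure (weight_measure w) (cball z0 R) \<le> measure (weight_measure w) (cball z \<rho>)"
    "\<And>z. 0 < measure (weight_measure w) (cball z R)"
    using A_inf_restricted_ball_growth[OF assms(3)] by blast
  interpret fock_weight w R c \<kappa> p \<alpha>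
    using * assms(1,2) by unfold_locales auto
  have bb: "bounded_below_on_fock p \<alpha> w (volterra g) \<longleftrightarrow> (\<exists>C>0. \<forall>f\<in>fock. fpow f \<le> C * fpow (volterra g f))"
    using volterra_quadratic_bounded[OF assms(4)] by (intro bounded_below_iff) blast
  show ?thesis
  proof (cases "c2 = 0")
    case False
    then show ?thesis
      using bb volterra_quadratic_lower_bound[OF assms(4) False] volterra_quadratic_closed_range[OF assms(4) False]
      by simp
  next
    case True
    then have g: "\<And>z. g z = c1 * z + c0" and c1: "c1 \<noteq> 0" using assms(4,5) by auto
    have "\<not> bounded_below_on_fock p \<alpha> w (volterra g)"
    proof
      assume "bounded_below_on_fock p \<alpha> w (volterra g)"
      then obtain C where C: "C > 0" "\<forall>f\<in>fock. fpow f \<le> C * fpow (volterra g f)" using bb by blast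
      then have "1 / (2 * C) > 0" by simp
      from volterra_linear_not_bounded_below[OF g c1 this] obtain f
        where f: "f \<in> fock" "0 < fpow f" "fpow (volterra g f) \<le> 1 / (2 * C) * fpow f" by blast
      have "fpow f \<le> C * fpow (volterra g f)" using C f by blast
      also have "\<dots> \<le> C * (1 / (2 * C) * fpow f)" using C f by (intro mult_left_mono) auto
      also have "\<dots> = fpow f / 2" using C by simp
      finally show False using f(2) by simp
    qed
    then show ?thesis using True volterra_linear_not_closed_range[OF g c1] by simp
  qed
qed

end
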